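(* The orbit counting algorithm (the explicit procedure, Steps (1)–(6), given in the context) gives the number of orbits of the action of the pairings $\{g_i\}_{i=1}^k$ on $[1,\dots,N]$ in time bounded by a polynomial in $k\log N$.
   Context: **Pairings and orbits.** Intervals are intervals of integers, $[a,b]=\{a,a+1,\dots,b\}$, of width $b-a+1$. The input is $N$ and a collection of pairings $g_i:[a_i,b_i]\to[c_i,d_i]$, $1\le i\le k$, between subintervals of $[1,N]$. A pairing is a bijection that is either increasing (orientation preserving: $a\mapsto c$, $b\mapsto d$) or decreasing (orientation reversing: $a\mapsto d$, $b\mapsto c$). Of the two paired intervals, the left one $[a,b]$ ($a<c$) is called the domain and $[c,d]$ the range. An orientation preserving pairing has translation distance $t=c-a=d-b$. The pairings generate a pseudogroup under composition where defined, inverses, and restriction to subintervals. The orbits are the equivalence classes into which this action divides $[1,N]$. **Terminology.** $N'$ denotes the current size of the interval, initially $N$. An interval is static if it meets neither the domain nor the range of any pairing. A pairing $g_i$ is maximal if $d_i=N'$ and $[c_i,N']$ contains the range of any other pairing with an endpoint at $N'$; more precisely, it is maximal in the lexicographical order on $(d_i,-c_i,-a_i,-\text{orientation})$, so that it has the highest upper endpoint, among those the widest range, and among those the biggest translation distance (if orientation preserving). A pairing $g:[a,b]\to[c,d]$ is periodic with period $t$ if it is orientation preserving with translation distance $t$ and $a<c=a+t\le b+1$; then $[a,d]$ is its periodic interval. **Operations.** - Periodic merger: if $g_1,g_2$ are periodic with periods $t_1,t_2$ and overlapping periodic intervals $R_1,R_2$, and width$(R_1\cap R_2)\ge t_1+t_2$,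 replace $g_1,g_2$ by a single periodic pairing with periodic interval $R_1\cup R_2$ and period $\mathrm{GCD}(t_1,t_2)$. - Contraction of a static interval $[r,s]$: eliminate it, replace $[1,N']$ by $[1,N'-(s-r+1)]$, and alter each pairing by replacing any point $x$ of a domain or range lying to the right of $s$ by $x-(s-r+1)$. - Trimming of an orientation reversing pairing $g:[a,b]\to[c,d]$ with $b\ge c$: replace $g$ by its restriction $g':[a,(a+d)/2)\to((a+d)/2,d]$. - Truncation: suppose $g:[a,b]\to[c,N']$ is a pairing and $M$ satisfies $c\le M+1\le N'$, with all points of $[M+1,N']$ in the range of no pairing other than $g$. Replace $[1,N']$ by $[1,M]$, leaving the other pairings unchanged. If $c=M+1$, eliminate $g$. Otherwise, if $g$ is orientation preserving, replace it by $g':[a,b-(N'-M)]\to[c,M]$ (this is allowed even if $[M+1,N']$ meets both range and domain of $g$). If $g$ is orientation reversing, truncation is applied only when $b<c$ and $[M+1,N']$ is disjoint from the domains and ranges of all other pairings, and $g$ is replaced by its restriction with domain $[a+N'-M,b]$ and range $[c,M]$. - Transmission of $g_2$ by $g_1$, where the range $[c_2,d_2]$ of $g_2$ is contained in the range of $g_1$: if $g_1$ is orientation reversing with overlapping domain and range, first trim $g_1$. Let $r=1$ if $g_1$ is orientation reversing; otherwise let $r\ge1$ be the largest integer such that $g_1^{-r+1}([c_2,d_2])$ is contained in the range of $g_1$. If the domain $[a_2,b_2]$ of $g_2$ is not contained in the range of $g_1$, replace $g_2$ by $g_1^{-r}\circ g_2$. If it is contained in the range of $g_1$, replace $g_2$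 by $g_1^{-r}\circ g_2\circ g_1^{s}:g_1^{-s}([a_2,b_2])\to g_1^{-r}([c_2,d_2])$, where $s=1$ if $g_1$ is orientation reversing, and otherwise $s\ge1$ is the largest integer such that $g_1^{-s+1}([a_2,b_2])$ is contained in the range of $g_1$. **Orbit counting algorithm.** Set the orbit counter to zero. Repeat the following steps, reducing $N'$ and $k$, until no points remain. (1) Delete any pairings that are restrictions of the identity. (2) Make any possible contractions and, if any exist, increment the orbit counter by the sum of the numbers of points deleted by the contractions. If the number of pairings remaining is zero, output the number of orbits (the value of the counter) and stop. (3) Trim all orientation reversing pairings whose domain and range overlap. (4) Search for pairs of periodic pairings $g_i,g_j$ satisfying the condition for a periodic merger. If any such pair exists, perform the merger, replacing $g_i,g_j$ by a single periodic pairing with translation distance $\mathrm{GCD}(t_i,t_j)$ acting on the union of their domains and ranges. Repeat until no mergers can be performed. (5) Find a maximal $g_i$. For each $g_j\ne g_i$ whose range is contained in $[c_i,N']$, transmit $g_j$ by $g_i$. (6) Find the smallest value of $c$ such that the interval $[c,N']$ intersects the range of exactly one pairing and is contained in that range. Truncate that pairing, removing the points of $[c,N']$. *)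

theory Defs
  imports
    "HOL-Library.Log_Nat"
    "HOL-Library.Monad_Syntax"
    "HOL-Computational_Algebra.Polynomial"
begin

section \<open>Pairings, the pseudogroup they generate, and its orbits\<close>

text \<open>
  \<open>Pairing a b c d p\<close> stands for the pairing \<open>[a,b] \<rightarrow> [c,d]\<close>, which is orientation preserving
  iff \<open>p\<close> holds. A pairing between one-point intervals is both increasing and decreasing; here
  it carries either flag.
\<close>

datatype pairing =
  Pairing (dom_lo: int) (dom_hi: int) (ran_lo: int) (ran_hi: int) (preserving: bool)

fun pairing_map :: "pairing \<Rightarrow> int \<Rightarrow> int" where
  "pairing_map (Pairing a b c d p) x = (if p then c + (x - a) else d - (x - a))"

definition pairing_graph :: "pairing \<Rightarrow> (int \<times> int) set" where
  "pairing_graph g = {(x, pairing_map g x) | x. x \<in> {dom_lo g..dom_hi g}}"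

text \<open>
  The domain is the left one of the two paired intervals. The case \<open>a = c\<close> (restrictions of the
  identity, reflections of an interval) is allowed.
\<close>

fun pairing_on :: "int \<Rightarrow> pairing \<Rightarrow> bool" where
  "pairing_on N (Pairing a b c d p) \<longleftrightarrow>
     1 \<le> a \<and> a \<le> b \<and> a \<le> c \<and> d \<le> N \<and> d - c = b - a"

text \<open>
  The elements of the pseudogroup are partial injections of \<open>[1,N]\<close>, represented by their
  graphs. \<open>h O h'\<close> is the composite that applies \<open>h\<close> first, where defined.
\<close>

inductive_set pseudogroup :: "int \<Rightarrow> pairing list \<Rightarrow> (int \<times> int) set set"
  for N :: int and gs :: "pairing list" where
  identity: "Id_on {1..N} \<in> pseudogroup N gs"
| generator: "g \<in> set gs \<Longrightarrow> pairing_graph g \<in> pseudogroup N gs"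
| composition: "h \<in> pseudogroup N gs \<Longrightarrow> h' \<in> pseudogroup N gs \<Longrightarrow> h O h' \<in> pseudogroup N gs"
| inverse: "h \<in> pseudogroup N gs \<Longrightarrow> h\<inverse> \<in> pseudogroup N gs"
| restriction: "h \<in> pseudogroup N gs \<Longrightarrow> h \<inter> ({r..s} \<times> UNIV) \<in> pseudogroup N gs"

definition orbit_relation :: "int \<Rightarrow> pairing list \<Rightarrow> (int \<times> int) set" where
  "orbit_relation N gs = {(x, y). \<exists>h \<in> pseudogroup N gs. (x, y) \<in> h}"

definition orbits :: "int \<Rightarrow> pairing list \<Rightarrow> int set set" where
  "orbits N gs = {1..N} // orbit_relation N gs"


section \<open>Time accounting\<close>

text \<open>
  A value together with the number of bit operations spent on computing it. Integers are written
  in binary: addition, subtraction and comparison are charged linearly in the operand lengths;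
  multiplication and division are charged the product of the lengths (schoolbook methods); the
  greatest common divisor is computed by Euclid's algorithm. Each visit of a list cell and each
  call is charged at least one unit. The only operations free of charge are a bounded number, per
  charged unit, of manipulations of references and truth values.
\<close>

datatype 'a timed = Timed (val: 'a) (cost: nat)

definition bind_timed :: "'a timed \<Rightarrow> ('a \<Rightarrow> 'b timed) \<Rightarrow> 'b timed" where
  "bind_timed m f = (case m of Timed x s \<Rightarrow> case f x of Timed y t \<Rightarrow> Timed y (s + t))"

adhoc_overloading Monad_Syntax.bind \<rightleftharpoons> bind_timed

lemma bind_timed_cong [fundef_cong]:
  assumes "m = m'" and "\<And>x. x = val m' \<Longrightarrow> f x = f' x"
  shows "bind_timed m f = bind_timed m' f'"
  using assms by (auto simp: bind_timed_def split: timed.splits)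

lemma val_bind_timed [simp]: "val (bind_timed m f) = val (f (val m))"
  by (simp add: bind_timed_def split: timed.splits)

lemma cost_bind_timed [simp]: "cost (bind_timed m f) = cost m + cost (f (val m))"
  by (simp add: bind_timed_def split: timed.splits)

definition return_t :: "'a \<Rightarrow> 'a timed" where
  "return_t x = Timed x 1"

definition bits :: "int \<Rightarrow> nat" where
  "bits x = nat (bitlen \<bar>x\<bar>) + 1"

definition add_t :: "int \<Rightarrow> int \<Rightarrow> int timed" where
  "add_t x y = Timed (x + y) (bits x + bits y)"

definition sub_t :: "int \<Rightarrow> int \<Rightarrow> int timed" where
  "sub_t x y = Timed (x - y) (bits x + bits y)"

definition mult_t :: "int \<Rightarrow> int \<Rightarrow> int timed" where
  "mult_t x y = Timed (x * y) (bits x * bits y)"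

definition div_t :: "int \<Rightarrow> int \<Rightarrow> int timed" where
  "div_t x y = Timed (x div y) (bits x * bits y)"

definition mod_t :: "int \<Rightarrow> int \<Rightarrow> int timed" where
  "mod_t x y = Timed (x mod y) (bits x * bits y)"

definition eq_t :: "int \<Rightarrow> int \<Rightarrow> bool timed" where
  "eq_t x y = Timed (x = y) (bits x + bits y)"

definition le_t :: "int \<Rightarrow> int \<Rightarrow> bool timed" where
  "le_t x y = Timed (x \<le> y) (bits x + bits y)"

definition less_t :: "int \<Rightarrow> int \<Rightarrow> bool timed" where
  "less_t x y = Timed (x < y) (bits x + bits y)"

definition max_t :: "int \<Rightarrow> int \<Rightarrow> int timed" where
  "max_t x y = do { l \<leftarrow> le_t x y; return_t (if l then y else x) }"

definition min_t :: "int \<Rightarrow> int \<Rightarrow> int timed" where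
  "min_t x y = do { l \<leftarrow> le_t x y; return_t (if l then x else y) }"

function gcd_t :: "int \<Rightarrow> int \<Rightarrow> int timed" where
  "gcd_t x y = do {
     z \<leftarrow> eq_t y 0;
     if z then return_t x
     else do { r \<leftarrow> mod_t x y; gcd_t y r } }"
  by pat_completeness auto
termination
  by (relation "measure (\<lambda>(x, y). nat \<bar>y\<bar>)")
    (auto simp: eq_t_def mod_t_def abs_mod_less)

declare gcd_t.simps [simp del]

fun map_t :: "('a \<Rightarrow> 'b timed) \<Rightarrow> 'a list \<Rightarrow> 'b list timed" where
  "map_t f [] = return_t []"
| "map_t f (x # xs) = do { y \<leftarrow> f x; ys \<leftarrow> map_t f xs; return_t (y # ys) }"

fun filter_t :: "('a \<Rightarrow> bool timed) \<Rightarrow> 'a list \<Rightarrow> 'a list timed" where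
  "filter_t f [] = return_t []"
| "filter_t f (x # xs) =
     do { keep \<leftarrow> f x; ys \<leftarrow> filter_t f xs; return_t (if keep then x # ys else ys) }"


section \<open>The operations\<close>

fun non_identity_t :: "pairing \<Rightarrow> bool timed" where
  "non_identity_t (Pairing a b c d p) = do {
     same \<leftarrow> eq_t a c;
     point \<leftarrow> eq_t a b;
     return_t (\<not> (same \<and> (p \<or> point))) }"

definition delete_identities_t :: "pairing list \<Rightarrow> pairing list timed" where
  "delete_identities_t gs = filter_t non_identity_t gs"

definition shift_left_t :: "int \<Rightarrow> int \<Rightarrow> int \<Rightarrow> int timed" where
  "shift_left_t s w x = do { right \<leftarrow> less_t s x; if right then sub_t x w else return_t x }"

fun shift_pairing_t :: "int \<Rightarrow> int \<Rightarrow> pairing \<Rightarrow> pairing timed" where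
  "shift_pairing_t s w (Pairing a b c d p) = do {
     a' \<leftarrow> shift_left_t s w a;
     b' \<leftarrow> shift_left_t s w b;
     c' \<leftarrow> shift_left_t s w c;
     d' \<leftarrow> shift_left_t s w d;
     return_t (Pairing a' b' c' d' p) }"

text \<open>Contraction of \<open>[r,s]\<close>; also returns the width of \<open>[r,s]\<close>.\<close>

definition contract_t :: "int \<Rightarrow> int \<Rightarrow> int \<Rightarrow> pairing list \<Rightarrow> (int \<times> int \<times> pairing list) timed" where
  "contract_t r s N gs = do {
     w' \<leftarrow> sub_t s r;
     w \<leftarrow> add_t w' 1;
     gs' \<leftarrow> map_t (shift_pairing_t s w) gs;
     N' \<leftarrow> sub_t N w;
     return_t (w, N', gs') }"

text \<open>
  \<open>cover_end_t q gs\<close> exceeds \<open>q\<close> iff some domain or range contains \<open>q\<close>; it is then the largest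
  \<open>h + 1\<close> for such an interval \<open>[l,h]\<close>, and otherwise it is \<open>q\<close>.
\<close>

definition pass_t :: "int \<Rightarrow> int \<Rightarrow> int \<Rightarrow> int \<Rightarrow> int timed" where
  "pass_t q l h e = do {
     x \<leftarrow> le_t l q;
     y \<leftarrow> le_t q h;
     if x \<and> y then do { h' \<leftarrow> add_t h 1; max_t e h' } else return_t e }"

fun cover_end_t :: "int \<Rightarrow> pairing list \<Rightarrow> int timed" where
  "cover_end_t q [] = return_t q"
| "cover_end_t q (Pairing a b c d p # gs) = do {
     e \<leftarrow> cover_end_t q gs;
     e' \<leftarrow> pass_t q a b e;
     pass_t q c d e' }"

text \<open>The least element of \<open>[q+1,N]\<close> at which a domain or range starts, or \<open>N + 1\<close>.\<close>

definition nearer_t :: "int \<Rightarrow> int \<Rightarrow> int \<Rightarrow> int timed" where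
  "nearer_t q l n = do {
     right \<leftarrow> less_t q l;
     if right then min_t l n else return_t n }"

fun next_start_t :: "int \<Rightarrow> int \<Rightarrow> pairing list \<Rightarrow> int timed" where
  "next_start_t q N [] = add_t N 1"
| "next_start_t q N (Pairing a b c d p # gs) = do {
     n \<leftarrow> next_start_t q N gs;
     n' \<leftarrow> nearer_t q a n;
     nearer_t q c n' }"

lemma next_start_t_greater:
  assumes "q \<le> N"
  shows "q < val (next_start_t q N gs)"
  using assms
  by (induction q N gs rule: next_start_t.induct)
    (auto simp: nearer_t_def add_t_def less_t_def min_t_def le_t_def return_t_def)

text \<open>
  A sweep from left to right that contracts every maximal static interval it meets; no point of
  \<open>[1,q-1]\<close> is static any more. The last argument is the orbit counter.
\<close>

function contract_from_t ::
    "int \<Rightarrow> int \<Rightarrow> pairing list \<Rightarrow> int \<Rightarrow> (int \<times> pairing list \<times> int) timed" where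
  "contract_from_t q N gs cnt = do {
     finished \<leftarrow> less_t N q;
     if finished then return_t (N, gs, cnt)
     else do {
       e \<leftarrow> cover_end_t q gs;
       covered \<leftarrow> less_t q e;
       if covered then contract_from_t e N gs cnt
       else do {
         n \<leftarrow> next_start_t q N gs;
         s \<leftarrow> sub_t n 1;
         (w, N', gs') \<leftarrow> contract_t q s N gs;
         cnt' \<leftarrow> add_t cnt w;
         contract_from_t q N' gs' cnt' } } }"
  by pat_completeness auto
termination
proof (relation "measure (\<lambda>(q, N, gs, cnt). nat (N + 1 - q))", goal_cases)
  case 1
  show ?case by simp
next
  case (2 q N gs cnt finished e covered)
  then show ?case by (auto simp: less_t_def)
next
  case (3 q N gs cnt finished e covered n s x w y N' gs' cnt')
  have "q < n" using 3 next_start_t_greater[of q N gs] by (auto simp: less_t_def)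
  moreover have "N' = N - (n - q)"
    using 3 by (auto simp: contract_t_def sub_t_def add_t_def return_t_def)
  ultimately show ?case using 3 by (auto simp: less_t_def)
qed

declare contract_from_t.simps [simp del]

text \<open>The integer points of \<open>[a,(a+d)/2)\<close> and of \<open>((a+d)/2,d]\<close>.\<close>

fun trim_t :: "pairing \<Rightarrow> pairing timed" where
  "trim_t (Pairing a b c d p) = do {
     overlap \<leftarrow> le_t c b;
     if \<not> p \<and> overlap then do {
       m \<leftarrow> add_t a d;
       m' \<leftarrow> sub_t m 1;
       b' \<leftarrow> div_t m' 2;
       h \<leftarrow> div_t m 2;
       c' \<leftarrow> add_t h 1;
       return_t (Pairing a b' c' d False) }
     else return_t (Pairing a b c d p) }"

fun periodic_t :: "pairing \<Rightarrow> bool timed" where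
  "periodic_t (Pairing a b c d p) = do {
     x \<leftarrow> less_t a c;
     b' \<leftarrow> add_t b 1;
     y \<leftarrow> le_t c b';
     return_t (p \<and> x \<and> y) }"

text \<open>
  \<open>merge_t g h\<close> is \<open>None\<close> if \<open>g\<close> and \<open>h\<close> do not satisfy the condition for a periodic merger. The
  periodic intervals overlap as soon as their intersection has the required positive width. The
  periodic pairing with period \<open>t\<close> and periodic interval \<open>[l,u]\<close> is \<open>[l,u-t] \<rightarrow> [l+t,u]\<close>.
\<close>

fun merge_t :: "pairing \<Rightarrow> pairing \<Rightarrow> pairing option timed" where
  "merge_t (Pairing a b c d p) (Pairing a' b' c' d' p') = do {
     x \<leftarrow> periodic_t (Pairing a b c d p);
     y \<leftarrow> periodic_t (Pairing a' b' c' d' p');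
     t1 \<leftarrow> sub_t c a;
     t2 \<leftarrow> sub_t c' a';
     lo \<leftarrow> max_t a a';
     hi \<leftarrow> min_t d d';
     w' \<leftarrow> sub_t hi lo;
     w \<leftarrow> add_t w' 1;
     t12 \<leftarrow> add_t t1 t2;
     z \<leftarrow> le_t t12 w;
     if x \<and> y \<and> z then do {
       t \<leftarrow> gcd_t t1 t2;
       l \<leftarrow> min_t a a';
       u \<leftarrow> max_t d d';
       l' \<leftarrow> add_t l t;
       u' \<leftarrow> sub_t u t;
       return_t (Some (Pairing l u' l' u True)) }
     else return_t None }"

fun merge_with_t :: "pairing \<Rightarrow> pairing list \<Rightarrow> pairing list option timed" where
  "merge_with_t g [] = return_t None"
| "merge_with_t g (h # hs) = do {
     m \<leftarrow> merge_t g h;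
     case m of
       Some g' \<Rightarrow> return_t (Some (g' # hs))
     | None \<Rightarrow> do { r \<leftarrow> merge_with_t g hs; return_t (map_option ((#) h) r) } }"

fun merge_first_t :: "pairing list \<Rightarrow> pairing list option timed" where
  "merge_first_t [] = return_t None"
| "merge_first_t (g # gs) = do {
     m \<leftarrow> merge_with_t g gs;
     case m of
       Some gs' \<Rightarrow> return_t (Some gs')
     | None \<Rightarrow> do { r \<leftarrow> merge_first_t gs; return_t (map_option ((#) g) r) } }"

lemma merge_with_t_length:
  "val (merge_with_t g hs) = Some gs \<Longrightarrow> length gs = length hs"
  by (induction g hs arbitrary: gs rule: merge_with_t.induct)
    (auto simp: return_t_def split: option.splits)

lemma merge_first_t_length:
  "val (merge_first_t gs) = Some gs' \<Longrightarrow> length gs' < length gs"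
  by (induction gs arbitrary: gs' rule: merge_first_t.induct)
    (auto simp: return_t_def dest: merge_with_t_length split: option.splits)

function merge_all_t :: "pairing list \<Rightarrow> pairing list timed" where
  "merge_all_t gs = do {
     m \<leftarrow> merge_first_t gs;
     case m of None \<Rightarrow> return_t gs | Some gs' \<Rightarrow> merge_all_t gs' }"
  by pat_completeness auto
termination
  by (relation "measure length") (auto dest: merge_first_t_length[OF sym])

declare merge_all_t.simps [simp del]

text \<open>
  Strict lexicographic order on \<open>(d, -c, -a, -orientation)\<close>, where the orientation is \<open>1\<close> for
  orientation preserving and \<open>-1\<close> for orientation reversing pairings.
\<close>

fun lex_less_t :: "pairing \<Rightarrow> pairing \<Rightarrow> bool timed" where
  "lex_less_t (Pairing a b c d p) (Pairing a' b' c' d' p') = do {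
     dl \<leftarrow> less_t d d';
     de \<leftarrow> eq_t d d';
     cl \<leftarrow> less_t c' c;
     ce \<leftarrow> eq_t c' c;
     al \<leftarrow> less_t a' a;
     ae \<leftarrow> eq_t a' a;
     return_t (dl \<or> de \<and> (cl \<or> ce \<and> (al \<or> ae \<and> p \<and> \<not> p'))) }"

text \<open>
  A maximal element of \<open>g # gs\<close>, and the list of the other elements. When the algorithm calls this
  on the interval \<open>[1,N]\<close>, no point is static except possibly midpoints removed by trimming, which
  lie to the left of \<open>N\<close>; so the upper endpoint of the maximal pairing is \<open>N\<close>.
\<close>

fun select_maximal_t :: "pairing \<Rightarrow> pairing list \<Rightarrow> (pairing \<times> pairing list) timed" where
  "select_maximal_t g [] = return_t (g, [])"
| "select_maximal_t g (h # hs) = do {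
     l \<leftarrow> lex_less_t g h;
     (m, rest) \<leftarrow> select_maximal_t (if l then h else g) hs;
     return_t (m, (if l then g else h) # rest) }"

text \<open>Inverts the pairing if necessary, so that the left interval becomes the domain.\<close>

fun orient_t :: "pairing \<Rightarrow> pairing timed" where
  "orient_t (Pairing a b c d p) = do {
     l \<leftarrow> le_t a c;
     return_t (if l then Pairing a b c d p else Pairing c d a b p) }"

text \<open>
  The displacement \<open>r * t\<close> of \<open>[x,y]\<close> under the \<open>r\<close>-th inverse power of an orientation preserving
  pairing with translation distance \<open>t\<close> and range \<open>[c,d]\<close>, where \<open>[x,y] \<subseteq> [c,d]\<close>. The largest \<open>r\<close>
  with \<open>c \<le> x - (r - 1) * t\<close> is \<open>(x - c) div t + 1\<close>.
\<close>

definition displacement_t :: "int \<Rightarrow> int \<Rightarrow> int \<Rightarrow> int timed" where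
  "displacement_t t c x = do {
     y \<leftarrow> sub_t x c;
     q \<leftarrow> div_t y t;
     r \<leftarrow> add_t q 1;
     mult_t r t }"

text \<open>
  Transmission of the second pairing by the first one. The inverse of an orientation reversing
  \<open>[a,b] \<rightarrow> [c,d]\<close> is \<open>x \<mapsto> a + d - x\<close>; composing with it on one side flips the orientation.
\<close>

fun transmit_trimmed_t :: "pairing \<Rightarrow> pairing \<Rightarrow> pairing timed" where
  "transmit_trimmed_t (Pairing a1 b1 c1 d1 p1) (Pairing a2 b2 c2 d2 p2) = do {
     x \<leftarrow> le_t c1 a2;
     y \<leftarrow> le_t b2 d1;
     if p1 then do {
       t \<leftarrow> sub_t c1 a1;
       u \<leftarrow> displacement_t t c1 c2;
       c \<leftarrow> sub_t c2 u;
       d \<leftarrow> sub_t d2 u;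
       if x \<and> y then do {
         v \<leftarrow> displacement_t t c1 a2;
         a \<leftarrow> sub_t a2 v;
         b \<leftarrow> sub_t b2 v;
         orient_t (Pairing a b c d p2) }
       else orient_t (Pairing a2 b2 c d p2) }
     else do {
       m \<leftarrow> add_t a1 d1;
       c \<leftarrow> sub_t m d2;
       d \<leftarrow> sub_t m c2;
       if x \<and> y then do {
         a \<leftarrow> sub_t m b2;
         b \<leftarrow> sub_t m a2;
         orient_t (Pairing a b c d p2) }
       else orient_t (Pairing a2 b2 c d (\<not> p2)) } }"

definition transmit_t :: "pairing \<Rightarrow> pairing \<Rightarrow> pairing timed" where
  "transmit_t g1 g2 = do { g \<leftarrow> trim_t g1; transmit_trimmed_t g g2 }"

definition transmit_if_t :: "int \<Rightarrow> pairing \<Rightarrow> pairing \<Rightarrow> pairing timed" where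
  "transmit_if_t N g h = do {
     x \<leftarrow> le_t (ran_lo g) (ran_lo h);
     y \<leftarrow> le_t (ran_hi h) N;
     if x \<and> y then transmit_t g h else return_t h }"

fun transmit_all_t :: "int \<Rightarrow> pairing list \<Rightarrow> pairing list timed" where
  "transmit_all_t N [] = return_t []"
| "transmit_all_t N (g # gs) = do {
     (m, rest) \<leftarrow> select_maximal_t g gs;
     rest' \<leftarrow> map_t (transmit_if_t N m) rest;
     return_t (m # rest') }"

text \<open>The first pairing whose range contains \<open>N\<close>, and the list of the other pairings.\<close>

fun extract_top_t :: "int \<Rightarrow> pairing list \<Rightarrow> (pairing \<times> pairing list) option timed" where
  "extract_top_t N [] = return_t None"
| "extract_top_t N (g # gs) = do {
     top \<leftarrow> eq_t (ran_hi g) N;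
     if top then return_t (Some (g, gs))
     else do {
       r \<leftarrow> extract_top_t N gs;
       return_t (map_option (\<lambda>(h, hs). (h, g # hs)) r) } }"

fun max_end_t :: "pairing list \<Rightarrow> int timed" where
  "max_end_t [] = return_t 0"
| "max_end_t (g # gs) = do { m \<leftarrow> max_end_t gs; max_t m (ran_hi g) }"

text \<open>
  Truncation of the pairing given as second argument, removing \<open>[M+1,N]\<close>. The result consists of
  the remaining pairing, if any, and the other pairings, given as third argument.
\<close>

fun truncate_t :: "int \<Rightarrow> int \<Rightarrow> pairing \<Rightarrow> pairing list \<Rightarrow> (int \<times> pairing list) timed" where
  "truncate_t N M (Pairing a b c d p) hs = do {
     M' \<leftarrow> add_t M 1;
     all \<leftarrow> eq_t c M';
     if all then return_t (M, hs)
     else do {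
       w \<leftarrow> sub_t N M;
       if p then do { b' \<leftarrow> sub_t b w; return_t (M, Pairing a b' c M p # hs) }
       else do { a' \<leftarrow> add_t a w; return_t (M, Pairing a' b c M p # hs) } } }"

text \<open>
  If \<open>[e,N]\<close> is nonempty, contained in the range \<open>[c,N]\<close> of the extracted pairing and disjoint from
  all other ranges, then \<open>c \<le> e\<close> and \<open>e\<close> exceeds the upper endpoints of all other ranges; hence the
  smallest \<open>e\<close> is the maximum below.
\<close>

definition truncate_top_t :: "int \<Rightarrow> pairing list \<Rightarrow> (int \<times> pairing list) timed" where
  "truncate_top_t N gs = do {
     r \<leftarrow> extract_top_t N gs;
     case r of
       None \<Rightarrow> return_t (N, gs)
     | Some (g, hs) \<Rightarrow> do {
         m \<leftarrow> max_end_t hs;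
         m' \<leftarrow> add_t m 1;
         e \<leftarrow> max_t (ran_lo g) m';
         M \<leftarrow> sub_t e 1;
         truncate_t N M g hs } }"


section \<open>The orbit counting algorithm\<close>

type_synonym state = "int \<times> pairing list \<times> int"

text \<open>
  One pass through the loop body. The result is \<open>Inl\<close> of the output if the algorithm stops, and
  \<open>Inr\<close> of the next state (length of the interval, pairings, orbit counter) otherwise.
\<close>

fun round_t :: "state \<Rightarrow> (int + state) timed" where
  "round_t (N, gs, cnt) = do {
     gs1 \<leftarrow> delete_identities_t gs;
     (N2, gs2, cnt2) \<leftarrow> contract_from_t 1 N gs1 cnt;
     if gs2 = [] then return_t (Inl cnt2)
     else do {
       gs3 \<leftarrow> map_t trim_t gs2;
       gs4 \<leftarrow> merge_all_t gs3;
       gs5 \<leftarrow> transmit_all_t N2 gs4;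
       (N6, gs6) \<leftarrow> truncate_top_t N2 gs5;
       return_t (Inr (N6, gs6, cnt2)) } }"

text \<open>The value is \<open>None\<close> if the loop does not terminate; otherwise it is the output and the time.\<close>

partial_function (option) orbit_counting_loop :: "state \<Rightarrow> (int \<times> nat) option" where
  "orbit_counting_loop st =
     (case val (round_t st) of
        Inl result \<Rightarrow> Some (result, cost (round_t st))
      | Inr st' \<Rightarrow> do {
          (result, time) \<leftarrow> orbit_counting_loop st';
          Some (result, cost (round_t st) + time) })"

text \<open>
  A time bound polynomial in \<open>k * log N\<close> has to be read with \<open>k\<close> and \<open>log N\<close> replaced by
  \<open>max 1 k\<close> and \<open>max 1 (log 2 N)\<close>: without pairings the output \<open>N\<close> still has about \<open>log 2 N\<close> bits,
  and for \<open>N = 1\<close> there still are \<open>k\<close> pairings to read. For \<open>k \<ge> 1\<close> and \<open>N \<ge> 2\<close> nothing changes.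
\<close>

definition orbit_counting :: "int \<Rightarrow> pairing list \<Rightarrow> (int \<times> nat) option" where
  "orbit_counting N gs = orbit_counting_loop (N, gs, 0)"

end

theory Submission
  imports Defs "HOL-Library.Multiset"
begin

text \<open>
  \<^bold>\<open>Counting.\<close> The orbits are the components of the graph on \<open>[1,N]\<close> with edges \<open>(x, g x)\<close>, that
  is, the classes of the generated equivalence relation \<open>eqv\<close> (\<open>orbits_eq\<close>). Deleting identities,
  trimming, merging and transmitting change the edges but not the generated relation; for a merger
  this is the theorem of Fine and Wilf (\<open>window_rotation\<close>, \<open>merge_graph\<close>). Contraction deletes
  one-point classes, and truncation deletes leaves of the graph one after the other. Hence the
  counter plus the number of classes is invariant (\<open>round_invariant\<close>).

  \<^bold>\<open>Number of rounds.\<close> The list of pairings can get shorter at most \<open>k\<close> times, so consider rounds that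
  lose no pairing. For a pairing on \<open>[1,N]\<close> with range \<open>[c,d]\<close> let \<open>w\<close> be the width of the range and
  \<open>u = N - c + 1\<close> the distance of its lower end from the top; \<open>w \<le> u\<close>, with equality iff \<open>d = N\<close>. The
  potential is a sum over all pairings with the two main terms \<open>A * ln w\<close> and \<open>- ln u\<close>. Let the
  maximal pairing \<open>m\<close> have range \<open>[c,N]\<close> of width \<open>w\<close> and lose \<open>l\<close> points in the truncation. A
  transmitted pairing ends up with its lower end below \<open>c\<close>, so its \<open>u\<close> has grown. The truncation and
  the next contraction diminish each \<open>u\<close>, but \<open>ln u\<close> drops at most by a multiple of \<open>ln (w / (w - l))\<close>
  that is polynomial in \<open>k\<close> (\<open>log_loss\<close>), and with a suitable \<open>A\<close> the term \<open>A * ln w\<close> of \<open>m\<close> pays for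
  that. So the potential never increases.

  A definite decrease comes from the pairings other than \<open>m\<close> that also end at \<open>N\<close>: they have \<open>u = w\<close>,
  and a transmission should raise \<open>u\<close> by a factor \<open>5/4\<close>. That can fail only if \<open>m\<close> or the transmitted
  pairing preserves orientation with a translation distance below a quarter of its width; such a
  pairing is said to have a short period. But if a transmission by such
  an \<open>m\<close> yields a pairing of short period that is still near the top, then both are periodic and
  overlap so much that they get merged, and a pairing is lost (\<open>no_short_periods\<close>,
  \<open>transmitted_far\<close>). Therefore a third term, the \<open>excess\<close>, which charges pairings of short period
  near the top, vanishes for transmitted pairings. With it the potential drops by \<open>ln (5/4)\<close> every few
  rounds, unless one and the same \<open>m\<close> of short period stays maximal for a longer time. This requires
  that transmissions produce overlapping reflections whose lower ends rise again when they are trimmed.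
  In that case their centres approach the lower end of \<open>m\<close> at least by halving the
  distance (\<open>offset_halved\<close>), so this lasts for at most about \<open>log 2 N\<close> rounds (\<open>phase_step\<close>).

  \<^bold>\<open>Time.\<close> Together this bounds the number of rounds by a polynomial in \<open>k\<close> and \<open>log 2 N\<close>
  (\<open>rank_decreases\<close>). No number occurring in the computation exceeds \<open>4 * N + 4\<close>, so a round costs
  polynomially many bit operations (\<open>cost_round\<close>).
\<close>

section \<open>Orbits as classes of a generated equivalence relation\<close>

lemma val_return [simp]: "val (return_t x) = x"
  by (simp add: return_t_def)

lemma val_arith [simp]:
  "val (add_t x y) = x + y" "val (sub_t x y) = x - y" "val (mult_t x y) = x * y"
  "val (div_t x y) = x div y" "val (mod_t x y) = x mod y"
  "val (eq_t x y) = (x = y)" "val (le_t x y) = (x \<le> y)" "val (less_t x y) = (x < y)"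
  "val (max_t x y) = max x y" "val (min_t x y) = min x y"
  by (simp_all add: add_t_def sub_t_def mult_t_def div_t_def mod_t_def eq_t_def le_t_def
      less_t_def max_t_def min_t_def)

lemma val_gcd_t:
  assumes "0 \<le> x" "0 \<le> y"
  shows "val (gcd_t x y) = gcd x y"
  using assms
proof (induction x y rule: gcd_t.induct)
  case (1 x y)
  then show ?case
    by (subst gcd_t.simps) (auto simp: gcd_red_int[of x y])
qed

lemma val_map_t [simp]: "val (map_t f xs) = map (\<lambda>x. val (f x)) xs"
  by (induction xs) auto

lemma val_filter_t [simp]: "val (filter_t f xs) = filter (\<lambda>x. val (f x)) xs"
  by (induction xs) auto

definition edges :: "pairing list \<Rightarrow> (int \<times> int) set" where
  "edges gs = (\<Union>g \<in> set gs. pairing_graph g)"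

definition eqv :: "pairing list \<Rightarrow> (int \<times> int) set" where
  "eqv gs = (edges gs \<union> (edges gs)\<inverse>)\<^sup>*"

lemma edges_eqv: "edges gs \<subseteq> eqv gs"
  by (auto simp: eqv_def)

lemma graph_eqv: "g \<in> set gs \<Longrightarrow> pairing_graph g \<subseteq> eqv gs"
  using edges_eqv by (fastforce simp: edges_def)

lemma equiv_eqv: "equiv UNIV (eqv gs)"
  unfolding eqv_def
  by (auto simp: equiv_def refl_on_def intro!: sym_rtrancl sym_Un_converse trans_rtrancl)

lemma eqv_refl [simp]: "(x, x) \<in> eqv gs"
  by (simp add: eqv_def)

lemma eqv_sym: "(x, y) \<in> eqv gs \<Longrightarrow> (y, x) \<in> eqv gs"
  using equiv_eqv by (auto simp: equiv_def dest: symD)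

lemma eqv_trans: "(x, y) \<in> eqv gs \<Longrightarrow> (y, z) \<in> eqv gs \<Longrightarrow> (x, z) \<in> eqv gs"
  by (simp add: eqv_def)

text \<open>
  The form in which equivalence relations are compared: only the edges have to be checked.
\<close>

lemma eqv_least:
  assumes "\<And>g. g \<in> set gs \<Longrightarrow> pairing_graph g \<subseteq> E" and E: "equiv UNIV E"
  shows "eqv gs \<subseteq> E"
proof -
  have "edges gs \<union> (edges gs)\<inverse> \<subseteq> E"
    using assms by (fastforce simp: edges_def equiv_def sym_def)
  then have "eqv gs \<subseteq> E\<^sup>*"
    unfolding eqv_def by (rule rtrancl_mono)
  moreover have "E\<^sup>* \<subseteq> E"
  proof (rule subrelI)
    fix x y assume "(x, y) \<in> E\<^sup>*"
    then show "(x, y) \<in> E"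
    proof induction
      case base
      show ?case using E by (simp add: equiv_def refl_on_def)
    next
      case (step y z)
      then show ?case using E by (meson equivE transD)
    qed
  qed
  ultimately show ?thesis by blast
qed

lemma eqv_eqI:
  assumes "\<And>g. g \<in> set gs \<Longrightarrow> pairing_graph g \<subseteq> eqv gs'"
    and "\<And>g. g \<in> set gs' \<Longrightarrow> pairing_graph g \<subseteq> eqv gs"
  shows "eqv gs = eqv gs'"
  using assms eqv_least[OF _ equiv_eqv] by (meson subset_antisym)

abbreviation all_on :: "int \<Rightarrow> pairing list \<Rightarrow> bool" where
  "all_on N gs \<equiv> \<forall>g \<in> set gs. pairing_on N g"

lemma pairing_graph_simp:
  "pairing_graph (Pairing a b c d p) =
     {(x, y). a \<le> x \<and> x \<le> b \<and> y = (if p then c + (x - a) else d - (x - a))}"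
  by (auto simp: pairing_graph_def)

lemma pairing_graph_on: "pairing_on N g \<Longrightarrow> pairing_graph g \<subseteq> {1..N} \<times> {1..N}"
  by (cases g) (auto simp: pairing_graph_simp)

lemma edges_on: "all_on N gs \<Longrightarrow> edges gs \<subseteq> {1..N} \<times> {1..N}"
  using pairing_graph_on by (fastforce simp: edges_def)

text \<open>
  A restriction of an element of the pseudogroup relates no new points, and a path of edges is
  followed by one composite of generators and inverses.
\<close>

lemma orbit_relation_iff:
  assumes "all_on N gs"
  shows "(x, y) \<in> orbit_relation N gs \<longleftrightarrow> x \<in> {1..N} \<and> (x, y) \<in> eqv gs"
proof -
  have "h \<subseteq> eqv gs \<inter> {1..N} \<times> {1..N}" if "h \<in> pseudogroup N gs" for h
    using that
  proof induction
    case (generator g)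
    then show ?case using graph_eqv[of g gs] pairing_graph_on[of N g] assms by blast
  next
    case (composition h h')
    then show ?case by (auto intro: eqv_trans)
  next
    case (inverse h)
    then show ?case by (auto intro: eqv_sym)
  qed auto
  moreover have "\<exists>h \<in> pseudogroup N gs. (x, y) \<in> h" if "x \<in> {1..N}" "(x, y) \<in> eqv gs"
    using that(2) unfolding eqv_def
  proof (induction rule: rtrancl_induct)
    case base
    show ?case using that(1) by (blast intro: pseudogroup.identity)
  next
    case (step y z)
    then obtain h where h: "h \<in> pseudogroup N gs" "(x, y) \<in> h" by blast
    from step(2) obtain g where g: "g \<in> set gs" "(y, z) \<in> pairing_graph g \<union> (pairing_graph g)\<inverse>"
      by (auto simp: edges_def)
    have 1: "h O pairing_graph g \<in> pseudogroup N gs"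
      and 2: "h O (pairing_graph g)\<inverse> \<in> pseudogroup N gs"
      using h(1) g(1) by (auto intro!: pseudogroup.intros(2-4))
    from g(2) show ?case
    proof
      assume "(y, z) \<in> pairing_graph g"
      with h(2) have "(x, z) \<in> h O pairing_graph g" by (rule relcompI)
      then show ?case using 1 by (rule bexI)
    next
      assume "(y, z) \<in> (pairing_graph g)\<inverse>"
      with h(2) have "(x, z) \<in> h O (pairing_graph g)\<inverse>" by (rule relcompI)
      then show ?case using 2 by (rule bexI)
    qed
  qed
  ultimately show ?thesis unfolding orbit_relation_def by blast
qed

lemma orbits_eq:
  assumes "all_on N gs"
  shows "orbits N gs = {1..N} // eqv gs"
proof -
  have "orbit_relation N gs `` {x} = eqv gs `` {x}" if "x \<in> {1..N}" for x
    using that by (auto simp: orbit_relation_iff[OF assms])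
  then show ?thesis by (auto simp: orbits_def quotient_def)
qed

text \<open>
  The number of classes is transported along any map that preserves and reflects equivalence and
  hits every class; contraction and truncation both supply such maps.
\<close>

lemma card_quotient_transfer:
  assumes E: "equiv UNIV E" and E': "equiv UNIV E'"
    and into: "f ` A \<subseteq> A'" and onto: "\<And>y. y \<in> A' \<Longrightarrow> \<exists>x \<in> A. (f x, y) \<in> E'"
    and iff: "\<And>x y. x \<in> A \<Longrightarrow> y \<in> A \<Longrightarrow> (x, y) \<in> E \<longleftrightarrow> (f x, f y) \<in> E'"
  shows "card (A // E) = card (A' // E')"
proof -
  let ?F = "\<lambda>X. E' `` (f ` (X \<inter> A))"
  have F: "?F (E `` {x}) = E' `` {f x}" if "x \<in> A" for x
  proof -
    have "y \<in> E' `` {f x}" if "y \<in> ?F (E `` {x})" for y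
    proof -
      from that obtain z where z: "z \<in> A" "(x, z) \<in> E" "(f z, y) \<in> E'" by auto
      with iff \<open>x \<in> A\<close> have "(f x, f z) \<in> E'" by simp
      with z E' show ?thesis by (meson Image_singleton_iff equivE transD)
    qed
    moreover have "x \<in> E `` {x} \<inter> A"
      using that E by (auto simp: equiv_def refl_on_def)
    ultimately show ?thesis by auto
  qed
  have "bij_betw ?F (A // E) (A' // E')"
    unfolding bij_betw_def
  proof
    show "inj_on ?F (A // E)"
    proof (rule inj_onI)
      fix X Y assume "X \<in> A // E" "Y \<in> A // E" and eq: "?F X = ?F Y"
      then obtain x y where xy: "X = E `` {x}" "x \<in> A" "Y = E `` {y}" "y \<in> A"
        by (auto simp: quotient_def)
      with eq have "E' `` {f x} = E' `` {f y}" by (simp add: F)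
      then have "(f x, f y) \<in> E'" using E' by (simp add: eq_equiv_class_iff)
      with xy iff have "(x, y) \<in> E" by simp
      with xy E show "X = Y" by (simp add: equiv_class_eq)
    qed
    have "?F ` (A // E) = (\<lambda>x. E' `` {f x}) ` A"
    proof -
      have "A // E = (\<lambda>x. E `` {x}) ` A" by (auto simp: quotient_def)
      then have "?F ` (A // E) = (\<lambda>x. ?F (E `` {x})) ` A" by (simp only: image_image)
      also have "\<dots> = (\<lambda>x. E' `` {f x}) ` A" using F by (rule image_cong[OF refl])
      finally show ?thesis .
    qed
    also have "\<dots> = A' // E'"
    proof
      show "(\<lambda>x. E' `` {f x}) ` A \<subseteq> A' // E'" using into by (auto simp: quotient_def)
      show "A' // E' \<subseteq> (\<lambda>x. E' `` {f x}) ` A"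
      proof
        fix X assume "X \<in> A' // E'"
        then obtain y where y: "y \<in> A'" "X = E' `` {y}" by (auto simp: quotient_def)
        with onto obtain x where "x \<in> A" "(f x, y) \<in> E'" by blast
        with y E' have "X = E' `` {f x}" by (simp add: equiv_class_eq)
        with \<open>x \<in> A\<close> show "X \<in> (\<lambda>x. E' `` {f x}) ` A" by (rule rev_image_eqI)
      qed
    qed
    finally show "?F ` (A // E) = A' // E'" .
  qed
  then show ?thesis by (rule bij_betw_same_card)
qed

section \<open>Trimming, merging and transmission keep the orbits\<close>

lemma val_trim [simp]:
  "val (trim_t (Pairing a b c d p)) =
    (if \<not> p \<and> c \<le> b then Pairing a ((a + d - 1) div 2) ((a + d) div 2 + 1) d False
     else Pairing a b c d p)"
  by auto

declare trim_t.simps [simp del]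

lemma trim_on:
  assumes "pairing_on N g" "val (non_identity_t g)"
  shows "pairing_on N (val (trim_t g))"
  using assms by (cases g) auto

text \<open>
  An overlapping orientation reversing pairing is the restriction of a reflection, and a point
  beyond the centre is paired with its mirror image by the trimmed pairing already.
\<close>

lemma trim_eqv:
  assumes "all_on N gs"
  shows "eqv (map (\<lambda>g. val (trim_t g)) gs) = eqv gs"
proof (rule eqv_eqI)
  let ?gs = "map (\<lambda>g. val (trim_t g)) gs"
  fix g assume "g \<in> set ?gs"
  then obtain h where h: "h \<in> set gs" "g = val (trim_t h)" by auto
  then have "pairing_on N h" using assms by simp
  then have "pairing_graph g \<subseteq> pairing_graph h"
    using h(2) by (cases h) (auto simp: pairing_graph_simp)
  then show "pairing_graph g \<subseteq> eqv gs" using graph_eqv[OF h(1)] by blast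
next
  let ?gs = "map (\<lambda>g. val (trim_t g)) gs"
  fix h assume h: "h \<in> set gs"
  then have on: "pairing_on N h" using assms by simp
  have g: "pairing_graph (val (trim_t h)) \<subseteq> eqv ?gs" using h by (intro graph_eqv) auto
  show "pairing_graph h \<subseteq> eqv ?gs"
  proof (rule subrelI)
    fix x y assume xy: "(x, y) \<in> pairing_graph h"
    have "(x, y) \<in> pairing_graph (val (trim_t h)) \<or> x = y \<or> (y, x) \<in> pairing_graph (val (trim_t h))"
      using xy on by (cases h) (auto simp: pairing_graph_simp)
    then show "(x, y) \<in> eqv ?gs" using g by (auto intro: eqv_sym)
  qed
qed

text \<open>
  Each step of length \<open>t\<close> inside \<open>[a,d]\<close> is an edge, whether or not domain and range overlap:
  if \<open>z + t \<le> d\<close> then \<open>z \<le> b\<close>.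
\<close>

lemma periodic_eqv:
  assumes g: "pairing_graph (Pairing a b c d True) \<subseteq> eqv gs"
    and t: "t = c - a" "0 < t" "d - c = b - a" and xy: "a \<le> x" "y \<le> d" "y = x + int n * t"
  shows "(x, y) \<in> eqv gs"
  using xy
proof (induction n arbitrary: y)
  case 0
  then show ?case by simp
next
  case (Suc n)
  let ?z = "x + int n * t"
  have y: "y = ?z + t" using Suc.prems by (simp add: algebra_simps)
  have "x \<le> ?z" using t by simp
  then have "(x, ?z) \<in> eqv gs" using Suc y t(2) by (intro Suc.IH) auto
  moreover have "(?z, y) \<in> pairing_graph (Pairing a b c d True)"
  proof -
    have "a \<le> ?z" "?z \<le> b" "y = c + (?z - a)"
      using Suc.prems(1,2) y t(1,3) \<open>x \<le> ?z\<close> by linarith+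
    then show ?thesis by (simp add: pairing_graph_simp)
  qed
  ultimately show ?case using g by (blast intro: eqv_trans)
qed

lemma periodic_eqv_dvd:
  assumes "pairing_graph (Pairing a b c d True) \<subseteq> eqv gs"
    and "0 < c - a" "d - c = b - a" "x \<in> {a..d}" "y \<in> {a..d}" "(c - a) dvd (y - x)"
  shows "(x, y) \<in> eqv gs"
proof -
  from assms(6) obtain k where k: "y - x = (c - a) * k" by (auto simp: dvd_def)
  show ?thesis
  proof (cases "0 \<le> k")
    case True
    then show ?thesis
      using assms k by (intro periodic_eqv[of a b c d gs "c - a" x y "nat k"]) (auto simp: algebra_simps)
  next
    case False
    then have "(y, x) \<in> eqv gs"
      using assms k by (intro periodic_eqv[of a b c d gs "c - a" y x "nat (- k)"]) (auto simp: algebra_simps)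
    then show ?thesis by (rule eqv_sym)
  qed
qed

text \<open>
  On a window of width \<open>s + t\<close> one of the moves \<open>x \<mapsto> x + s\<close>, \<open>x \<mapsto> x - t\<close> is always possible, and
  both are the rotation by \<open>s\<close> modulo \<open>s + t\<close>. Its orbits are the residue classes modulo
  \<open>gcd s (s + t) = gcd s t\<close>.
\<close>

lemma window_rotation:
  fixes s t lo :: int
  assumes E: "equiv UNIV E" and pos: "0 < s" "0 < t"
    and up: "\<And>x. lo \<le> x \<Longrightarrow> x + s < lo + (s + t) \<Longrightarrow> (x, x + s) \<in> E"
    and down: "\<And>x. lo \<le> x - t \<Longrightarrow> x < lo + (s + t) \<Longrightarrow> (x, x - t) \<in> E"
    and xy: "x \<in> {lo..<lo + (s + t)}" "y \<in> {lo..<lo + (s + t)}" "gcd s t dvd y - x"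
  shows "(x, y) \<in> E"
proof -
  have rot: "(x, lo + (x - lo + int n * s) mod (s + t)) \<in> E" for n
  proof (induction n)
    case 0
    then show ?case using xy(1) E by (simp add: equiv_def refl_on_def)
  next
    case (Suc n)
    define z where "z = lo + (x - lo + int n * s) mod (s + t)"
    have z: "lo \<le> z" "z < lo + (s + t)" using pos by (simp_all add: z_def)
    have "lo + (x - lo + int (Suc n) * s) mod (s + t) = lo + (z - lo + s) mod (s + t)"
      by (simp add: z_def mod_simps algebra_simps)
    also have "\<dots> = (if z < lo + t then z + s else z - t)"
    proof (cases "z < lo + t")
      case True
      then show ?thesis using z pos by (simp add: mod_pos_pos_trivial)
    next
      case False
      have "(z - lo + s) mod (s + t) = (z - lo - t + (s + t)) mod (s + t)" by (simp add: algebra_simps)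
      also have "\<dots> = z - lo - t" using False z pos by (subst mod_add_self2) (simp add: mod_pos_pos_trivial)
      finally show ?thesis using False by simp
    qed
    also have "(z, \<dots>) \<in> E" using up[of z] down[of z] z by auto
    finally show ?case using Suc E unfolding z_def[symmetric] by (meson equivE transD)
  qed
  obtain u v where uv: "u * s + v * t = gcd s t" using bezout_int by blast
  obtain k where k: "y - x = gcd s t * k" using xy(3) by (auto simp: dvd_def)
  \<comment> \<open>Since \<open>t = - s\<close> modulo \<open>s + t\<close>, Bezout's identity says that \<open>(u - v) * s\<close> is the greatest
    common divisor modulo \<open>s + t\<close>.\<close>
  define n where "n = nat (((u - v) * k) mod (s + t))"
  have n: "int n = ((u - v) * k) mod (s + t)" using pos by (simp add: n_def)
  have "(u - v) * k * s = (y - x) - v * k * (s + t)"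
    unfolding k uv[symmetric] by (simp add: algebra_simps)
  then have "(x - lo + int n * s) mod (s + t) = (x - lo + ((y - x) - v * k * (s + t))) mod (s + t)"
    unfolding n by (metis mod_add_right_eq mod_mult_left_eq)
  also have "\<dots> = (y - lo - v * k * (s + t)) mod (s + t)" by (simp add: algebra_simps)
  also have "\<dots> = (y - lo) mod (s + t)" by (metis mod_diff_right_eq mod_mult_self2_is_0 diff_zero mult.commute)
  also have "\<dots> = y - lo" using xy(2) by (simp add: mod_pos_pos_trivial)
  finally show ?thesis using rot[of n] by simp
qed

lemma val_periodic [simp]:
  "val (periodic_t (Pairing a b c d p)) = (p \<and> a < c \<and> c \<le> b + 1)"
  by auto

definition mergeable :: "pairing \<Rightarrow> pairing \<Rightarrow> bool" where
  "mergeable g h \<longleftrightarrow> val (periodic_t g) \<and> val (periodic_t h) \<and>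
     (ran_lo g - dom_lo g) + (ran_lo h - dom_lo h)
       \<le> min (ran_hi g) (ran_hi h) - max (dom_lo g) (dom_lo h) + 1"

lemma val_merge:
  "val (merge_t (Pairing a b c d p) (Pairing a' b' c' d' p')) =
    (if mergeable (Pairing a b c d p) (Pairing a' b' c' d' p')
     then (let t = gcd (c - a) (c' - a') in
       Some (Pairing (min a a') (max d d' - t) (min a a' + t) (max d d') True)) else None)"
  by (auto simp: mergeable_def val_gcd_t Let_def)

declare merge_t.simps [simp del] periodic_t.simps [simp del]

lemma merge_on:
  assumes "pairing_on N g" "pairing_on N h" "val (merge_t g h) = Some m"
  shows "pairing_on N m"
proof (cases g, cases h)
  fix a b c d p a' b' c' d' p'
  assume gh: "g = Pairing a b c d p" "h = Pairing a' b' c' d' p'"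
  define t where "t = gcd (c - a) (c' - a')"
  have mg: "mergeable g h" and m: "m = Pairing (min a a') (max d d' - t) (min a a' + t) (max d d') True"
    using assms(3) unfolding gh val_merge t_def by (auto simp: Let_def split: if_splits)
  have "0 \<le> t" "t \<le> c - a" using mg by (auto simp: t_def gh mergeable_def intro!: gcd_le1_int)
  then show ?thesis using assms(1,2) mg by (auto simp: gh mergeable_def m)
qed

text \<open>
  The intersection of the periodic intervals contains a window on which \<open>window_rotation\<close> applies.
  Every point of the union is equivalent to a point of the window congruent to it modulo \<open>s\<close> or \<open>s'\<close>,
  hence modulo the greatest common divisor.
\<close>

lemma merge_graph:
  assumes g: "pairing_on N g" "pairing_graph g \<subseteq> eqv gs" and h: "pairing_on N h" "pairing_graph h \<subseteq> eqv gs"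
    and "val (merge_t g h) = Some m"
  shows "pairing_graph m \<subseteq> eqv gs"
proof (cases g, cases h)
  fix a b c d p a' b' c' d' p'
  assume gh: "g = Pairing a b c d p" "h = Pairing a' b' c' d' p'"
  define s where "s = c - a"
  define s' where "s' = c' - a'"
  define t where "t = gcd s s'"
  have mg: "mergeable g h" and m: "m = Pairing (min a a') (max d d' - t) (min a a' + t) (max d d') True"
    using assms(5) unfolding gh val_merge t_def s_def s'_def by (auto simp: Let_def split: if_splits)
  have pp: "p" "p'" "0 < s" "0 < s'" and w: "s + s' \<le> min d d' - max a a' + 1"
    using mg by (auto simp: gh mergeable_def s_def s'_def)
  have E1: "(x, y) \<in> eqv gs" if "x \<in> {a..d}" "y \<in> {a..d}" "s dvd y - x" for x y
    using g pp that by (intro periodic_eqv_dvd[of a b c d]) (auto simp: gh s_def)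
  have E2: "(x, y) \<in> eqv gs" if "x \<in> {a'..d'}" "y \<in> {a'..d'}" "s' dvd y - x" for x y
    using h pp that by (intro periodic_eqv_dvd[of a' b' c' d']) (auto simp: gh s'_def)
  define lo where "lo = max a a'"
  have win: "(x, y) \<in> eqv gs"
    if "x \<in> {lo..<lo + (s + s')}" "y \<in> {lo..<lo + (s + s')}" "t dvd y - x" for x y
  proof (rule window_rotation[OF equiv_eqv pp(3,4) _ _ that(1,2)])
    show "gcd s s' dvd y - x" using that(3) by (simp add: t_def)
  next
    fix x assume "lo \<le> x" "x + s < lo + (s + s')"
    then show "(x, x + s) \<in> eqv gs" using w pp by (intro E1) (auto simp: lo_def)
  next
    fix x assume "lo \<le> x - s'" "x < lo + (s + s')"
    then show "(x, x - s') \<in> eqv gs" using w pp by (intro E2) (auto simp: lo_def)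
  qed
  have rep: "\<exists>z \<in> {lo..<lo + (s + s')}. (x, z) \<in> eqv gs \<and> t dvd z - x"
    if x: "x \<in> {min a a'..max d d'}" for x
  proof -
    have *: "\<exists>z \<in> {lo..<lo + (s + s')}. (x, z) \<in> eqv gs \<and> t dvd z - x"
      if "r dvd lo + (x - lo) mod r - x \<Longrightarrow> (x, lo + (x - lo) mod r) \<in> eqv gs" "r = s \<or> r = s'" for r
    proof -
      have "0 < r" "t dvd r" using that(2) pp by (auto simp: t_def)
      have "r dvd lo + (x - lo) mod r - x"
        by (metis add.commute diff_diff_eq2 dvd_minus_mod dvd_diff_commute)
      then have "(x, lo + (x - lo) mod r) \<in> eqv gs" "t dvd lo + (x - lo) mod r - x"
        using that \<open>t dvd r\<close> by (auto dest: dvd_trans)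
      moreover have "0 \<le> (x - lo) mod r" "(x - lo) mod r < r" using \<open>0 < r\<close> by simp_all
      moreover have "r < s + s'" using that(2) pp(3,4) by auto
      ultimately show ?thesis by (intro bexI[of _ "lo + (x - lo) mod r"]) auto
    qed
    have bd: "0 \<le> (x - lo) mod r" "(x - lo) mod r < r" if "0 < r" for r using that by simp_all
    have lo: "a \<le> lo" "a' \<le> lo" "lo + s \<le> d" "lo + s' \<le> d'" using w pp by (auto simp: lo_def)
    have "x \<in> {a..d} \<or> x \<in> {a'..d'}" using x w pp by auto
    then show ?thesis
    proof
      assume "x \<in> {a..d}"
      then show ?thesis using bd[OF pp(3)] lo by (intro *[of s] E1) auto
    next
      assume "x \<in> {a'..d'}"
      then show ?thesis using bd[OF pp(4)] lo by (intro *[of s'] E2) auto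
    qed
  qed
  show ?thesis
  proof (rule subrelI)
    fix x y assume "(x, y) \<in> pairing_graph m"
    then have xy: "x \<in> {min a a'..max d d'}" "y \<in> {min a a'..max d d'}" "y = x + t"
      using pp gcd_ge_0_int[of s s', folded t_def] by (auto simp: m pairing_graph_simp)
    from rep[OF xy(1)] obtain z where z: "z \<in> {lo..<lo + (s + s')}" "(x, z) \<in> eqv gs" "t dvd z - x" by blast
    from rep[OF xy(2)] obtain z' where z': "z' \<in> {lo..<lo + (s + s')}" "(y, z') \<in> eqv gs" "t dvd z' - y" by blast
    have "z' - z = (z' - y) + t - (z - x)" using xy(3) by simp
    then have "t dvd z' - z" using z z' by (metis dvd_add dvd_diff dvd_refl)
    then have "(z, z') \<in> eqv gs" using z z' by (intro win)
    then show "(x, y) \<in> eqv gs" using z z' by (meson eqv_trans eqv_sym)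
  qed
qed

text \<open>
  Both old periods are multiples of the new one, and both periodic intervals lie in the new one.
\<close>

lemma merge_graph_conv:
  assumes g: "pairing_on N g" and h: "pairing_on N h" and "val (merge_t g h) = Some m"
    and "pairing_graph m \<subseteq> eqv gs"
  shows "pairing_graph g \<subseteq> eqv gs" "pairing_graph h \<subseteq> eqv gs"
proof -
  obtain a b c d p a' b' c' d' p'
    where gh: "g = Pairing a b c d p" "h = Pairing a' b' c' d' p'" by (metis pairing.exhaust)
  define t where "t = gcd (c - a) (c' - a')"
  have mg: "mergeable g h" and m: "m = Pairing (min a a') (max d d' - t) (min a a' + t) (max d d') True"
    using assms(3) unfolding gh val_merge t_def by (auto simp: Let_def split: if_splits)
  have pp: "p" "p'" "0 < t" using mg by (auto simp: gh mergeable_def t_def)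
  have E: "(x, y) \<in> eqv gs"
    if "x \<in> {min a a'..max d d'}" "y \<in> {min a a'..max d d'}" "t dvd y - x" for x y
    using periodic_eqv_dvd[OF assms(4)[unfolded m], of x y] pp that by simp
  show "pairing_graph g \<subseteq> eqv gs" "pairing_graph h \<subseteq> eqv gs"
    using g h pp by (auto simp: gh pairing_graph_simp t_def intro!: E)
qed


lemma val_orient:
  "val (orient_t (Pairing a b c d p)) =
     (if a \<le> c then Pairing a b c d p else Pairing c d a b p)"
  by auto

declare orient_t.simps [simp del]

lemma orient_graph:
  assumes "d - c = b - a"
  shows "pairing_graph (val (orient_t (Pairing a b c d p))) \<subseteq> eqv gs
    \<longleftrightarrow> pairing_graph (Pairing a b c d p) \<subseteq> eqv gs"
proof -
  have "pairing_graph (Pairing c d a b p) = (pairing_graph (Pairing a b c d p))\<inverse>"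
    using assms by (auto simp: pairing_graph_simp)
  then show ?thesis by (auto simp: val_orient intro: eqv_sym)
qed

text \<open>
  The distance by which a transmission moves an interval with lower end \<open>x\<close>; see \<open>displacement_t\<close>.
\<close>

definition disp :: "int \<Rightarrow> int \<Rightarrow> int \<Rightarrow> int" where
  "disp t c x = ((x - c) div t + 1) * t"

lemma val_displacement [simp]: "val (displacement_t t c x) = disp t c x"
  by (simp add: displacement_t_def disp_def)

text \<open>
  The interval is moved just far enough for its lower end to fall into \<open>[c - t, c - 1]\<close>, the first
  \<open>t\<close> points of the domain.
\<close>

lemma disp_bounds:
  assumes "0 < t" "c \<le> x"
  shows "t \<le> disp t c x" "c - t \<le> x - disp t c x" "x - disp t c x < c" "t dvd disp t c x"
proof -
  define q where "q = (x - c) div t * t"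
  have "q + (x - c) mod t = x - c" by (simp add: q_def)
  moreover have "0 \<le> (x - c) mod t" "(x - c) mod t < t" using assms by simp_all
  moreover have "0 \<le> q" using assms by (simp add: q_def pos_imp_zdiv_nonneg_iff)
  moreover have "disp t c x = q + t" by (simp add: disp_def q_def ring_distribs)
  ultimately show "t \<le> disp t c x" "c - t \<le> x - disp t c x" "x - disp t c x < c"
    by linarith+
  show "t dvd disp t c x" by (simp add: disp_def)
qed

lemma val_transmit:
  assumes "p1 \<or> b1 < c1"
  shows "val (transmit_t (Pairing a1 b1 c1 d1 p1) (Pairing a2 b2 c2 d2 p2)) =
    (let u = disp (c1 - a1) c1 c2; v = disp (c1 - a1) c1 a2; m = a1 + d1; inside = (c1 \<le> a2 \<and> b2 \<le> d1)
     in val (orient_t (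
       if p1 then
         if inside then Pairing (a2 - v) (b2 - v) (c2 - u) (d2 - u) p2
         else Pairing a2 b2 (c2 - u) (d2 - u) p2
       else
         if inside then Pairing (m - b2) (m - a2) (m - d2) (m - c2) p2
         else Pairing a2 b2 (m - d2) (m - c2) (\<not> p2))))"
  using assms by (auto simp: transmit_t_def Let_def)

declare transmit_trimmed_t.simps [simp del]

text \<open>A pairing that can serve as transmitter: neither an identity nor untrimmed.\<close>

fun proper :: "pairing \<Rightarrow> bool" where
  "proper (Pairing a b c d p) \<longleftrightarrow> a < c \<and> (p \<or> b < c)"

text \<open>
  Since the range of \<open>g2\<close> lies above the lower end \<open>c1\<close>, its domain is contained in the range of the
  transmitter iff \<open>c1 \<le> a2\<close>.
\<close>

lemma transmit_cases:
  assumes "proper (Pairing a1 b1 c1 N p1)" "pairing_on N (Pairing a1 b1 c1 N p1)"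
    and "pairing_on N (Pairing a2 b2 c2 d2 p2)" "c1 \<le> c2"
  obtains
    (both) u v where "p1" "c1 \<le> a2" "u = disp (c1 - a1) c1 c2" "v = disp (c1 - a1) c1 a2"
      "val (transmit_t (Pairing a1 b1 c1 N p1) (Pairing a2 b2 c2 d2 p2)) =
         val (orient_t (Pairing (a2 - v) (b2 - v) (c2 - u) (d2 - u) p2))"
  | (one) u where "p1" "a2 < c1" "u = disp (c1 - a1) c1 c2"
      "val (transmit_t (Pairing a1 b1 c1 N p1) (Pairing a2 b2 c2 d2 p2)) =
         val (orient_t (Pairing a2 b2 (c2 - u) (d2 - u) p2))"
  | (both_rev) m where "\<not> p1" "c1 \<le> a2" "m = a1 + N" "b1 < c1"
      "val (transmit_t (Pairing a1 b1 c1 N p1) (Pairing a2 b2 c2 d2 p2)) =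
         val (orient_t (Pairing (m - b2) (m - a2) (m - d2) (m - c2) p2))"
  | (one_rev) m where "\<not> p1" "a2 < c1" "m = a1 + N" "b1 < c1"
      "val (transmit_t (Pairing a1 b1 c1 N p1) (Pairing a2 b2 c2 d2 p2)) =
         val (orient_t (Pairing a2 b2 (m - d2) (m - c2) (\<not> p2)))"
proof -
  have "p1 \<or> b1 < c1" "b2 \<le> N" using assms by auto
  then show ?thesis using that by (cases p1; cases "c1 \<le> a2") (simp_all add: val_transmit Let_def)
qed

text \<open>
  Moving the two ends of every edge along equivalences does not matter for the generated relation.
\<close>

lemma graph_moved:
  assumes "pairing_graph P' = (\<lambda>(x, y). (f x, h y)) ` pairing_graph P"
    and "\<And>x. x \<in> {dom_lo P..dom_hi P} \<Longrightarrow> (x, f x) \<in> eqv gs"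
    and "\<And>y. y \<in> {ran_lo P..ran_hi P} \<Longrightarrow> (y, h y) \<in> eqv gs"
    and "pairing_on N P"
  shows "pairing_graph P' \<subseteq> eqv gs \<longleftrightarrow> pairing_graph P \<subseteq> eqv gs"
proof -
  have "(f x, h y) \<in> eqv gs \<longleftrightarrow> (x, y) \<in> eqv gs" if "(x, y) \<in> pairing_graph P" for x y
  proof -
    have "x \<in> {dom_lo P..dom_hi P}" "y \<in> {ran_lo P..ran_hi P}"
      using that assms(4) by (cases P, auto simp: pairing_graph_simp split: if_splits)+
    then show ?thesis using assms(2,3) by (meson eqv_sym eqv_trans)
  qed
  then show ?thesis unfolding assms(1) by fast
qed

lemma graph_image_cong:
  assumes "\<And>x y. (x, y) \<in> G \<Longrightarrow> (f x, h y) \<in> G'" "\<And>x y. (x, y) \<in> G' \<Longrightarrow> (f' x, h' y) \<in> G"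
    and "\<And>x y. (x, y) \<in> G' \<Longrightarrow> f (f' x) = x \<and> h (h' y) = y"
  shows "G' = (\<lambda>(x, y). (f x, h y)) ` G"
proof
  show "G' \<subseteq> (\<lambda>(x, y). (f x, h y)) ` G"
  proof (rule subrelI)
    fix x y assume "(x, y) \<in> G'"
    with assms(2,3) have "(f' x, h' y) \<in> G" "(x, y) = (\<lambda>(x, y). (f x, h y)) (f' x, h' y)" by auto
    then show "(x, y) \<in> (\<lambda>(x, y). (f x, h y)) ` G" by (metis imageI)
  qed
qed (use assms(1) in auto)

text \<open>
  The transmitter itself stays in the list, and each point is moved along its edges: by a multiple
  of its translation distance, or to its mirror image.
\<close>

lemma transmit_graph:
  assumes m: "proper m" "pairing_on N m" "ran_hi m = N" "pairing_graph m \<subseteq> eqv gs"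
    and x: "pairing_on N x" "ran_lo m \<le> ran_lo x"
  shows "pairing_graph (val (transmit_t m x)) \<subseteq> eqv gs \<longleftrightarrow> pairing_graph x \<subseteq> eqv gs"
proof -
  obtain a1 b1 c1 p1 a2 b2 c2 d2 p2
    where mx: "m = Pairing a1 b1 c1 N p1" "x = Pairing a2 b2 c2 d2 p2"
    using m(3) by (metis pairing.exhaust pairing.sel(4))
  have on: "1 \<le> a1" "a1 \<le> b1" "N - c1 = b1 - a1" "1 \<le> a2" "a2 \<le> b2" "a2 \<le> c2" "d2 \<le> N" "d2 - c2 = b2 - a2" "a1 < c1"
    "c1 \<le> c2"
    using m x by (auto simp: mx)
  have refl: "(y, y + int 0) \<in> eqv gs" for y by simp
  have p: "(y, y - disp (c1 - a1) c1 z) \<in> eqv gs" if "p1" "c1 \<le> z" "z \<le> y" "y \<le> N" for y z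
    using m(4) disp_bounds[of "c1 - a1" c1 z] that on
    by (intro periodic_eqv_dvd[of a1 b1 c1 N gs]) (auto simp: mx)
  have r: "(y, a1 + N - y) \<in> eqv gs" if "\<not> p1" "c1 \<le> y" "y \<le> N" for y
  proof -
    have "(a1 + N - y, y) \<in> pairing_graph m" using that on by (auto simp: mx pairing_graph_simp)
    then show ?thesis using m(4) by (blast intro: eqv_sym)
  qed
  show ?thesis
  proof (cases rule: transmit_cases[OF m(1)[unfolded mx] m(2)[unfolded mx] x(1)[unfolded mx] \<open>c1 \<le> c2\<close>,
        case_names both one both_rev one_rev])
    case (both u v)
    show ?thesis unfolding mx both(5)
      by (subst orient_graph, use on in simp,
          rule graph_moved[where f = "\<lambda>x. x - v" and h = "\<lambda>y. y - u" and N = N],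
          rule graph_image_cong[where f' = "\<lambda>x. x + v" and h' = "\<lambda>y. y + u"])
        (use on both x in \<open>auto simp: mx pairing_graph_simp intro!: p\<close>)
  next
    case (one u)
    show ?thesis unfolding mx one(4)
      by (subst orient_graph, use on in simp,
          rule graph_moved[where f = "\<lambda>x. x" and h = "\<lambda>y. y - u" and N = N],
          rule graph_image_cong[where f' = "\<lambda>x. x" and h' = "\<lambda>y. y + u"])
        (use on one x in \<open>auto simp: mx pairing_graph_simp intro!: p\<close>)
  next
    case (both_rev k)
    show ?thesis unfolding mx both_rev(5)
      by (subst orient_graph, use on in simp,
          rule graph_moved[where f = "\<lambda>x. k - x" and h = "\<lambda>y. k - y" and N = N],
          rule graph_image_cong[where f' = "\<lambda>x. k - x" and h' = "\<lambda>y. k - y"])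
        (use on both_rev x in \<open>auto simp: mx pairing_graph_simp intro!: r split: if_splits\<close>)
  next
    case (one_rev k)
    show ?thesis unfolding mx one_rev(5)
      by (subst orient_graph, use on in simp,
          rule graph_moved[where f = "\<lambda>x. x" and h = "\<lambda>y. k - y" and N = N],
          rule graph_image_cong[where f' = "\<lambda>x. x" and h' = "\<lambda>y. k - y"])
        (use on one_rev x in \<open>auto simp: mx pairing_graph_simp intro!: r split: if_splits\<close>)
  qed
qed

section \<open>Contracting all static intervals\<close>

definition cover :: "pairing list \<Rightarrow> int set" where
  "cover gs = (\<Union>g \<in> set gs. {dom_lo g..dom_hi g} \<union> {ran_lo g..ran_hi g})"

lemma cover_simps [simp]:
  "cover [] = {}"
  "cover (Pairing a b c d p # gs) = {a..b} \<union> {c..d} \<union> cover gs"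
  by (auto simp: cover_def)

lemma cover_on: "all_on N gs \<Longrightarrow> cover gs \<subseteq> {1..N}"
  unfolding cover_def
proof (rule UN_least)
  fix g assume "all_on N gs" "g \<in> set gs"
  then show "{dom_lo g..dom_hi g} \<union> {ran_lo g..ran_hi g} \<subseteq> {1..N}" by (cases g) fastforce
qed

fun relabel :: "(int \<Rightarrow> int) \<Rightarrow> pairing \<Rightarrow> pairing" where
  "relabel f (Pairing a b c d p) = Pairing (f a) (f b) (f c) (f d) p"

text \<open>The number of points up to \<open>x\<close> that survive the deletion of \<open>S\<close>.\<close>

definition squeeze :: "int set \<Rightarrow> int \<Rightarrow> int" where
  "squeeze S x = x - int (card (S \<inter> {..x}))"

lemma squeeze_diff:
  assumes "finite S" "x \<le> y"
  shows "squeeze S y - squeeze S x = (y - x) - int (card (S \<inter> {x<..y}))"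
proof -
  have "S \<inter> {..y} = S \<inter> {..x} \<union> S \<inter> {x<..y}" using assms by auto
  then have "card (S \<inter> {..y}) = card (S \<inter> {..x}) + card (S \<inter> {x<..y})"
    using assms by (subst card_Un_disjoint[symmetric]) auto
  then show ?thesis by (simp add: squeeze_def)
qed

lemma squeeze_rigid:
  assumes "finite S" "x \<le> y" "S \<inter> {x<..y} = {}"
  shows "squeeze S y - squeeze S x = y - x"
  using squeeze_diff[OF assms(1,2)] assms(3) by simp

lemma squeeze_mono:
  assumes "finite S" "x \<le> y"
  shows "squeeze S x \<le> squeeze S y"
proof -
  have "card (S \<inter> {x<..y}) \<le> card {x<..y}" by (intro card_mono) auto
  then show ?thesis using squeeze_diff[OF assms] assms(2) by simp
qed

lemma squeeze_strict:
  assumes "finite S" "x < y" "y \<notin> S"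
  shows "squeeze S x < squeeze S y"
proof -
  have "card (S \<inter> {x<..y}) \<le> card {x<..y - 1}"
    using assms(3) by (intro card_mono) (auto simp: le_less)
  then show ?thesis using squeeze_diff[of S x y] assms by simp
qed

lemma squeeze_loss:
  assumes "finite S" "x \<le> y"
  shows "y - x - int (card S) \<le> squeeze S y - squeeze S x"
proof -
  have "card (S \<inter> {x<..y}) \<le> card S" using assms(1) by (intro card_mono) auto
  then show ?thesis using squeeze_diff[OF assms] by simp
qed

lemma cover_end_props:
  fixes q gs defines "e \<equiv> val (cover_end_t q gs)"
  shows "q \<le> e" "{q..<e} \<subseteq> cover gs" "q \<in> cover gs \<Longrightarrow> q < e"
    "q < e \<Longrightarrow> \<exists>g \<in> set gs. (dom_lo g \<le> q \<and> q \<le> dom_hi g \<and> e = dom_hi g + 1) \<or>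
       (ran_lo g \<le> q \<and> q \<le> ran_hi g \<and> e = ran_hi g + 1)"
  unfolding e_def
  by (induction q gs rule: cover_end_t.induct) (auto simp: pass_t_def max_def)

lemma next_start_props:
  fixes q N gs defines "n \<equiv> val (next_start_t q N gs)"
  assumes "all_on N gs"
  shows "n \<le> N + 1"
    "\<And>g. g \<in> set gs \<Longrightarrow> dom_lo g \<notin> {q<..<n} \<and> ran_lo g \<notin> {q<..<n}"
    "n \<le> N \<Longrightarrow> \<exists>g \<in> set gs. dom_lo g = n \<or> ran_lo g = n"
proof -
  have "n \<le> N + 1 \<and> (\<forall>g \<in> set gs. dom_lo g \<notin> {q<..<n} \<and> ran_lo g \<notin> {q<..<n}) \<and>
    (n \<le> N \<longrightarrow> (\<exists>g \<in> set gs. dom_lo g = n \<or> ran_lo g = n))"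
    using assms(2) unfolding n_def
    by (induction q N gs rule: next_start_t.induct) (auto simp: nearer_t_def min_def)
  then show "n \<le> N + 1"
    "\<And>g. g \<in> set gs \<Longrightarrow> dom_lo g \<notin> {q<..<n} \<and> ran_lo g \<notin> {q<..<n}"
    "n \<le> N \<Longrightarrow> \<exists>g \<in> set gs. dom_lo g = n \<or> ran_lo g = n" by blast+
qed

definition shift :: "int \<Rightarrow> int \<Rightarrow> int \<Rightarrow> int" where
  "shift s w x = (if s < x then x - w else x)"

lemma val_contract:
  "val (contract_t r s N gs) = (s - r + 1, N - (s - r + 1), map (relabel (shift s (s - r + 1))) gs)"
proof -
  have "val (shift_pairing_t s w g) = relabel (shift s w) g" for w g
    by (cases g) (auto simp: shift_left_t_def shift_def)
  then show ?thesis by (simp add: contract_t_def)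
qed

lemma gap_disjoint:
  assumes "all_on N gs" "cover gs \<inter> {q..<n} = {}" "q < n" "g \<in> set gs"
  shows "dom_hi g < q \<or> n \<le> dom_lo g" "ran_hi g < q \<or> n \<le> ran_lo g"
    "dom_lo g \<le> dom_hi g" "ran_lo g \<le> ran_hi g"
proof -
  have "pairing_on N g" using assms(1,4) by blast
  then show le: "dom_lo g \<le> dom_hi g" "ran_lo g \<le> ran_hi g" by (cases g; auto)+
  have "{dom_lo g..dom_hi g} \<union> {ran_lo g..ran_hi g} \<subseteq> cover gs" using assms(4) by (auto simp: cover_def)
  then have out: "x \<notin> {q..<n}" if "x \<in> {dom_lo g..dom_hi g} \<union> {ran_lo g..ran_hi g}" for x
    using assms(2) that by blast
  show "dom_hi g < q \<or> n \<le> dom_lo g" using out[of q] out[of "dom_lo g"] le assms(3) by fastforce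
  show "ran_hi g < q \<or> n \<le> ran_lo g" using out[of q] out[of "ran_lo g"] le assms(3) by fastforce
qed

text \<open>
  Induction step of the sweep: contracting \<open>[q,n-1]\<close> first and the remaining static points afterwards
  amounts to deleting all static points from \<open>q\<close> on at once.
\<close>

lemma contract_one:
  assumes wf: "all_on N gs" and qn: "1 \<le> q" "q < n" "n \<le> N + 1" and gap: "cover gs \<inter> {q..<n} = {}"
  defines "w \<equiv> n - q" and "gs' \<equiv> map (relabel (shift (n - 1) (n - q))) gs"
  shows "all_on (N - w) gs'"
    "card ({q..N} - cover gs) = nat w + card ({q..N - w} - cover gs')"
    "map (relabel (squeeze ({q..N} - cover gs))) gs = map (relabel (squeeze ({q..N - w} - cover gs'))) gs'"
proof -
  have pair: "(b < q \<or> n \<le> a) \<and> (d < q \<or> n \<le> c) \<and> pairing_on N (Pairing a b c d p)"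
    if "Pairing a b c d p \<in> set gs" for a b c d p
  proof -
    have "pairing_on N (Pairing a b c d p)" using wf that by blast
    then show ?thesis using gap_disjoint[OF wf gap qn(2) that] by simp
  qed
  show "all_on (N - w) gs'"
  proof
    fix g assume "g \<in> set gs'"
    then obtain h where "h \<in> set gs" "g = relabel (shift (n - 1) w) h" by (auto simp: gs'_def w_def)
    moreover obtain a b c d p where "h = Pairing a b c d p" by (cases h)
    ultimately show "pairing_on (N - w) g"
      using pair[of a b c d p] qn by (auto simp: shift_def w_def)
  qed
  have cov: "y \<in> cover gs' \<longleftrightarrow> y + w \<in> cover gs" if "q \<le> y" for y
  proof -
    let ?f = "relabel (shift (n - 1) w)"
    have "y \<in> {dom_lo (?f g)..dom_hi (?f g)} \<union> {ran_lo (?f g)..ran_hi (?f g)} \<longleftrightarrow>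
        y + w \<in> {dom_lo g..dom_hi g} \<union> {ran_lo g..ran_hi g}"
      if "g \<in> set gs" for g
    proof -
      have iv: "y \<in> {shift (n - 1) w a..shift (n - 1) w b} \<longleftrightarrow> y + w \<in> {a..b}"
        if "b < q \<or> n \<le> a" "a \<le> b" for a b
        using that \<open>q \<le> y\<close> qn by (auto simp: shift_def w_def)
      obtain a b c d p where g: "g = Pairing a b c d p" by (cases g)
      then have "b < q \<or> n \<le> a" "d < q \<or> n \<le> c" "a \<le> b" "c \<le> d"
        using pair[of a b c d p] that by auto
      then show ?thesis by (simp only: g relabel.simps pairing.sel Un_iff iv)
    qed
    then show ?thesis unfolding cover_def gs'_def w_def[symmetric] by (simp only: set_map UN_iff bex_simps image_iff) blast
  qed
  define S where "S = {q..N} - cover gs"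
  define S' where "S' = {q..N - w} - cover gs'"
  have fin: "finite S" "finite S'" by (simp_all add: S_def S'_def)
  have S: "S = {q..<n} \<union> (\<lambda>y. y + w) ` S'"
  proof
    show "S \<subseteq> {q..<n} \<union> (\<lambda>y. y + w) ` S'"
    proof
      fix x assume x: "x \<in> S"
      show "x \<in> {q..<n} \<union> (\<lambda>y. y + w) ` S'"
      proof (cases "x < n")
        case False
        then have "x - w \<in> S'" using x cov[of "x - w"] by (auto simp: S_def S'_def w_def)
        then show ?thesis by (auto intro!: image_eqI[of _ _ "x - w"])
      qed (use x in \<open>auto simp: S_def\<close>)
    qed
    show "{q..<n} \<union> (\<lambda>y. y + w) ` S' \<subseteq> S"
      using gap cov qn by (auto simp: S_def S'_def w_def)
  qed
  have ge: "n \<le> y + w" if "y \<in> S'" for y using that by (auto simp: S'_def w_def)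
  have "card S = card {q..<n} + card ((\<lambda>y. y + w) ` S')"
    unfolding S using fin ge by (intro card_Un_disjoint) fastforce+
  also have "card ((\<lambda>y. y + w) ` S') = card S'" by (intro card_image) (auto simp: inj_on_def)
  finally show "card ({q..N} - cover gs) = nat w + card ({q..N - w} - cover gs')"
    by (simp add: S_def S'_def w_def)
  have sq: "squeeze S x = squeeze S' (shift (n - 1) w x)" if "x < q \<or> n \<le> x" for x
    using that
  proof
    assume x: "x < q"
    then have "S \<inter> {..x} = {}" "S' \<inter> {..x} = {}" by (auto simp: S_def S'_def)
    then show ?thesis using x qn by (simp add: squeeze_def shift_def)
  next
    assume x: "n \<le> x"
    have "S \<inter> {..x} = {q..<n} \<union> (\<lambda>y. y + w) ` (S' \<inter> {..x - w})" using x by (auto simp: S)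
    moreover have "card ({q..<n} \<union> (\<lambda>y. y + w) ` (S' \<inter> {..x - w}))
        = card {q..<n} + card ((\<lambda>y. y + w) ` (S' \<inter> {..x - w}))"
      using fin ge by (intro card_Un_disjoint) fastforce+
    moreover have "card ((\<lambda>y. y + w) ` (S' \<inter> {..x - w})) = card (S' \<inter> {..x - w})"
      by (intro card_image) (auto simp: inj_on_def)
    ultimately show ?thesis using x qn by (simp add: squeeze_def shift_def w_def)
  qed
  have "relabel (squeeze S) g = relabel (squeeze S') (relabel (shift (n - 1) w) g)" if "g \<in> set gs" for g
  proof (cases g)
    case (Pairing a b c d p)
    then have "\<forall>x \<in> {a, b, c, d}. x < q \<or> n \<le> x" using pair[of a b c d p] that by auto
    then show ?thesis using sq by (simp add: Pairing)
  qed
  then show "map (relabel (squeeze ({q..N} - cover gs))) gs = map (relabel (squeeze ({q..N - w} - cover gs'))) gs'"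
    by (simp add: gs'_def S_def S'_def w_def)
qed

text \<open>
  If \<open>q\<close> is static, an interval containing a later point before \<open>n\<close> would have to start in between.
\<close>

lemma static_gap:
  assumes "all_on N gs" "q \<notin> cover gs" "n = val (next_start_t q N gs)"
  shows "cover gs \<inter> {q..<n} = {}"
proof (rule ccontr)
  assume "\<not> ?thesis"
  then obtain x where x: "q \<le> x" "x < n" and "x \<in> cover gs" by auto
  then obtain g where g: "g \<in> set gs" "x \<in> {dom_lo g..dom_hi g} \<union> {ran_lo g..ran_hi g}"
    unfolding cover_def by blast
  have "q \<notin> {dom_lo g..dom_hi g} \<union> {ran_lo g..ran_hi g}"
    using assms(2) g(1) by (auto simp: cover_def)
  then have "dom_lo g \<in> {q<..<n} \<or> ran_lo g \<in> {q<..<n}" using g(2) x by auto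
  then show False using next_start_props(2)[OF assms(1) g(1)] assms(3) by blast
qed

text \<open>
  Skipped stretches are covered and contracted ones are not, so the sweep deletes the static points from
  \<open>q\<close> on and no others.
\<close>

lemma val_contract_from:
  assumes "1 \<le> q" "all_on N gs"
  defines "S \<equiv> {q..N} - cover gs"
  shows "val (contract_from_t q N gs cnt) =
    (N - int (card S), map (relabel (squeeze S)) gs, cnt + int (card S))"
  using assms(1,2) unfolding S_def
proof (induction "nat (N + 1 - q)" arbitrary: q N gs cnt rule: less_induct)
  case less
  define e where "e = val (cover_end_t q gs)"
  define n where "n = val (next_start_t q N gs)"
  have id: "map (relabel (squeeze {})) gs = gs"
    by (rule map_idI) (metis relabel.simps pairing.exhaust squeeze_def Int_empty_left card.empty diff_zero of_nat_0)
  consider "N < q" | "q \<le> N" "q < e" | "q \<le> N" "\<not> q < e" by linarith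
  then show ?case
  proof cases
    case 1
    then show ?thesis by (subst contract_from_t.simps) (simp add: id)
  next
    case 2
    have "{q..<e} \<subseteq> cover gs" unfolding e_def by (rule cover_end_props)
    then have S: "{q..N} - cover gs = {e..N} - cover gs" using 2 by force
    have "val (contract_from_t q N gs cnt) = val (contract_from_t e N gs cnt)"
      using 2 by (subst contract_from_t.simps) (simp add: e_def)
    also have "\<dots> = (N - int (card ({e..N} - cover gs)), map (relabel (squeeze ({e..N} - cover gs))) gs,
        cnt + int (card ({e..N} - cover gs)))"
      using 2 less.prems by (intro less.hyps) auto
    finally show ?thesis by (simp only: S)
  next
    case 3
    define gs' where "gs' = map (relabel (shift (n - 1) (n - q))) gs"
    have "q \<notin> cover gs" using cover_end_props(3)[of q gs] 3 by (auto simp: e_def)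
    then have gap: "cover gs \<inter> {q..<n} = {}" using static_gap less.prems by (simp add: n_def)
    have qn: "q < n" unfolding n_def using 3 by (intro next_start_t_greater)
    have nN: "n \<le> N + 1" unfolding n_def by (rule next_start_props(1)[OF less.prems(2)])
    note one = contract_one[OF less.prems(2,1) qn nN gap, folded gs'_def]
    have "val (contract_from_t q N gs cnt) = val (contract_from_t q (N - (n - q)) gs' (cnt + (n - q)))"
      using 3 by (subst contract_from_t.simps) (simp add: e_def n_def val_contract gs'_def)
    also have "\<dots> = (N - (n - q) - int (card ({q..N - (n - q)} - cover gs')),
        map (relabel (squeeze ({q..N - (n - q)} - cover gs'))) gs',
        cnt + (n - q) + int (card ({q..N - (n - q)} - cover gs')))"
      using 3 less.prems(1) one(1) qn by (intro less.hyps) auto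
    finally show ?thesis using one(2,3) qn by simp
  qed
qed

definition statics :: "int \<Rightarrow> pairing list \<Rightarrow> int set" where
  "statics N gs = {1..N} - cover gs"

lemma finite_statics [simp]: "finite (statics N gs)"
  by (simp add: statics_def)

lemma squeeze_end:
  assumes "1 \<le> N" shows "squeeze (statics N gs) N = N - int (card (statics N gs))"
proof -
  have "statics N gs \<inter> {..N} = statics N gs" by (auto simp: statics_def)
  then show ?thesis by (simp add: squeeze_def)
qed

lemma squeeze_zero: "squeeze (statics N gs) 0 = 0"
proof -
  have "statics N gs \<inter> {..0} = {}" by (auto simp: statics_def)
  then show ?thesis by (simp add: squeeze_def)
qed

lemma squeeze_pos:
  assumes "x \<in> {1..N} - statics N gs" shows "1 \<le> squeeze (statics N gs) x"
  using squeeze_strict[of "statics N gs" 0 x] squeeze_zero[of N gs] assms by simp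

text \<open>
  No point of a domain or range is deleted, so both are translated as a whole.
\<close>

lemma squeeze_pairing:
  assumes "all_on N gs" "g \<in> set gs"
  defines "f \<equiv> squeeze (statics N gs)"
  shows "x \<in> {dom_lo g..dom_hi g} \<Longrightarrow> f x - f (dom_lo g) = x - dom_lo g"
    and "x \<in> {ran_lo g..ran_hi g} \<Longrightarrow> f x - f (ran_lo g) = x - ran_lo g"
proof -
  have "{dom_lo g..dom_hi g} \<subseteq> cover gs" "{ran_lo g..ran_hi g} \<subseteq> cover gs"
    using assms(2) by (auto simp: cover_def)
  then show "x \<in> {dom_lo g..dom_hi g} \<Longrightarrow> f x - f (dom_lo g) = x - dom_lo g"
    "x \<in> {ran_lo g..ran_hi g} \<Longrightarrow> f x - f (ran_lo g) = x - ran_lo g"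
    unfolding f_def by (auto intro!: squeeze_rigid simp: statics_def subset_iff)
qed

lemma relabel_on:
  assumes "all_on N gs" "g \<in> set gs"
  shows "pairing_on (N - int (card (statics N gs))) (relabel (squeeze (statics N gs)) g)"
proof (cases g)
  case (Pairing a b c d p)
  have on: "1 \<le> a" "a \<le> b" "a \<le> c" "d \<le> N" "d - c = b - a" using assms Pairing by fastforce+
  have "{a..b} \<subseteq> cover gs" using assms(2) Pairing by (force simp: cover_def)
  then have "a \<notin> statics N gs" using on by (auto simp: statics_def)
  then show ?thesis
    using on squeeze_pairing[OF assms, of b] squeeze_pairing[OF assms, of d] squeeze_end[of N gs]
      squeeze_mono[of "statics N gs" a c] squeeze_mono[of "statics N gs" d N] squeeze_pos[of a N gs]
    by (simp add: Pairing)
qed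

lemma relabel_graph:
  assumes "all_on N gs" "g \<in> set gs"
  defines "f \<equiv> squeeze (statics N gs)"
  shows "pairing_graph (relabel f g) = (\<lambda>(x, y). (f x, f y)) ` pairing_graph g"
proof (cases g)
  case (Pairing a b c d p)
  have on: "1 \<le> a" "a \<le> b" "a \<le> c" "d \<le> N" "d - c = b - a" using assms Pairing by fastforce+
  have dom: "f x = f a + (x - a)" if "a \<le> x" "x \<le> b" for x
    using squeeze_pairing(1)[OF assms(1,2), of x] that by (simp add: Pairing f_def)
  have ran: "f y = f c + (y - c)" if "c \<le> y" "y \<le> d" for y
    using squeeze_pairing(2)[OF assms(1,2), of y] that by (simp add: Pairing f_def)
  have fb: "f b = f a + (b - a)" and fd: "f d = f c + (d - c)" using dom[of b] ran[of d] on by auto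
  have "pairing_graph (relabel f g) =
      (\<lambda>(x, y). (f a + (x - a), f c + (y - c))) ` pairing_graph g"
    unfolding Pairing relabel.simps fb fd
    by (rule graph_image_cong[where f' = "\<lambda>x. x - f a + a" and h' = "\<lambda>y. y - f c + c"])
      (use on in \<open>auto simp: pairing_graph_simp split: if_splits\<close>)
  also have "\<dots> = (\<lambda>(x, y). (f x, f y)) ` pairing_graph g"
  proof (rule image_cong[OF refl])
    fix z assume "z \<in> pairing_graph g"
    then have "a \<le> fst z" "fst z \<le> b" "c \<le> snd z" "snd z \<le> d"
      using on by (auto simp: Pairing pairing_graph_simp split: if_splits)
    then show "(\<lambda>(x, y). (f a + (x - a), f c + (y - c))) z = (\<lambda>(x, y). (f x, f y)) z"
      using dom[of "fst z"] ran[of "snd z"] by (simp add: case_prod_unfold)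
  qed
  finally show ?thesis .
qed

text \<open>
  Each static point is an orbit of its own, and on the covered points the relabelling is a bijection
  that carries edges to edges.
\<close>

lemma contraction_orbits:
  assumes wf: "all_on N gs" and N: "0 \<le> N"
  defines "S \<equiv> statics N gs"
  shows "card ({1..N} // eqv gs) =
    card S + card ({1..N - int (card S)} // eqv (map (relabel (squeeze S)) gs))"
proof -
  define C where "C = cover gs"
  define f where "f = squeeze S"
  define gs' where "gs' = map (relabel f) gs"
  define N' where "N' = N - int (card S)"
  have fin: "finite S" by (simp add: S_def)
  have C: "C \<subseteq> {1..N}" "{1..N} = S \<union> C" "S \<inter> C = {}"
    using cover_on[OF wf] by (auto simp: C_def S_def statics_def)
  have graph: "pairing_graph (relabel f g) = (\<lambda>(x, y). (f x, f y)) ` pairing_graph g"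
    if "g \<in> set gs" for g using relabel_graph[OF wf that] by (simp add: f_def S_def)
  have gC: "pairing_graph g \<subseteq> C \<times> C" if "g \<in> set gs" for g
  proof -
    have "pairing_on N g" "{dom_lo g..dom_hi g} \<union> {ran_lo g..ran_hi g} \<subseteq> C"
      using that wf by (auto simp: C_def cover_def)
    then show ?thesis by (cases g) (auto simp: pairing_graph_simp split: if_splits)
  qed
  have inj: "inj_on f C"
  proof (rule linorder_inj_onI')
    fix x y assume "x \<in> C" "y \<in> C" "x < y"
    then show "f x \<noteq> f y" using squeeze_strict[OF fin, of x y] C(3) by (fastforce simp: f_def)
  qed
  have "f ` C \<subseteq> {1..N'}"
  proof
    fix z assume "z \<in> f ` C"
    then obtain x where x: "x \<in> C" "z = f x" by blast
    then have "x \<in> {1..N} - S" using C by auto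
    then show "z \<in> {1..N'}"
      using squeeze_pos[of x N gs] squeeze_mono[OF fin, of x N] squeeze_end[of N gs] x
      by (simp add: f_def S_def N'_def)
  qed
  moreover have "card (f ` C) = card {1..N'}"
  proof -
    have "finite C" using C(1) by (rule finite_subset) simp
    then have "card {1..N} = card S + card C" unfolding C(2) using C(3) fin by (intro card_Un_disjoint)
    then show ?thesis using inj N by (simp add: card_image N'_def)
  qed
  ultimately have img: "f ` C = {1..N'}" by (intro card_subset_eq) auto
  have fwd: "eqv gs \<subseteq> {(x, y). x = y \<or> x \<in> C \<and> y \<in> C \<and> (f x, f y) \<in> eqv gs'}"
  proof (rule eqv_least)
    fix g assume g: "g \<in> set gs"
    then have "pairing_graph (relabel f g) \<subseteq> eqv gs'" by (intro graph_eqv) (simp add: gs'_def)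
    then show "pairing_graph g \<subseteq> {(x, y). x = y \<or> x \<in> C \<and> y \<in> C \<and> (f x, f y) \<in> eqv gs'}"
      using gC[OF g] graph[OF g] by auto
  next
    show "equiv UNIV {(x, y). x = y \<or> x \<in> C \<and> y \<in> C \<and> (f x, f y) \<in> eqv gs'}"
      by (auto simp: equiv_def refl_on_def sym_def trans_def intro: eqv_sym eqv_trans)
  qed
  define r where "r = inv_into C f"
  have r: "r (f x) = x" if "x \<in> C" for x using inj that by (simp add: r_def)
  have bwd: "eqv gs' \<subseteq> {(x, y). x = y \<or> x \<in> {1..N'} \<and> y \<in> {1..N'} \<and> (r x, r y) \<in> eqv gs}"
  proof (rule eqv_least)
    fix h assume "h \<in> set gs'"
    then obtain g where g: "g \<in> set gs" "h = relabel f g" by (auto simp: gs'_def)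
    have "x \<in> {1..N'} \<and> y \<in> {1..N'} \<and> (r x, r y) \<in> eqv gs" if "(x, y) \<in> pairing_graph h" for x y
    proof -
      from that obtain u v where uv: "(u, v) \<in> pairing_graph g" "x = f u" "y = f v"
        using graph[OF g(1)] g(2) by auto
      then have "u \<in> C" "v \<in> C" "(u, v) \<in> eqv gs" using gC[OF g(1)] graph_eqv[OF g(1)] by auto
      then show ?thesis using uv img r by auto
    qed
    then show "pairing_graph h \<subseteq> {(x, y). x = y \<or> x \<in> {1..N'} \<and> y \<in> {1..N'} \<and> (r x, r y) \<in> eqv gs}"
      by blast
  next
    show "equiv UNIV {(x, y). x = y \<or> x \<in> {1..N'} \<and> y \<in> {1..N'} \<and> (r x, r y) \<in> eqv gs}"
      by (auto simp: equiv_def refl_on_def sym_def trans_def intro: eqv_sym eqv_trans)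
  qed
  have "card (C // eqv gs) = card ({1..N'} // eqv gs')"
  proof (rule card_quotient_transfer[where f = f])
    show "f ` C \<subseteq> {1..N'}" by (simp add: img)
    show "\<exists>x \<in> C. (f x, y) \<in> eqv gs'" if "y \<in> {1..N'}" for y
      using that unfolding img[symmetric] by (auto intro: eqv_refl)
    show "(x, y) \<in> eqv gs \<longleftrightarrow> (f x, f y) \<in> eqv gs'" if "x \<in> C" "y \<in> C" for x y
    proof
      assume "(x, y) \<in> eqv gs"
      then show "(f x, f y) \<in> eqv gs'" using fwd by auto
    next
      assume "(f x, f y) \<in> eqv gs'"
      then have "f x = f y \<or> (r (f x), r (f y)) \<in> eqv gs" using bwd by auto
      then show "(x, y) \<in> eqv gs" using r that by (metis eqv_refl)
    qed
  qed (rule equiv_eqv)+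
  moreover have "card ({1..N} // eqv gs) = card S + card (C // eqv gs)"
  proof -
    have sing: "eqv gs `` {x} = {x}" if "x \<in> S" for x using that fwd C(3) by fastforce
    have "{1..N} // eqv gs = (\<lambda>x. {x}) ` S \<union> C // eqv gs"
      unfolding C(2) using sing by (auto simp: quotient_def)
    moreover have "(\<lambda>x. {x}) ` S \<inter> C // eqv gs = {}"
    proof -
      have "X \<inter> C \<noteq> {}" if "X \<in> C // eqv gs" for X using that by (auto simp: quotient_def)
      then show ?thesis using C(3) by auto
    qed
    moreover have "finite (C // eqv gs)"
      using finite_subset[OF C(1)] by (simp add: quotient_def)
    ultimately show ?thesis using fin by (simp add: card_Un_disjoint card_image)
  qed
  ultimately show ?thesis by (simp add: gs'_def N'_def f_def)
qed

text \<open>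
  The relabelling grows by at most \<open>1\<close> from each point to the next, so the first point where it
  attains \<open>z\<close> is not static.
\<close>

lemma statics_contracted:
  assumes wf: "all_on N gs" and N: "0 \<le> N"
  shows "statics (N - int (card (statics N gs))) (map (relabel (squeeze (statics N gs))) gs) = {}"
proof -
  define S where "S = statics N gs"
  define f where "f = squeeze S"
  have "z \<in> cover (map (relabel f) gs)" if z: "1 \<le> z" "z \<le> N - int (card S)" for z
  proof -
    have "f 0 = 0" unfolding f_def S_def by (rule squeeze_zero)
    have fN: "f N = N - int (card S)"
      using squeeze_end[of N gs] z by (simp add: f_def S_def)
    define k where "k = (LEAST k. z \<le> f (int k))"
    have "z \<le> f (int (nat N))" using z N fN by simp
    then have k: "z \<le> f (int k)" "k \<le> nat N" unfolding k_def by (rule LeastI, rule Least_le)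
    have "k \<noteq> 0"
    proof
      assume "k = 0"
      then show False using k(1) z(1) \<open>f 0 = 0\<close> by simp
    qed
    then have k': "f (int k - 1) < z" using not_less_Least[of "k - 1" "\<lambda>k. z \<le> f (int k)"]
      by (auto simp: k_def[symmetric] of_nat_diff not_le)
    have diff: "f (int k) - f (int k - 1) = 1 - int (card (S \<inter> {int k - 1<..int k}))"
      using squeeze_diff[of S "int k - 1" "int k"] by (simp add: f_def S_def)
    have "int k \<notin> S"
    proof
      assume "int k \<in> S"
      then have "S \<inter> {int k - 1<..int k} = {int k}" by auto
      then show False using diff k k' by simp
    qed
    then have "int k \<in> cover gs" using k(2) \<open>k \<noteq> 0\<close> by (auto simp: S_def statics_def)
    moreover have fk: "f (int k) = z" using diff k k' by linarith
    ultimately obtain g where g: "g \<in> set gs" "int k \<in> {dom_lo g..dom_hi g} \<union> {ran_lo g..ran_hi g}"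
      by (auto simp: cover_def)
    have "z \<in> {f (dom_lo g)..f (dom_hi g)} \<union> {f (ran_lo g)..f (ran_hi g)}"
      using g(2) squeeze_mono[of S] unfolding fk[symmetric] f_def by (auto simp: S_def)
    moreover have "dom_lo (relabel f g) = f (dom_lo g)" "dom_hi (relabel f g) = f (dom_hi g)"
      "ran_lo (relabel f g) = f (ran_lo g)" "ran_hi (relabel f g) = f (ran_hi g)" by (cases g; simp)+
    ultimately show ?thesis using g(1) by (auto simp: cover_def intro!: bexI[of _ g])
  qed
  then show ?thesis by (auto simp: statics_def[of _ "map _ _"] S_def f_def)
qed

section \<open>Truncation\<close>

text \<open>
  A point that is paired with exactly one other point is a leaf of the graph of all pairs; removing
  a leaf does not change the number of components.
\<close>

lemma remove_leaf:
  assumes edges: "edges gs = insert (u, N) (edges gs')" and on: "edges gs' \<subseteq> {1..N - 1} \<times> {1..N - 1}"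
    and u: "u \<in> {1..N - 1}"
  shows "card ({1..N} // eqv gs) = card ({1..N - 1} // eqv gs')"
proof -
  define f where "f = (\<lambda>x. if x = N then u else x)"
  have sub: "eqv gs' \<subseteq> eqv gs"
    unfolding eqv_def by (rule rtrancl_mono) (auto simp: edges)
  have uN: "(u, N) \<in> eqv gs" using edges_eqv edges by blast
  have "(f x, f y) \<in> eqv gs'" if "(x, y) \<in> eqv gs" for x y
    using that unfolding eqv_def[of gs]
  proof (induction rule: rtrancl_induct)
    case (step y z)
    then have "(y, z) \<in> edges gs' \<union> (edges gs')\<inverse> \<or> {y, z} = {u, N}" by (auto simp: edges)
    then have "(f y, f z) \<in> eqv gs'"
    proof
      assume yz: "(y, z) \<in> edges gs' \<union> (edges gs')\<inverse>"
      then have "f y = y" "f z = z" using on by (auto simp: f_def)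
      moreover have "(y, z) \<in> eqv gs'" using yz edges_eqv[of gs'] by (auto intro: eqv_sym)
      ultimately show ?thesis by simp
    next
      assume "{y, z} = {u, N}"
      then have "f y = f z" by (auto simp: f_def doubleton_eq_iff)
      then show ?thesis by simp
    qed
    with step.IH show ?case by (rule eqv_trans)
  next
    case base
    show ?case by (rule eqv_refl)
  qed
  moreover have "(x, f x) \<in> eqv gs" for x using uN by (auto simp: f_def intro: eqv_sym)
  ultimately have iff: "(x, y) \<in> eqv gs \<longleftrightarrow> (f x, f y) \<in> eqv gs'" for x y
    using sub by (meson eqv_sym eqv_trans subsetD)
  show ?thesis
  proof (rule card_quotient_transfer[where f = f])
    show "f ` {1..N} \<subseteq> {1..N - 1}" using u by (auto simp: f_def)
    show "\<exists>x \<in> {1..N}. (f x, y) \<in> eqv gs'" if "y \<in> {1..N - 1}" for y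
      using that by (intro bexI[of _ y]) (auto simp: f_def)
  qed (use iff in \<open>auto intro: equiv_eqv\<close>)
qed

text \<open>
  The truncated pairing in front of the others; nothing of it is left if \<open>c = M + 1\<close>.
\<close>

fun truncate :: "int \<Rightarrow> int \<Rightarrow> pairing \<Rightarrow> pairing list \<Rightarrow> pairing list" where
  "truncate N M (Pairing a b c d p) hs =
     (if c = M + 1 then hs
      else (if p then Pairing a (b - (N - M)) c M p else Pairing (a + (N - M)) b c M p) # hs)"

lemma val_truncate: "val (truncate_t N M g hs) = (M, truncate N M g hs)"
  by (cases g) auto

declare truncate_t.simps [simp del]

lemma truncate_on:
  assumes "pairing_on N g" "ran_hi g = N" "proper g" "ran_lo g \<le> M + 1" "M \<le> N" "all_on M hs"
  shows "all_on M (truncate N M g hs)"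
  using assms by (cases g) auto

lemma truncate_edge:
  assumes g: "pairing_on N g" "ran_hi g = N" "proper g" and hs: "all_on (N - 1) hs"
  shows "card ({1..N} // eqv (g # hs)) = card ({1..N - 1} // eqv (truncate N (N - 1) g hs))"
proof (cases g)
  case (Pairing a b c d p)
  have on: "1 \<le> a" "a \<le> b" "a < c" "d = N" "N - c = b - a" "p \<or> b < c"
    using g by (auto simp: Pairing)
  define u where "u = (if p then b else a)"
  have u: "u \<in> {1..N - 1}" using on by (auto simp: u_def)
  have "pairing_graph g = insert (u, N) (edges (truncate N (N - 1) g []))"
    using on by (auto simp: Pairing u_def edges_def pairing_graph_simp split: if_splits)
  moreover have "edges (truncate N (N - 1) g hs) = edges (truncate N (N - 1) g []) \<union> edges hs"
    by (auto simp: Pairing edges_def)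
  ultimately have "edges (g # hs) = insert (u, N) (edges (truncate N (N - 1) g hs))"
    by (auto simp: edges_def)
  moreover have "all_on (N - 1) (truncate N (N - 1) g hs)"
    using g hs on by (intro truncate_on) (auto simp: Pairing)
  ultimately show ?thesis using u by (intro remove_leaf) (auto dest: edges_on)
qed

text \<open>
  The points of \<open>[M+1,N]\<close> are removed one at a time from the top. Each is a leaf when its turn comes,
  even if it belongs to the domain of the truncated pairing originally: the domain of a proper pairing
  ends below the top.
\<close>

lemma truncate_orbits:
  assumes "pairing_on N g" "ran_hi g = N" "proper g" "ran_lo g \<le> M + 1" "M \<le> N" "all_on M hs"
  shows "card ({1..N} // eqv (g # hs)) = card ({1..M} // eqv (truncate N M g hs))"
  using assms
proof (induction "nat (N - M)" arbitrary: N g)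
  case 0
  then show ?case by (cases g) auto
next
  case (Suc n)
  then have MN: "M < N" by linarith
  obtain a b c p where g: "g = Pairing a b c N p" using Suc.prems(2) by (cases g) auto
  have hs: "all_on (N - 1) hs"
  proof
    fix h assume "h \<in> set hs"
    then have "pairing_on M h" using Suc.prems(6) by blast
    then show "pairing_on (N - 1) h" using MN by (cases h) auto
  qed
  have one: "card ({1..N} // eqv (g # hs)) = card ({1..N - 1} // eqv (truncate N (N - 1) g hs))"
    using Suc.prems hs by (intro truncate_edge)
  show ?case
  proof (cases "c = N")
    case True
    then have "M = N - 1" using Suc.prems(4) MN by (simp add: g)
    then show ?thesis using one by simp
  next
    case False
    define g' where "g' = (if p then Pairing a (b - 1) c (N - 1) p else Pairing (a + 1) b c (N - 1) p)"
    have "pairing_on (N - 1) g'" "ran_hi g' = N - 1" "proper g'" "ran_lo g' \<le> M + 1"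
      using Suc.prems(1,3,4) False by (auto simp: g g'_def)
    then have "card ({1..N - 1} // eqv (g' # hs)) = card ({1..M} // eqv (truncate (N - 1) M g' hs))"
      using Suc.hyps(2) MN Suc.prems(6) by (intro Suc.hyps(1)) auto
    moreover have "truncate N (N - 1) g hs = g' # hs" using False by (simp add: g g'_def)
    moreover have "truncate (N - 1) M g' hs = truncate N M g hs" by (simp add: g g'_def)
    ultimately show ?thesis using one by simp
  qed
qed


section \<open>Deletions and mergers\<close>

lemma non_identity_simp [simp]:
  "val (non_identity_t (Pairing a b c d p)) \<longleftrightarrow> \<not> (a = c \<and> (p \<or> a = b))"
  by auto

declare non_identity_t.simps [simp del]

lemma delete_identities_eqv:
  assumes "all_on N gs"
  shows "eqv (filter (\<lambda>g. val (non_identity_t g)) gs) = eqv gs"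
proof (rule eqv_eqI)
  fix g assume g: "g \<in> set gs"
  let ?gs = "filter (\<lambda>g. val (non_identity_t g)) gs"
  show "pairing_graph g \<subseteq> eqv ?gs"
  proof (cases "val (non_identity_t g)")
    case True
    then show ?thesis using g by (intro graph_eqv) simp
  next
    case False
    moreover have "pairing_on N g" using g assms by blast
    ultimately show ?thesis by (cases g) (auto simp: pairing_graph_simp)
  qed
next
  show "pairing_graph g \<subseteq> eqv gs" if "g \<in> set (filter (\<lambda>g. val (non_identity_t g)) gs)" for g
    using that by (intro graph_eqv) simp
qed

lemma merge_None: "val (merge_t g h) = None \<longleftrightarrow> \<not> mergeable g h"
  by (cases g; cases h) (simp add: val_merge Let_def)

lemma merge_with_None: "val (merge_with_t g hs) = None \<Longrightarrow> \<forall>h \<in> set hs. \<not> mergeable g h"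
  by (induction g hs rule: merge_with_t.induct) (auto simp: merge_None split: option.splits)

lemma merge_with_Some:
  "val (merge_with_t g hs) = Some gs' \<Longrightarrow>
     \<exists>h m R. set hs = insert h R \<and> set gs' = insert m R \<and> val (merge_t g h) = Some m"
proof (induction hs arbitrary: gs')
  case (Cons h hs)
  show ?case
  proof (cases "val (merge_t g h)")
    case None
    with Cons.prems obtain gs'' where gs'': "val (merge_with_t g hs) = Some gs''" "gs' = h # gs''"
      by auto
    from Cons.IH[OF gs''(1)] obtain h' m R
      where "set hs = insert h' R" "set gs'' = insert m R" "val (merge_t g h') = Some m" by blast
    then show ?thesis using gs''(2)
      by (intro exI[of _ h'] exI[of _ m] exI[of _ "insert h R"]) (simp add: insert_commute)
  next
    case (Some m)
    then have "set (h # hs) = insert h (set hs)" "set gs' = insert m (set hs)"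
      using Cons.prems by auto
    then show ?thesis using Some by blast
  qed
qed simp

lemma merge_first_None: "val (merge_first_t gs) = None \<Longrightarrow> sorted_wrt (\<lambda>g h. \<not> mergeable g h) gs"
  by (induction gs rule: merge_first_t.induct) (auto dest: merge_with_None split: option.splits)

text \<open>
  Sets suffice here: the order of the list and repetitions matter neither for the orbits nor for
  \<open>ready\<close>.
\<close>

lemma merge_first_Some:
  "val (merge_first_t gs) = Some gs' \<Longrightarrow>
     \<exists>g h m R. set gs = insert g (insert h R) \<and> set gs' = insert m R \<and> val (merge_t g h) = Some m"
proof (induction gs arbitrary: gs')
  case (Cons g gs)
  show ?case
  proof (cases "val (merge_with_t g gs)")
    case None
    with Cons.prems obtain gs'' where gs'': "val (merge_first_t gs) = Some gs''" "gs' = g # gs''"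
      by auto
    from Cons.IH[OF gs''(1)] obtain g' h' m R where
      "set gs = insert g' (insert h' R)" "set gs'' = insert m R" "val (merge_t g' h') = Some m" by blast
    then show ?thesis using gs''(2)
      by (intro exI[of _ g'] exI[of _ h'] exI[of _ m] exI[of _ "insert g R"]) (simp add: insert_commute)
  next
    case (Some hs)
    from merge_with_Some[OF this] obtain h m R
      where R: "set gs = insert h R" "set hs = insert m R" "val (merge_t g h) = Some m" by blast
    moreover have "set gs' = set hs" using Some Cons.prems by simp
    ultimately have "set (g # gs) = insert g (insert h R)" "set gs' = insert m R" by auto
    then show ?thesis using R(3) by blast
  qed
qed simp

lemma merge_shape:
  assumes "val (merge_t g h) = Some m" "pairing_on N g" "pairing_on N h"
  shows "proper m" "ran_hi m = max (ran_hi g) (ran_hi h)"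
    "cover [g, h] \<subseteq> cover [m]"
proof -
  obtain a b c d p a' b' c' d' p'
    where gh: "g = Pairing a b c d p" "h = Pairing a' b' c' d' p'" by (metis pairing.exhaust)
  define t where "t = gcd (c - a) (c' - a')"
  have mg: "mergeable g h" and m: "m = Pairing (min a a') (max d d' - t) (min a a' + t) (max d d') True"
    using assms(1) unfolding gh val_merge t_def by (auto simp: Let_def split: if_splits)
  have "0 < t" "t \<le> c - a" using mg by (auto simp: t_def gh mergeable_def intro!: gcd_le1_int)
  then show "proper m" "ran_hi m = max (ran_hi g) (ran_hi h)" by (simp_all add: m gh)
  show "cover [g, h] \<subseteq> cover [m]"
    using assms(2,3) mg \<open>0 < t\<close> \<open>t \<le> c - a\<close>
    by (auto simp: gh m mergeable_def min_def max_def split: if_splits)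
qed

text \<open>
  What the operations between two contractions rely on. That some range ends at \<open>N\<close> holds after a
  contraction because \<open>N\<close> is then covered, and a domain never ends above its range.
\<close>

definition ready :: "int \<Rightarrow> pairing list \<Rightarrow> bool" where
  "ready N gs \<longleftrightarrow> all_on N gs \<and> (\<forall>g \<in> set gs. proper g) \<and> (gs \<noteq> [] \<longrightarrow> (\<exists>g \<in> set gs. ran_hi g = N))"

lemma merge_first_step:
  assumes "val (merge_first_t gs) = Some gs'" "ready N gs"
  shows "ready N gs'" "eqv gs' = eqv gs" "cover gs \<subseteq> cover gs'"
proof -
  from merge_first_Some[OF assms(1)] obtain g h m R where
    R: "set gs = insert g (insert h R)" "set gs' = insert m R" "val (merge_t g h) = Some m" by blast
  have on: "pairing_on N g" "pairing_on N h" "\<And>x. x \<in> R \<Longrightarrow> pairing_on N x"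
    using assms(2) R(1) by (auto simp: ready_def)
  note shape = merge_shape[OF R(3) on(1,2)]
  have "pairing_on N m" using merge_on[OF on(1,2) R(3)] .
  moreover have "\<exists>x \<in> set gs'. ran_hi x = N"
  proof -
    from assms(2) R(1) obtain x where x: "x \<in> insert g (insert h R)" "ran_hi x = N"
      by (auto simp: ready_def)
    have le: "ran_hi x \<le> N" if "pairing_on N x" for x using that by (cases x) auto
    from x show ?thesis using shape(2) le[OF on(1)] le[OF on(2)] R(2) by auto
  qed
  ultimately show "ready N gs'" using assms(2) R shape(1) by (auto simp: ready_def)
  show "cover gs \<subseteq> cover gs'"
    using shape(3) unfolding cover_def R(1,2) by (simp only: UN_insert list.set) blast
  show "eqv gs' = eqv gs"
  proof (rule eqv_eqI)
    fix x assume "x \<in> set gs'"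
    then consider "x = m" | "x \<in> R" using R(2) by blast
    then show "pairing_graph x \<subseteq> eqv gs"
    proof cases
      case 1
      then show ?thesis
        using merge_graph[OF on(1) _ on(2) _ R(3)] R(1) by (simp add: graph_eqv)
    qed (use R(1) in \<open>auto intro!: graph_eqv\<close>)
  next
    fix x assume "x \<in> set gs"
    then consider "x = g" | "x = h" | "x \<in> R" using R(1) by blast
    moreover have "pairing_graph m \<subseteq> eqv gs'" using R(2) by (intro graph_eqv) simp
    ultimately show "pairing_graph x \<subseteq> eqv gs'"
      using merge_graph_conv[OF on(1,2) R(3), of gs'] R(2) graph_eqv[of x gs'] by cases auto
  qed
qed

lemma merge_all_props:
  assumes "ready N gs"
  defines "gs' \<equiv> val (merge_all_t gs)"
  shows "ready N gs'" "eqv gs' = eqv gs" "cover gs \<subseteq> cover gs'"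
    "sorted_wrt (\<lambda>g h. \<not> mergeable g h) gs'" "gs' = [] \<longleftrightarrow> gs = []"
    "length gs' \<le> length gs" "length gs' = length gs \<Longrightarrow> gs' = gs"
proof -
  have "ready N gs' \<and> eqv gs' = eqv gs \<and> cover gs \<subseteq> cover gs' \<and>
    sorted_wrt (\<lambda>g h. \<not> mergeable g h) gs' \<and> (gs' = [] \<longleftrightarrow> gs = []) \<and> length gs' \<le> length gs \<and>
    (length gs' = length gs \<longrightarrow> gs' = gs)"
    using assms(1) unfolding gs'_def
  proof (induction gs rule: merge_all_t.induct)
    case (1 gs)
    show ?case
    proof (cases "val (merge_first_t gs)")
      case None
      then have "val (merge_all_t gs) = gs" by (subst merge_all_t.simps) simp
      then show ?thesis using "1.prems" merge_first_None[OF None] by simp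
    next
      case (Some hs)
      have "gs \<noteq> []" using Some by auto
      moreover have "hs \<noteq> []" using merge_first_Some[OF Some] by auto
      moreover have "val (merge_all_t gs) = val (merge_all_t hs)"
        by (subst merge_all_t.simps) (simp add: Some)
      ultimately show ?thesis
        using "1.IH"[OF refl Some] merge_first_step[OF Some "1.prems"] merge_first_t_length[OF Some] by auto
    qed
  qed
  then show "ready N gs'" "eqv gs' = eqv gs" "cover gs \<subseteq> cover gs'"
    "sorted_wrt (\<lambda>g h. \<not> mergeable g h) gs'" "gs' = [] \<longleftrightarrow> gs = []"
    "length gs' \<le> length gs" "length gs' = length gs \<Longrightarrow> gs' = gs" by blast+
qed

section \<open>One round of the algorithm\<close>

definition live :: "pairing list \<Rightarrow> pairing list" where
  "live gs = filter (\<lambda>g. val (non_identity_t g)) gs"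

definition contracted :: "int \<Rightarrow> pairing list \<Rightarrow> pairing list" where
  "contracted N gs = map (relabel (squeeze (statics N gs))) gs"

definition trimmed :: "pairing list \<Rightarrow> pairing list" where
  "trimmed gs = map (\<lambda>g. val (trim_t g)) gs"

text \<open>The state reached by deletions, contractions, trimmings and mergers.\<close>

definition prep_size :: "int \<Rightarrow> pairing list \<Rightarrow> int" where
  "prep_size N gs = N - int (card (statics N (live gs)))"

definition prep :: "int \<Rightarrow> pairing list \<Rightarrow> pairing list" where
  "prep N gs = val (merge_all_t (trimmed (contracted N (live gs))))"

lemma live_on: "all_on N gs \<Longrightarrow> all_on N (live gs)"
  by (simp add: live_def)

lemma contracted_on: "all_on N gs \<Longrightarrow> all_on (N - int (card (statics N gs))) (contracted N gs)"
  by (auto simp: contracted_def intro: relabel_on)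

lemma contracted_non_identity:
  assumes "all_on N gs" "g \<in> set gs" "val (non_identity_t g)"
  shows "val (non_identity_t (relabel (squeeze (statics N gs)) g))"
proof (cases g)
  case (Pairing a b c d p)
  have on: "pairing_on N (Pairing a b c d p)" using assms(1,2) Pairing by blast
  have "{a..b} \<union> {c..d} \<subseteq> cover gs" using assms(2) Pairing by (force simp: cover_def)
  then have "b \<notin> statics N gs" "c \<notin> statics N gs" using on by (auto simp: statics_def subset_iff)
  then show ?thesis
    using assms(3) on squeeze_strict[of "statics N gs" a c] squeeze_strict[of "statics N gs" a b]
    by (cases "a = b"; cases "a = c") (auto simp: Pairing)
qed

lemma card_statics_le: "0 \<le> N \<Longrightarrow> int (card (statics N gs)) \<le> N"
proof -
  assume "0 \<le> N"
  have "card (statics N gs) \<le> card {1..N}" by (intro card_mono) (auto simp: statics_def)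
  with \<open>0 \<le> N\<close> show ?thesis by simp
qed

lemma trim_cover:
  assumes "pairing_on N g" "x \<in> cover [g]"
  shows "x \<in> cover [val (trim_t g)] \<or> x = (dom_lo g + ran_hi g) div 2"
  using assms by (cases g) (auto split: if_splits)

lemma ran_hi_trim [simp]: "ran_hi (val (trim_t g)) = ran_hi g"
  by (cases g) simp

lemma proper_trim:
  assumes "pairing_on N g" "val (non_identity_t g)"
  shows "proper (val (trim_t g))"
  using assms by (cases g) auto

text \<open>
  After the contraction every point is covered, and a trimming uncovers at most the centre of one
  reflection. This bounds the number of static points by the number of pairings.
\<close>

lemma trimmed_contracted:
  assumes wf: "all_on N gs" and N: "0 \<le> N" and nid: "\<forall>g \<in> set gs. val (non_identity_t g)"
  defines "N' \<equiv> N - int (card (statics N gs))" and "hs \<equiv> trimmed (contracted N gs)"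
  shows "ready N' hs" "card (statics N' hs) \<le> length gs"
    "card ({1..N} // eqv gs) = card (statics N gs) + card ({1..N'} // eqv hs)"
proof -
  let ?cs = "contracted N gs"
  have wf': "all_on N' ?cs" unfolding N'_def by (rule contracted_on[OF wf])
  have nid': "\<forall>g \<in> set ?cs. val (non_identity_t g)"
    using contracted_non_identity[OF wf] nid by (auto simp: contracted_def)
  have full: "statics N' ?cs = {}"
    unfolding N'_def contracted_def by (rule statics_contracted[OF wf N])
  have "\<exists>g \<in> set hs. ran_hi g = N'" if "hs \<noteq> []"
  proof -
    have "?cs \<noteq> []" using that by (auto simp: hs_def trimmed_def)
    then obtain h where "h \<in> set ?cs" by (cases ?cs) auto
    then have "pairing_on N' h" using wf' by blast
    then have "N' \<in> {1..N'}" by (cases h) auto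
    then have "N' \<in> cover ?cs" using full by (auto simp: statics_def)
    then obtain g where g: "g \<in> set ?cs" "N' \<in> {dom_lo g..dom_hi g} \<union> {ran_lo g..ran_hi g}"
      by (auto simp: cover_def)
    have "pairing_on N' g" using g(1) wf' by blast
    then have "ran_hi g = N'" using g(2) by (cases g) auto
    then show ?thesis using g(1) by (auto simp: hs_def trimmed_def)
  qed
  moreover have "all_on N' hs" "\<forall>g \<in> set hs. proper g"
    using wf' nid' trim_on proper_trim by (auto simp: hs_def trimmed_def)
  ultimately show "ready N' hs" by (auto simp: ready_def)
  have "statics N' hs \<subseteq> (\<lambda>g. (dom_lo g + ran_hi g) div 2) ` set ?cs"
  proof
    fix x assume x: "x \<in> statics N' hs"
    then have "x \<in> cover ?cs" using full by (auto simp: statics_def)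
    then obtain g where g: "g \<in> set ?cs" "x \<in> cover [g]" by (auto simp: cover_def)
    have "x \<notin> cover [val (trim_t g)]" using x g(1) by (auto simp: statics_def cover_def hs_def trimmed_def)
    then show "x \<in> (\<lambda>g. (dom_lo g + ran_hi g) div 2) ` set ?cs"
      using trim_cover[of N' g x] g wf' by auto
  qed
  then have "card (statics N' hs) \<le> card ((\<lambda>g. (dom_lo g + ran_hi g) div 2) ` set ?cs)"
    by (intro card_mono) auto
  also have "\<dots> \<le> card (set ?cs)" by (intro card_image_le) simp
  also have "\<dots> \<le> length ?cs" by (rule card_length)
  finally show "card (statics N' hs) \<le> length gs" by (simp add: contracted_def)
  have "eqv hs = eqv ?cs" unfolding hs_def trimmed_def by (rule trim_eqv[OF wf'])
  then show "card ({1..N} // eqv gs) = card (statics N gs) + card ({1..N'} // eqv hs)"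
    using contraction_orbits[OF wf N] by (simp add: N'_def contracted_def)
qed

lemma trimmed_live:
  assumes "all_on N gs" "0 \<le> N"
  defines "hs \<equiv> trimmed (contracted N (live gs))"
  shows "ready (prep_size N gs) hs" "card (statics (prep_size N gs) hs) \<le> length (live gs)"
    "card ({1..N} // eqv (live gs)) = card (statics N (live gs)) + card ({1..prep_size N gs} // eqv hs)"
  unfolding hs_def prep_size_def
  by (rule trimmed_contracted[OF live_on[OF assms(1)] assms(2)]; simp add: live_def)+

lemma prep_Nil: "all_on N gs \<Longrightarrow> 0 \<le> N \<Longrightarrow> prep N gs = [] \<longleftrightarrow> live gs = []"
  using merge_all_props(5)[OF trimmed_live(1)] by (simp add: prep_def trimmed_def contracted_def)

lemma prep_props:
  assumes wf: "all_on N gs" and N: "0 \<le> N"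
  shows "ready (prep_size N gs) (prep N gs)" "0 \<le> prep_size N gs" "prep_size N gs \<le> N"
    "card (statics (prep_size N gs) (prep N gs)) \<le> length gs"
    "sorted_wrt (\<lambda>g h. \<not> mergeable g h) (prep N gs)"
    "int (card ({1..N} // eqv gs)) =
       N - prep_size N gs + int (card ({1..prep_size N gs} // eqv (prep N gs)))"
    "length (prep N gs) \<le> length gs"
proof -
  let ?N = "prep_size N gs" and ?hs = "trimmed (contracted N (live gs))"
  note tc = trimmed_live[OF wf N]
  note ma = merge_all_props[OF tc(1), folded prep_def]
  show "ready ?N (prep N gs)" "sorted_wrt (\<lambda>g h. \<not> mergeable g h) (prep N gs)" by (rule ma)+
  show "0 \<le> ?N" "?N \<le> N" using card_statics_le[OF N] by (simp_all add: prep_size_def)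
  have "card (statics ?N (prep N gs)) \<le> card (statics ?N ?hs)"
    using ma(3) by (intro card_mono) (auto simp: statics_def)
  also have "\<dots> \<le> length (live gs)" by (rule tc(2))
  also have "\<dots> \<le> length gs" by (simp add: live_def)
  finally show "card (statics ?N (prep N gs)) \<le> length gs" .
  have "length (prep N gs) \<le> length (live gs)" using ma(6) by (simp add: trimmed_def contracted_def)
  also have "\<dots> \<le> length gs" by (simp add: live_def)
  finally show "length (prep N gs) \<le> length gs" .
  have "eqv (live gs) = eqv gs" unfolding live_def by (rule delete_identities_eqv[OF wf])
  then show "int (card ({1..N} // eqv gs)) = N - ?N + int (card ({1..?N} // eqv (prep N gs)))"
    using tc(3) ma(2) by (simp add: prep_size_def)
qed

text \<open>
  Each deletion and each merger shortens the list.
\<close>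

lemma prep_steady:
  assumes "all_on N gs" "0 \<le> N" "length (prep N gs) = length gs"
  shows "\<forall>g \<in> set gs. val (non_identity_t g)" "prep_size N gs = N - int (card (statics N gs))"
    "prep N gs = trimmed (contracted N gs)"
proof -
  note ma = merge_all_props[OF trimmed_live(1)[OF assms(1,2)], folded prep_def]
  have "length (live gs) \<le> length gs" by (simp add: live_def)
  moreover have "length (prep N gs) \<le> length (live gs)" using ma(6) by (simp add: trimmed_def contracted_def)
  ultimately have len: "length (live gs) = length gs" using assms(3) by simp
  then show nid': "\<forall>g \<in> set gs. val (non_identity_t g)"
    unfolding live_def using length_filter_less[of _ gs "\<lambda>g. val (non_identity_t g)"] by fastforce
  then have live: "live gs = gs" by (simp add: live_def)
  then show "prep_size N gs = N - int (card (statics N gs))" by (simp add: prep_size_def)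
  show "prep N gs = trimmed (contracted N gs)"
    using ma(7) assms(3) live by (simp add: trimmed_def contracted_def)
qed

text \<open>
  The part of the lexicographic order that matters for the analysis.
\<close>

definition below :: "pairing \<Rightarrow> pairing \<Rightarrow> bool" where
  "below m h \<longleftrightarrow> ran_hi h < ran_hi m \<or> ran_hi h = ran_hi m \<and> ran_lo m \<le> ran_lo h"

lemma below_trans: "below g h \<Longrightarrow> below h k \<Longrightarrow> below g k"
  by (auto simp: below_def)

lemma select_maximal:
  assumes "val (select_maximal_t g hs) = (m, rest)"
  shows "mset (m # rest) = mset (g # hs)" "\<forall>h \<in> set rest. below m h"
proof -
  have "mset (m # rest) = mset (g # hs) \<and> (\<forall>h \<in> set rest. below m h)"
    using assms
  proof (induction hs arbitrary: g m rest)
    case (Cons h hs)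
    define l where "l = val (lex_less_t g h)"
    obtain m' rest' where m': "val (select_maximal_t (if l then h else g) hs) = (m', rest')"
      by (metis prod.exhaust)
    have m: "m = m'" "rest = (if l then g else h) # rest'"
      using Cons.prems m' by (simp_all add: l_def split: if_splits)
    note IH = Cons.IH[OF m']
    have "below h g" if l using that by (cases g; cases h) (auto simp: l_def below_def)
    moreover have "below g h" if "\<not> l" using that by (cases g; cases h) (auto simp: l_def below_def)
    moreover have "below m' (if l then h else g)"
    proof -
      have "(if l then h else g) \<in> set (m' # rest')" using IH by (metis list.set_intros(1) mset_eq_setD)
      then show ?thesis using IH by (auto simp: below_def)
    qed
    ultimately have "below m' (if l then g else h)" by (auto intro: below_trans split: if_splits)
    then show ?case using IH by (auto simp: m)
  qed simp
  then show "mset (m # rest) = mset (g # hs)" "\<forall>h \<in> set rest. below m h" by blast+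
qed

definition transmit :: "pairing \<Rightarrow> pairing \<Rightarrow> pairing" where
  "transmit m x = (if ran_lo m \<le> ran_lo x then val (transmit_t m x) else x)"

abbreviation width :: "pairing \<Rightarrow> int" where
  "width g \<equiv> ran_hi g - ran_lo g + 1"

abbreviation period :: "pairing \<Rightarrow> int" where
  "period g \<equiv> ran_lo g - dom_lo g"

text \<open>
  The strict bound on the lower end and the upper end \<open>N - 1\<close> leave \<open>m\<close> as the only pairing whose range
  contains \<open>N\<close>. A part of the domain or range of \<open>x\<close> from which the result has moved away lies in the
  range of \<open>m\<close>.
\<close>

lemma transmit_props:
  assumes m: "proper m" "pairing_on N m" "ran_hi m = N"
    and x: "pairing_on N x" "below m x"
  shows "pairing_on (N - 1) (transmit m x)" "width (transmit m x) = width x"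
    "ran_lo (transmit m x) < ran_lo m"
    "cover [x] \<subseteq> cover [m, transmit m x]"
proof -
  obtain a1 b1 c1 p1 a2 b2 c2 d2 p2
    where mx: "m = Pairing a1 b1 c1 N p1" "x = Pairing a2 b2 c2 d2 p2"
    using m(3) by (metis pairing.exhaust pairing.sel(4))
  have on: "1 \<le> a1" "a1 \<le> b1" "N - c1 = b1 - a1" "1 \<le> a2" "a2 \<le> b2" "a2 \<le> c2" "d2 \<le> N"
    "d2 - c2 = b2 - a2" "a1 < c1"
    using m x by (auto simp: mx)
  have "pairing_on (N - 1) (transmit m x) \<and> width (transmit m x) = width x \<and>
    ran_lo (transmit m x) < ran_lo m \<and> cover [x] \<subseteq> cover [m, transmit m x]"
  proof (cases "c1 \<le> c2")
    case False
    then show ?thesis using x by (auto simp: transmit_def mx below_def)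
  next
    case True
    then have T: "transmit m x = val (transmit_t m x)" by (simp add: transmit_def mx)
    have u: "c1 - a1 \<le> disp (c1 - a1) c1 z" "a1 \<le> z - disp (c1 - a1) c1 z" "z - disp (c1 - a1) c1 z < c1"
      if "c1 \<le> z" for z using disp_bounds[of "c1 - a1" c1 z] that on by auto
    show ?thesis
    proof (cases rule: transmit_cases[OF m(1)[unfolded mx] m(2)[unfolded mx] x(1)[unfolded mx] True,
          case_names both one both_rev one_rev])
      case (both u v)
      show ?thesis unfolding mx T[unfolded mx] both(5) using on both(2,3,4) u[OF True] u[of a2]
        by (auto simp: val_orient)
    next
      case (one u)
      show ?thesis unfolding mx T[unfolded mx] one(4) using on one(2,3) u[OF True] by (auto simp: val_orient)
    next
      case (both_rev k)
      show ?thesis unfolding mx T[unfolded mx] both_rev(5) using on both_rev(2,3,4) True by (auto simp: val_orient)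
    next
      case (one_rev k)
      show ?thesis unfolding mx T[unfolded mx] one_rev(5) using on one_rev(2,3,4) True by (auto simp: val_orient)
    qed
  qed
  then show "pairing_on (N - 1) (transmit m x)" "width (transmit m x) = width x"
    "ran_lo (transmit m x) < ran_lo m" "cover [x] \<subseteq> cover [m, transmit m x]" by blast+
qed

lemma val_transmit_all:
  assumes "val (select_maximal_t g gs) = (m, rest)" "all_on N rest"
  shows "val (transmit_all_t N (g # gs)) = m # map (transmit m) rest"
proof -
  have "val (transmit_if_t N m x) = transmit m x" if "pairing_on N x" for x
    using that by (cases x) (simp add: transmit_if_t_def transmit_def)
  then show ?thesis using assms by simp
qed

definition max_end :: "pairing list \<Rightarrow> int" where
  "max_end hs = Max (insert 0 (ran_hi ` set hs))"

lemma val_max_end [simp]: "val (max_end_t hs) = max_end hs"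
proof (induction hs)
  case (Cons h hs)
  have "max_end (h # hs) = Max (insert (ran_hi h) (insert 0 (ran_hi ` set hs)))"
    by (simp only: max_end_def list.set image_insert insert_commute)
  also have "\<dots> = max (ran_hi h) (max_end hs)" unfolding max_end_def by (rule Max_insert) auto
  finally show ?case using Cons by (simp add: max.commute)
qed (simp add: max_end_def)

text \<open>
  The new upper end of the interval: the truncation removes the points of the range of \<open>m\<close> above all
  other ranges.
\<close>

definition cut :: "pairing \<Rightarrow> pairing list \<Rightarrow> int" where
  "cut m hs = max (ran_lo m) (max_end hs + 1) - 1"

lemma val_truncate_top:
  assumes "ran_hi m = N"
  shows "val (truncate_top_t N (m # hs)) = (cut m hs, truncate N (cut m hs) m hs)"
  using assms by (simp add: truncate_top_t_def val_truncate cut_def)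

lemma cut_props:
  assumes "pairing_on N m" "ran_hi m = N" "all_on (N - 1) hs"
  shows "ran_lo m \<le> cut m hs + 1" "cut m hs < N" "0 \<le> cut m hs" "all_on (cut m hs) hs"
    "ran_lo m \<le> cut m hs \<Longrightarrow> \<exists>h \<in> set hs. ran_hi h = cut m hs"
proof -
  have hi: "ran_hi h \<le> N - 1" if "h \<in> set hs" for h
  proof -
    have "pairing_on (N - 1) h" using assms(3) that by blast
    then show ?thesis by (cases h) auto
  qed
  have m: "1 \<le> ran_lo m" "ran_lo m \<le> N" using assms(1,2) by (cases m; auto)+
  have fin: "finite (insert 0 (ran_hi ` set hs))" by simp
  have "max_end hs \<le> N - 1" unfolding max_end_def using fin hi m by (subst Max_le_iff) auto
  then show "cut m hs < N" using m by (simp add: cut_def)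
  show "ran_lo m \<le> cut m hs + 1" "0 \<le> cut m hs" using m by (auto simp: cut_def)
  have le: "ran_hi h \<le> cut m hs" if "h \<in> set hs" for h
  proof -
    have "ran_hi h \<le> max_end hs" unfolding max_end_def using fin that by (intro Max_ge) auto
    then show ?thesis by (simp add: cut_def)
  qed
  show "all_on (cut m hs) hs"
  proof
    fix h assume h: "h \<in> set hs"
    then have "pairing_on (N - 1) h" using assms(3) by blast
    then show "pairing_on (cut m hs) h" using le[OF h] by (cases h) auto
  qed
  show "\<exists>h \<in> set hs. ran_hi h = cut m hs" if "ran_lo m \<le> cut m hs"
  proof -
    have "max_end hs \<in> insert 0 (ran_hi ` set hs)" unfolding max_end_def using fin by (intro Max_in) auto
    moreover have "cut m hs = max_end hs" "0 < max_end hs" using that m by (auto simp: cut_def)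
    ultimately show ?thesis by auto
  qed
qed

definition pick :: "pairing list \<Rightarrow> pairing \<times> pairing list" where
  "pick gs = val (select_maximal_t (hd gs) (tl gs))"

lemma pick_props:
  assumes "ready N gs" "gs \<noteq> []" "pick gs = (m, rest)"
  shows "mset gs = mset (m # rest)" "\<forall>h \<in> set rest. below m h" "ran_hi m = N" "proper m" "pairing_on N m"
    "all_on N rest" "\<forall>g \<in> set rest. proper g"
proof -
  show ms: "mset gs = mset (m # rest)" and bel: "\<forall>h \<in> set rest. below m h"
    using select_maximal[of "hd gs" "tl gs" m rest] assms(2,3) by (simp_all add: pick_def)
  have st: "set gs = insert m (set rest)" using mset_eq_setD[OF ms] by simp
  then show "proper m" "pairing_on N m" "all_on N rest" "\<forall>g \<in> set rest. proper g"
    using assms(1) by (auto simp: ready_def)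
  then have "ran_hi m \<le> N" by (cases m) auto
  moreover obtain g where "g \<in> set gs" "ran_hi g = N" using assms(1,2) by (auto simp: ready_def)
  ultimately show "ran_hi m = N" using bel by (auto simp: st below_def)
qed

definition advance_size :: "pairing list \<Rightarrow> int" where
  "advance_size gs = (case pick gs of (m, rest) \<Rightarrow> cut m (map (transmit m) rest))"

text \<open>Transmission by a maximal pairing, followed by its truncation.\<close>

definition advance :: "int \<Rightarrow> pairing list \<Rightarrow> pairing list" where
  "advance N gs = (case pick gs of (m, rest) \<Rightarrow>
     truncate N (advance_size gs) m (map (transmit m) rest))"

lemma val_advance:
  assumes "ready N gs" "gs \<noteq> []"
  shows "val (truncate_top_t N (val (transmit_all_t N gs))) = (advance_size gs, advance N gs)"
proof -
  obtain m rest where p: "pick gs = (m, rest)" by fastforce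
  note pp = pick_props[OF assms p]
  have "val (transmit_all_t N gs) = m # map (transmit m) rest"
    using val_transmit_all[of "hd gs" "tl gs" m rest N] p pp(6) assms(2) by (simp add: pick_def)
  then show ?thesis using pp(3) p by (simp add: val_truncate_top advance_size_def advance_def)
qed

lemma transmit_all_on:
  assumes "ready N gs" "gs \<noteq> []" "pick gs = (m, rest)"
  shows "all_on (N - 1) (map (transmit m) rest)"
  using pick_props[OF assms] transmit_props(1) by auto

lemma advance_props:
  assumes r: "ready N gs" "gs \<noteq> []"
  shows "all_on (advance_size gs) (advance N gs)" "0 \<le> advance_size gs" "advance_size gs < N"
    "card ({1..advance_size gs} // eqv (advance N gs)) = card ({1..N} // eqv gs)"
    "length (advance N gs) \<le> length gs"
proof -
  obtain m rest where p: "pick gs = (m, rest)" by fastforce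
  note pp = pick_props[OF r p]
  let ?hs = "map (transmit m) rest" and ?M = "advance_size gs"
  have M: "?M = cut m ?hs" by (simp add: advance_size_def p)
  have adv: "advance N gs = truncate N ?M m ?hs" by (simp add: advance_def p)
  note cp = cut_props[OF pp(5,3) transmit_all_on[OF r p], folded M]
  show "0 \<le> ?M" "?M < N" by (rule cp)+
  show "all_on ?M (advance N gs)" unfolding adv using pp cp by (intro truncate_on) auto
  have "eqv (m # ?hs) = eqv (m # rest)"
  proof (rule eqv_eqI)
    have T: "pairing_graph (transmit m x) \<subseteq> eqv hs \<longleftrightarrow> pairing_graph x \<subseteq> eqv hs"
      if "x \<in> set rest" "pairing_graph m \<subseteq> eqv hs" for x hs
      using transmit_graph[OF pp(4,5,3) that(2)] that(1) pp(6) by (auto simp: transmit_def)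
    show "pairing_graph g \<subseteq> eqv (m # rest)" if "g \<in> set (m # ?hs)" for g
      using that T[of _ "m # rest"] graph_eqv[of _ "m # rest"] by auto
    show "pairing_graph g \<subseteq> eqv (m # ?hs)" if "g \<in> set (m # rest)" for g
    proof (cases "g = m")
      case False
      then have g: "g \<in> set rest" using that by simp
      then have "pairing_graph (transmit m g) \<subseteq> eqv (m # ?hs)" by (intro graph_eqv) simp
      then show ?thesis using T[OF g, of "m # ?hs"] graph_eqv[of m "m # ?hs"] by simp
    qed (simp add: graph_eqv)
  qed
  moreover have "eqv (m # rest) = eqv gs"
    using mset_eq_setD[OF pp(1)] by (simp add: eqv_def edges_def)
  moreover have "card ({1..N} // eqv (m # ?hs)) = card ({1..?M} // eqv (advance N gs))"
    unfolding adv using pp cp by (intro truncate_orbits) auto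
  ultimately show "card ({1..?M} // eqv (advance N gs)) = card ({1..N} // eqv gs)" by simp
  have "length gs = Suc (length rest)" using pp(1) by (metis length_Cons size_mset)
  moreover have "length (advance N gs) \<le> Suc (length rest)" unfolding adv by (cases m) auto
  ultimately show "length (advance N gs) \<le> length gs" by simp
qed

lemma val_round:
  assumes "all_on N gs" "0 \<le> N"
  defines "hs \<equiv> prep N gs" and "M \<equiv> prep_size N gs"
  shows "val (round_t (N, gs, cnt)) =
    (if hs = [] then Inl (cnt + (N - M)) else Inr (advance_size hs, advance M hs, cnt + (N - M)))"
proof -
  have c: "val (contract_from_t 1 N (live gs) cnt) = (M, contracted N (live gs), cnt + (N - M))"
    using val_contract_from[of 1 "live gs" N cnt] live_on[OF assms(1)]
    by (simp add: statics_def[symmetric] contracted_def M_def prep_size_def)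
  have e: "contracted N (live gs) = [] \<longleftrightarrow> hs = []"
    using prep_Nil[OF assms(1,2)] by (simp add: hs_def contracted_def)
  have d: "val (delete_identities_t gs) = live gs" by (simp add: delete_identities_t_def live_def)
  have h: "val (merge_all_t (map (\<lambda>g. val (trim_t g)) (contracted N (live gs)))) = hs"
    by (simp add: hs_def prep_def trimmed_def)
  show ?thesis
  proof (cases "hs = []")
    case True
    then show ?thesis using e by (simp add: d c)
  next
    case False
    then have a: "val (truncate_top_t M (val (transmit_all_t M hs))) = (advance_size hs, advance M hs)"
      using prep_props(1)[OF assms(1,2)] by (intro val_advance) (simp_all add: hs_def M_def)
    show ?thesis using False e by (simp add: d c h a)
  qed
qed

text \<open>
  A contraction moves orbits from the interval to the counter, and all other steps keep their number.
\<close>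

lemma round_invariant:
  assumes "all_on N gs" "0 \<le> N"
  shows "val (round_t (N, gs, cnt)) = Inl r \<Longrightarrow> r = cnt + int (card ({1..N} // eqv gs))"
    and "val (round_t (N, gs, cnt)) = Inr (N', gs', cnt') \<Longrightarrow>
      all_on N' gs' \<and> 0 \<le> N' \<and> cnt' + int (card ({1..N'} // eqv gs')) = cnt + int (card ({1..N} // eqv gs))"
proof -
  let ?M = "prep_size N gs" and ?hs = "prep N gs"
  note pp = prep_props[OF assms]
  show "r = cnt + int (card ({1..N} // eqv gs))" if "val (round_t (N, gs, cnt)) = Inl r"
  proof -
    have nil: "?hs = []" and r: "r = cnt + (N - ?M)"
      using that unfolding val_round[OF assms] by (auto split: if_splits)
    have "live gs = []" using prep_Nil[OF assms] nil by simp
    then have "?M = 0" using assms(2) by (simp add: prep_size_def statics_def)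
    then show ?thesis using pp(6) r by (simp add: quotient_def)
  qed
  show "all_on N' gs' \<and> 0 \<le> N' \<and> cnt' + int (card ({1..N'} // eqv gs')) = cnt + int (card ({1..N} // eqv gs))"
    if "val (round_t (N, gs, cnt)) = Inr (N', gs', cnt')"
  proof -
    have ne: "?hs \<noteq> []" and eq: "N' = advance_size ?hs" "gs' = advance ?M ?hs" "cnt' = cnt + (N - ?M)"
      using that unfolding val_round[OF assms] by (auto split: if_splits)
    show ?thesis using advance_props[OF pp(1) ne] pp(6) by (simp add: eq)
  qed
qed

declare round_t.simps [simp del]

section \<open>Displacements caused by a transmission\<close>

text \<open>
  The factor \<open>4\<close> is chosen for \<open>transmitted_far\<close>: a pairing of short period has its domain and range
  within a quarter of its width of each other, so if one of them has moved down by half of the width, then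
  neither is close to the top.
\<close>

definition short_period :: "pairing \<Rightarrow> bool" where
  "short_period g \<longleftrightarrow> preserving g \<and> 4 * period g < width g"

text \<open>
  The last two claims: a pairing that has no short period and ends at \<open>N\<close> has its domain at least a
  quarter of its width below its range, so its new lower end is low whether the old domain or the
  displaced range becomes the range. For a reflection \<open>x\<close>, whose centre is half of \<open>dom_hi + ran_lo\<close>, a
  displacement by \<open>r\<close> of one interval moves that sum down by \<open>r\<close>, and \<open>r\<close> exceeds
  \<open>ran_lo x - ran_lo m\<close>.
\<close>

lemma transmit_position:
  assumes m: "proper m" "pairing_on N m" "ran_hi m = N"
    and x: "pairing_on N x" "proper x" "ran_lo m \<le> ran_lo x"
  defines "T \<equiv> transmit m x"
  shows "preserving m \<Longrightarrow> dom_lo m \<le> ran_lo T"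
    and "preserving m \<Longrightarrow> preserving T \<longleftrightarrow> preserving x"
    and "preserving m \<Longrightarrow> preserving T \<Longrightarrow> ran_hi T \<le> N - period m + period T"
    and "\<not> preserving m \<Longrightarrow> preserving T \<Longrightarrow> ran_hi T \<le> N - width m + period T"
    and "\<not> short_period m \<Longrightarrow> \<not> short_period x \<Longrightarrow> ran_hi x = N \<Longrightarrow> 5 * width x \<le> 4 * (N - ran_lo T + 1)"
    and "preserving m \<Longrightarrow> \<not> preserving x \<Longrightarrow>
      dom_hi T + ran_lo T \<le> dom_hi x + ran_lo x - (ran_lo x - ran_lo m + 1)"
proof -
  obtain a1 b1 c1 p1 a2 b2 c2 d2 p2
    where mx: "m = Pairing a1 b1 c1 N p1" "x = Pairing a2 b2 c2 d2 p2"
    using m(3) by (metis pairing.exhaust pairing.sel(4))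
  have on: "1 \<le> a1" "a1 \<le> b1" "N - c1 = b1 - a1" "1 \<le> a2" "a2 \<le> b2" "a2 < c2" "d2 \<le> N"
    "d2 - c2 = b2 - a2" "a1 < c1" "c1 \<le> c2" "p2 \<or> b2 < c2"
    using m x by (auto simp: mx)
  have T: "T = val (transmit_t m x)" using x(3) by (simp add: transmit_def T_def)
  have u: "c1 - a1 \<le> disp (c1 - a1) c1 z" "a1 \<le> z - disp (c1 - a1) c1 z" "z - disp (c1 - a1) c1 z < c1"
    if "c1 \<le> z" for z using disp_bounds[of "c1 - a1" c1 z] that on by auto
  have "(preserving m \<longrightarrow> dom_lo m \<le> ran_lo T) \<and>
    (preserving m \<longrightarrow> (preserving T \<longleftrightarrow> preserving x)) \<and>
    (preserving m \<longrightarrow> preserving T \<longrightarrow> ran_hi T \<le> N - period m + period T) \<and>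
    (\<not> preserving m \<longrightarrow> preserving T \<longrightarrow> ran_hi T \<le> N - width m + period T) \<and>
    (\<not> short_period m \<longrightarrow> \<not> short_period x \<longrightarrow> ran_hi x = N \<longrightarrow> 5 * width x \<le> 4 * (N - ran_lo T + 1)) \<and>
    (preserving m \<longrightarrow> \<not> preserving x \<longrightarrow>
      dom_hi T + ran_lo T \<le> dom_hi x + ran_lo x - (ran_lo x - ran_lo m + 1))"
  proof (cases rule: transmit_cases[OF m(1)[unfolded mx] m(2)[unfolded mx] x(1)[unfolded mx] \<open>c1 \<le> c2\<close>,
        case_names both one both_rev one_rev])
    case (both u v)
    show ?thesis unfolding mx T[unfolded mx] both(5)
      using on both(1-4) u[OF \<open>c1 \<le> c2\<close>] u[of a2] by (auto simp: val_orient short_period_def)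
  next
    case (one u)
    show ?thesis unfolding mx T[unfolded mx] one(4)
      using on one(1-3) u[OF \<open>c1 \<le> c2\<close>] by (auto simp: val_orient short_period_def)
  next
    case (both_rev k)
    show ?thesis unfolding mx T[unfolded mx] both_rev(5)
      using on both_rev(1-4) by (auto simp: val_orient short_period_def)
  next
    case (one_rev k)
    show ?thesis unfolding mx T[unfolded mx] one_rev(5)
      using on one_rev(1-4) by (auto simp: val_orient short_period_def)
  qed
  then show "preserving m \<Longrightarrow> dom_lo m \<le> ran_lo T"
    "preserving m \<Longrightarrow> preserving T \<longleftrightarrow> preserving x"
    "preserving m \<Longrightarrow> preserving T \<Longrightarrow> ran_hi T \<le> N - period m + period T"
    "\<not> preserving m \<Longrightarrow> preserving T \<Longrightarrow> ran_hi T \<le> N - width m + period T"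
    "\<not> short_period m \<Longrightarrow> \<not> short_period x \<Longrightarrow> ran_hi x = N \<Longrightarrow> 5 * width x \<le> 4 * (N - ran_lo T + 1)"
    "preserving m \<Longrightarrow> \<not> preserving x \<Longrightarrow>
      dom_hi T + ran_lo T \<le> dom_hi x + ran_lo x - (ran_lo x - ran_lo m + 1)"
    by blast+
qed

text \<open>
  How much a truncation by \<open>l\<close> out of \<open>w\<close> points can cost the other pairings, measured in the
  logarithmic loss of the truncated one.
\<close>

lemma log_loss:
  fixes w l u u' K :: real
  assumes l: "0 < l" "l < w" and K: "1 \<le> K" and u: "w \<le> u" "u - K * l \<le> u'" "w - l \<le> u'"
  shows "ln u - ln u' \<le> (4 * K\<^sup>2 + 1) * (ln w - ln (w - l))"
proof -
  define z where "z = l / w"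
  define R where "R = ln w - ln (w - l)"
  have pos: "0 < w" "0 < u" "0 < u'" "0 < w - l" using assms by linarith+
  have z: "0 < z" "z < 1" using l pos by (simp_all add: z_def)
  have "1 - z = (w - l) / w" using pos by (simp add: z_def field_simps)
  then have R: "R = - ln (1 - z)" using pos by (simp add: R_def ln_div)
  have zR: "z \<le> R" unfolding R using ln_le_minus_one[of "1 - z"] z by simp
  have K2: "2 * K \<le> 4 * K\<^sup>2"
  proof -
    have "2 * K * 1 \<le> 2 * K * (2 * K)" using K by (intro mult_left_mono) auto
    then show ?thesis by (simp add: power2_eq_square)
  qed
  have Kl: "K * l = K * z * w" using pos by (simp add: z_def)
  show ?thesis unfolding R_def[symmetric]
  proof (cases "K * z \<le> 1 / 2")
    case True
    have "K * z * w \<le> K * z * u" using u K z by (intro mult_left_mono) auto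
    then have "u * (1 - K * z) \<le> u'" using u Kl by (simp add: algebra_simps)
    moreover have "0 < u * (1 - K * z)" using True pos by (intro mult_pos_pos) auto
    ultimately have "ln (u * (1 - K * z)) \<le> ln u'" by simp
    then have "ln u - ln u' \<le> - ln (1 - K * z)" using True pos by (simp add: ln_mult)
    also have "- ln (1 - K * z) \<le> K * z + 2 * (K * z)\<^sup>2"
      using ln_one_minus_pos_lower_bound[of "K * z"] True K z by simp
    also have "\<dots> \<le> 2 * (K * z)"
    proof -
      have "(K * z) * (K * z) \<le> 1 / 2 * (K * z)" using True K z by (intro mult_right_mono) auto
      then show ?thesis by (simp add: power2_eq_square)
    qed
    also have "\<dots> \<le> 2 * K * R" using zR K by simp
    also have "\<dots> \<le> (4 * K\<^sup>2 + 1) * R" using K2 zR z by (intro mult_right_mono) auto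
    finally show "ln u - ln u' \<le> (4 * K\<^sup>2 + 1) * R" .
  next
    case False
    then have "1 / 2 \<le> K * R" using zR K by (smt (verit) mult_left_mono)
    then have KR: "1 \<le> 2 * K * R" by simp
    show "ln u - ln u' \<le> (4 * K\<^sup>2 + 1) * R"
    proof (cases "2 * K * w \<le> u")
      case True
      have "K * l \<le> K * w" using K l by simp
      then have "u / 2 \<le> u'" using True u by linarith
      then have "ln (u / 2) \<le> ln u'" using pos by simp
      then have "ln u - ln u' \<le> ln 2" using pos by (simp add: ln_div)
      also have "\<dots> \<le> 1" using ln_le_minus_one[of "2::real"] by simp
      also have "1 \<le> 2 * K * R" by (rule KR)
      also have "\<dots> \<le> (4 * K\<^sup>2 + 1) * R" using K2 zR z by (intro mult_right_mono) auto
      finally show ?thesis .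
    next
      case False
      then have "ln u \<le> ln (2 * K * w)" using pos by simp
      also have "\<dots> = ln (2 * K) + ln w" using K pos by (simp add: ln_mult)
      finally have "ln u - ln u' \<le> ln (2 * K) + ln w - ln u'" by simp
      also have "\<dots> \<le> ln (2 * K) + R" using u(3) pos by (simp add: R_def)
      also have "ln (2 * K) \<le> 2 * K" using ln_le_minus_one[of "2 * K"] K by simp
      also have "2 * K \<le> 2 * K * (2 * K * R)" using KR K by simp
      finally show ?thesis by (simp add: power2_eq_square algebra_simps)
    qed
  qed
qed

text \<open>
  Zero as soon as the distance of the lower end from the top is \<open>5/4\<close> of the width.
\<close>

definition excess :: "int \<Rightarrow> pairing \<Rightarrow> real" where
  "excess N g = (if short_period g then max 0 (ln (5/4) + ln (width g) - ln (N - ran_lo g + 1)) else 0)"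

definition pot :: "real \<Rightarrow> int \<Rightarrow> pairing \<Rightarrow> real" where
  "pot A N g = A * ln (width g) - ln (N - ran_lo g + 1) + excess N g"

lemma excess_nonneg: "0 \<le> excess N g"
  by (simp add: excess_def)

text \<open>
  Trimming cuts off the same number of points from the width \<open>w\<close> and from the larger distance \<open>u\<close>.
\<close>

lemma trim_log:
  fixes w w' u :: real
  assumes "0 < w'" "w' \<le> w" "w \<le> u"
  shows "ln u - ln (u - (w - w')) \<le> ln w - ln w'"
proof -
  have "u * w' \<le> w * (u - (w - w'))"
  proof -
    have "(u - w) * w' \<le> (u - w) * w" using assms by (intro mult_left_mono) auto
    then show ?thesis by (simp add: algebra_simps)
  qed
  then have "ln (u * w') \<le> ln (w * (u - (w - w')))" using assms by simp
  then show ?thesis using assms by (simp add: ln_mult)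
qed

section \<open>A round that loses no pairing\<close>

lemma periodic_sel:
  "val (periodic_t g) \<longleftrightarrow> preserving g \<and> dom_lo g < ran_lo g \<and> ran_lo g \<le> dom_hi g + 1"
  by (cases g) simp

text \<open>
  Transmission by the maximal pairing \<open>m\<close> and its truncation lead from \<open>gs\<close> on \<open>[1,N]\<close> to \<open>hs\<close> on
  \<open>[1,M]\<close>, where \<open>m1\<close> is what is left of \<open>m\<close>. The next round relabels the points by \<open>f\<close> when it contracts
  static intervals, and since it deletes and merges nothing, it turns each \<open>x\<close> of \<open>hs\<close> into \<open>F x\<close>.
  The bound \<open>k\<close> covers both the pairings and the static points, which are centres of trimmed
  reflections.
\<close>

locale steady_round =
  fixes N M N' :: int and gs hs :: "pairing list" and m m1 :: pairing and rest :: "pairing list"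
    and k :: nat and f :: "int \<Rightarrow> int" and F :: "pairing \<Rightarrow> pairing"
  assumes ready: "ready N gs" and nonempty: "gs \<noteq> []" and picked: "pick gs = (m, rest)"
    and few_statics: "card (statics N gs) \<le> k" and few_pairings: "length gs \<le> k"
    and M_def: "M = advance_size gs" and hs_def: "hs = advance N gs"
    and m1_def: "m1 = hd (truncate N M m [])"
    and N'_def: "N' = prep_size M hs" and f_def: "f = squeeze (statics M hs)"
    and F_def: "F = (\<lambda>x. val (trim_t (relabel f x)))"
    and steady: "length (prep M hs) = length gs"
begin

lemmas pick_facts = pick_props[OF ready nonempty picked]
lemmas advance_facts = advance_props[OF ready nonempty, folded M_def hs_def]

lemma M_cut: "M = cut m (map (transmit m) rest)"
  by (simp add: M_def advance_size_def picked)

lemmas cut_facts =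
  cut_props[OF pick_facts(5,3) transmit_all_on[OF ready nonempty picked], folded M_cut]

lemma hs_truncate: "hs = truncate N M m (map (transmit m) rest)"
  by (simp add: hs_def advance_def picked M_def)

lemma length_hs: "length hs = length gs"
  using prep_props(7)[OF advance_facts(1,2)] advance_facts(5) steady by simp

lemma kept: "ran_lo m \<le> M" "hs = m1 # map (transmit m) rest"
proof -
  have len: "length gs = Suc (length rest)" using pick_facts(1) by (metis length_Cons size_mset)
  have "ran_lo m \<noteq> M + 1"
  proof
    assume "ran_lo m = M + 1"
    then have "length hs = length rest" by (cases m) (simp add: hs_truncate)
    then show False using length_hs len by simp
  qed
  then show "ran_lo m \<le> M" using cut_facts(1) by simp
  show "hs = m1 # map (transmit m) rest"
    using \<open>ran_lo m \<noteq> M + 1\<close> by (cases m) (simp add: hs_truncate m1_def)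
qed

lemma sizes: "1 \<le> M" "M < N" "1 \<le> ran_lo m" "all_on M hs" "0 \<le> M"
  using advance_facts(1-3) kept(1) pick_facts(5) by (cases m, auto)+

lemma m1_facts:
  "ran_lo m1 = ran_lo m" "ran_hi m1 = M" "preserving m1 = preserving m"
  "preserving m \<Longrightarrow> dom_lo m1 = dom_lo m" "proper m1" "pairing_on M m1"
proof -
  obtain a b c p where m: "m = Pairing a b c N p" using pick_facts(3) by (cases m) auto
  have "m1 = (if p then Pairing a (b - (N - M)) c M p else Pairing (a + (N - M)) b c M p)"
    using kept(1) by (simp add: m1_def hs_truncate m)
  moreover have "proper (Pairing a b c N p)" using pick_facts(4) by (simp add: m)
  ultimately show "ran_lo m1 = ran_lo m" "ran_hi m1 = M" "preserving m1 = preserving m"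
    "preserving m \<Longrightarrow> dom_lo m1 = dom_lo m" "proper m1"
    using sizes(2) pick_facts(5) kept(1) by (auto simp: m)
  show "pairing_on M m1" using sizes(4) kept(2) by simp
qed

lemmas prep_facts = prep_steady[OF sizes(4,5) steady[folded length_hs]]

lemma prep_eq: "prep M hs = map F hs"
  by (simp add: prep_facts(3) trimmed_def contracted_def F_def f_def comp_def)

lemma N'_eq: "N' = M - int (card (statics M hs))"
  by (simp add: N'_def prep_facts(2))

lemma ready': "ready N' (map F hs)" "0 \<le> N'" "sorted_wrt (\<lambda>g h. \<not> mergeable g h) (map F hs)"
  using prep_props[OF sizes(4,5)] by (simp_all add: N'_def prep_eq)

lemma proper_hs:
  assumes "x \<in> set hs"
  shows "pairing_on M x" "val (non_identity_t x)" "1 \<le> width x"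
proof -
  show on: "pairing_on M x" and "val (non_identity_t x)" using assms sizes(4) prep_facts(1) by blast+
  then show "1 \<le> width x" by (cases x) auto
qed

lemma f_M: "f M = N'"
  using squeeze_end[OF sizes(1), of hs] by (simp add: f_def N'_eq)

lemma f_mono: "y \<le> z \<Longrightarrow> f y \<le> f z"
  by (simp add: f_def squeeze_mono)

lemma f_step: "f (y + 1) \<le> f y + 1"
  using squeeze_diff[of "statics M hs" y "y + 1"] by (simp add: f_def)

lemma f_strict: "y \<in> cover hs \<Longrightarrow> z < y \<Longrightarrow> f z < f y"
  by (simp add: f_def squeeze_strict statics_def)

lemma f_rigid: "y \<le> z \<Longrightarrow> {y<..z} \<subseteq> cover hs \<Longrightarrow> f z - f y = z - y"
  unfolding f_def by (rule squeeze_rigid) (auto simp: statics_def)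

lemma cover_hs: "x \<in> set hs \<Longrightarrow> {dom_lo x..dom_hi x} \<union> {ran_lo x..ran_hi x} \<subseteq> cover hs"
  by (auto simp: cover_def)

text \<open>
  If domain and range overlap or touch, they are translated together.
\<close>

lemma f_rigid_joined:
  assumes "x \<in> set hs" "ran_lo x \<le> dom_hi x + 1" "dom_lo x \<le> y" "y \<le> z" "z \<le> ran_hi x"
  shows "f z - f y = z - y"
proof (rule f_rigid[OF assms(4)])
  have "{y<..z} \<subseteq> {dom_lo x..dom_hi x} \<union> {ran_lo x..ran_hi x}" using assms by auto
  then show "{y<..z} \<subseteq> cover hs" using cover_hs[OF assms(1)] by blast
qed

lemma relabel_sel [simp]:
  "dom_lo (relabel f x) = f (dom_lo x)" "dom_hi (relabel f x) = f (dom_hi x)"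
  "ran_lo (relabel f x) = f (ran_lo x)" "ran_hi (relabel f x) = f (ran_hi x)"
  "preserving (relabel f x) = preserving x"
  by (cases x; simp)+

lemma relabel_width:
  assumes "x \<in> set hs"
  shows "width (relabel f x) = width x"
proof -
  have "{ran_lo x<..ran_hi x} \<subseteq> cover hs" using cover_hs[OF assms] by auto
  then show ?thesis using f_rigid[of "ran_lo x" "ran_hi x"] proper_hs(3)[OF assms] by simp
qed

lemma relabel_dom_width:
  assumes "x \<in> set hs"
  shows "f (dom_hi x) - f (dom_lo x) = dom_hi x - dom_lo x"
proof (rule f_rigid)
  show "dom_lo x \<le> dom_hi x" using proper_hs(1)[OF assms] by (cases x) auto
  show "{dom_lo x<..dom_hi x} \<subseteq> cover hs" using cover_hs[OF assms] by auto
qed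

lemma ran_hi_F [simp]: "ran_hi (F x) = f (ran_hi x)"
  by (simp add: F_def)

lemma preserving_F [simp]: "preserving (F x) = preserving x"
  by (cases x) (simp add: F_def)

lemma F_preserving: "preserving x \<Longrightarrow> F x = relabel f x"
  by (cases x) (simp add: F_def)

lemma ends_in_cover:
  assumes "x \<in> set hs"
  shows "dom_lo x \<in> cover hs" "dom_hi x \<in> cover hs" "ran_lo x \<in> cover hs" "ran_hi x \<in> cover hs"
proof -
  have "dom_lo x \<le> dom_hi x" "ran_lo x \<le> ran_hi x" using proper_hs(1)[OF assms] by (cases x; auto)+
  then show "dom_lo x \<in> cover hs" "dom_hi x \<in> cover hs" "ran_lo x \<in> cover hs" "ran_hi x \<in> cover hs"
    using cover_hs[OF assms] by auto
qed

lemma F_disjoint: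
  assumes "x \<in> set hs" "dom_hi x < ran_lo x"
  shows "F x = relabel f x"
proof -
  have "f (dom_hi x) < f (ran_lo x)" using f_strict ends_in_cover(3)[OF assms(1)] assms(2) by blast
  then show ?thesis by (cases x) (simp add: F_def)
qed

lemma F_facts:
  assumes "x \<in> set hs"
  shows "pairing_on N' (F x)" "1 \<le> width (F x)" "width (F x) \<le> width x"
    "ran_lo (F x) = f (ran_lo x) + (width x - width (F x))"
proof -
  show on: "pairing_on N' (F x)" using ready'(1) assms by (auto simp: ready_def)
  then show "1 \<le> width (F x)" by (cases "F x") auto
  have "pairing_on N' (relabel f x)"
    using relabel_on[OF sizes(4) assms] by (simp add: f_def N'_eq)
  moreover have "val (non_identity_t (relabel f x))"
    using contracted_non_identity[OF sizes(4) assms proper_hs(2)[OF assms]] by (simp add: f_def)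
  ultimately have "width (F x) \<le> width (relabel f x)"
    unfolding F_def by (cases "relabel f x") auto
  then show "width (F x) \<le> width x" using relabel_width[OF assms] by simp
  show "ran_lo (F x) = f (ran_lo x) + (width x - width (F x))"
    using relabel_width[OF assms] by simp
qed

lemma F_m1: "ran_lo (F m1) = f (ran_lo m)" "ran_hi (F m1) = N'" "width (F m1) = M - ran_lo m + 1"
proof -
  have in_hs: "m1 \<in> set hs" using kept(2) by simp
  have "F m1 = relabel f m1"
  proof (cases "preserving m1")
    case False
    then have "dom_hi m1 < ran_lo m1" using m1_facts(5) by (cases m1) auto
    then show ?thesis by (rule F_disjoint[OF in_hs])
  qed (rule F_preserving)
  then show "ran_lo (F m1) = f (ran_lo m)" "ran_hi (F m1) = N'" "width (F m1) = M - ran_lo m + 1"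
    using relabel_width[OF in_hs] m1_facts f_M by simp_all
qed

text \<open>
  A contraction can shorten the gap between domain and range, but a pairing with such a gap has no
  short period before or after.
\<close>

lemma short_period_F:
  assumes "x \<in> set hs"
  shows "short_period (F x) \<longleftrightarrow> short_period x"
proof (cases "preserving x")
  case True
  have w: "width (F x) = width x" using True relabel_width[OF assms] by (simp add: F_preserving)
  have on: "dom_lo x \<le> dom_hi x" "dom_hi x \<le> ran_hi x" "ran_lo x \<le> ran_hi x" "dom_lo x \<le> ran_lo x"
    "dom_hi x - dom_lo x = ran_hi x - ran_lo x"
    using proper_hs(1)[OF assms] by (cases x; auto)+
  have F: "F x = relabel f x" using True by (rule F_preserving)
  show ?thesis
  proof (cases "ran_lo x \<le> dom_hi x + 1")
    case True
    then have "period (F x) = period x"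
      using f_rigid_joined[OF assms True, of "dom_lo x" "ran_lo x"] on by (simp add: F)
    then show ?thesis using w by (simp add: short_period_def)
  next
    case False
    then have "f (dom_hi x) < f (ran_lo x)" using f_strict ends_in_cover(3)[OF assms] by simp
    then have "width x \<le> period (F x)" using relabel_dom_width[OF assms] on by (simp add: F)
    moreover have "width x \<le> period x" using False on by simp
    ultimately show ?thesis using w on by (auto simp: short_period_def)
  qed
qed (simp add: short_period_def)

lemma short_period_m1:
  shows "short_period m1 \<Longrightarrow> short_period m"
  using m1_facts sizes(2) pick_facts(3) by (auto simp: short_period_def)

text \<open>
  At most \<open>k\<close> points are static before the truncation, and the truncation uncovers only the part of
  the domain of \<open>m\<close> that it cuts off.
\<close>

lemma statics_bound: "int (card (statics M hs)) \<le> k + (N - M)"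
proof -
  obtain a b c p where m: "m = Pairing a b c N p" using pick_facts(3) by (cases m) auto
  define D where "D = (if p then {b - (N - M) + 1..b} else {a..a + (N - M) - 1})"
  have m1: "m1 = (if p then Pairing a (b - (N - M)) c M p else Pairing (a + (N - M)) b c M p)"
    using kept(1) by (simp add: m1_def hs_truncate m)
  have "statics M hs \<subseteq> statics N gs \<union> D"
  proof
    fix y assume y: "y \<in> statics M hs"
    then have yM: "1 \<le> y" "y \<le> M" "y \<notin> cover hs" by (auto simp: statics_def)
    show "y \<in> statics N gs \<union> D"
    proof (rule ccontr)
      assume "y \<notin> statics N gs \<union> D"
      then have "y \<in> cover gs" "y \<notin> D" using yM sizes(2) by (auto simp: statics_def)
      then obtain g where g: "g \<in> set gs" "y \<in> {dom_lo g..dom_hi g} \<union> {ran_lo g..ran_hi g}"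
        by (auto simp: cover_def)
      have "g \<in> insert m (set rest)" using g(1) mset_eq_setD[OF pick_facts(1)] by simp
      then have "y \<in> cover [m] \<union> cover hs"
      proof
        assume "g = m"
        then show ?thesis using g(2) by (auto simp: cover_def)
      next
        assume gr: "g \<in> set rest"
        then have "cover [g] \<subseteq> cover [m, transmit m g]"
          using pick_facts by (intro transmit_props(4)) auto
        moreover have "cover [m, transmit m g] \<subseteq> cover [m] \<union> cover hs"
          using gr kept(2) by (auto simp: cover_def)
        moreover have "y \<in> cover [g]" using g(2) by (simp add: cover_def)
        ultimately show ?thesis by blast
      qed
      then have "y \<in> cover [m]" using yM by simp
      then have "y \<in> cover [m1]" using yM \<open>y \<notin> D\<close> by (auto simp: m m1 D_def split: if_splits)
      then show False using yM kept(2) by (auto simp: cover_def)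
    qed
  qed
  then have "card (statics M hs) \<le> card (statics N gs \<union> D)" by (intro card_mono) (auto simp: D_def)
  also have "\<dots> \<le> card (statics N gs) + card D" by (rule card_Un_le)
  also have "card D = nat (N - M)" by (simp add: D_def)
  finally show ?thesis using few_statics sizes(2) by linarith
qed

text \<open>
  The static points are the only ones the relabelling drops.
\<close>

lemma f_lower: "z \<le> M \<Longrightarrow> M - z - (k + (N - M)) \<le> f M - f z"
  using squeeze_loss[of "statics M hs" z M] statics_bound by (simp add: f_def)

lemma transmitted:
  assumes "x \<in> set rest"
  shows "transmit m x \<in> set hs" "pairing_on N x" "proper x" "below m x" "width (transmit m x) = width x"
    "ran_lo (transmit m x) < ran_lo m" "ran_hi (transmit m x) \<le> M" "1 \<le> width x" "width x \<le> N - ran_lo x + 1"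
proof -
  show "transmit m x \<in> set hs" using assms kept(2) by simp
  show "pairing_on N x" "proper x" "below m x"
    using assms pick_facts(2,6,7) by blast+
  then show "width (transmit m x) = width x" "ran_lo (transmit m x) < ran_lo m"
    using transmit_props(2,3)[OF pick_facts(4,5,3)] by blast+
  have "pairing_on M (transmit m x)" using \<open>transmit m x \<in> set hs\<close> by (rule proper_hs)
  then show "ran_hi (transmit m x) \<le> M" by (cases "transmit m x") auto
  show "1 \<le> width x" "width x \<le> N - ran_lo x + 1" using \<open>pairing_on N x\<close> by (cases x; auto)+
qed

text \<open>
  A transmission by a pairing of short period that is not displaced far lands inside the periodic
  interval of that pairing. If its result has a short period, too, then the two are merged.
\<close>

lemma no_short_periods:
  assumes x: "x \<in> set rest" "ran_lo m \<le> ran_lo x" and m: "preserving m" "2 * period m < width x"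
  shows "\<not> short_period (transmit m x)"
proof
  define T where "T = transmit m x"
  assume "short_period (transmit m x)"
  then have T: "preserving T" "4 * period T < width T" by (simp_all add: short_period_def T_def)
  note tr = transmitted[OF x(1), folded T_def]
  have in1: "m1 \<in> set hs" using kept(2) by simp
  have "dom_lo m \<le> ran_lo T"
    using transmit_position(1)[OF pick_facts(4,5,3) tr(2,3) x(2) m(1)] by (simp add: T_def)
  then have lo: "dom_lo m1 \<le> ran_lo T" "dom_lo m1 = dom_lo m" using m1_facts(4)[OF m(1)] by simp_all
  have T_on: "dom_lo T \<le> ran_lo T" "ran_lo T \<le> ran_hi T" "ran_hi T \<le> M" "dom_hi T = dom_lo T + (ran_hi T - ran_lo T)"
    using proper_hs(1)[OF tr(1)] by (cases T; auto)+
  have "dom_lo T \<noteq> ran_lo T" using proper_hs(2)[OF tr(1)] T(1) by (cases T) auto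
  then have Tlo: "dom_lo T < ran_lo T" using T_on by simp
  have wT: "width T = width x" by (rule tr)
  have m1_on: "dom_hi m1 = dom_lo m1 + (M - ran_lo m)"
    using m1_facts(1,2,6) by (cases m1) auto
  have m1_lo: "dom_lo m1 < ran_lo m" using m1_facts(1,5) by (cases m1) auto
  have joined: "ran_lo m1 \<le> dom_hi m1 + 1"
    using m1_on m1_facts(1) lo m(2) T_on wT by (simp add: algebra_simps)
  have T_joined: "ran_lo T \<le> dom_hi T + 1" using T(2) T_on by (simp add: algebra_simps)
  have Fm: "F m1 = relabel f m1" using m(1) m1_facts(3) by (intro F_preserving) simp
  have FT: "F T = relabel f T" using T(1) by (rule F_preserving)
  have pm: "f (ran_lo m1) - f (dom_lo m1) = ran_lo m - dom_lo m"
    using f_rigid_joined[OF in1 joined, of "dom_lo m1" "ran_lo m1"] m1_facts(1,2) m1_lo lo kept(1) by simp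
  have pT: "f (ran_lo T) - f (dom_lo T) = ran_lo T - dom_lo T"
    using f_rigid_joined[OF tr(1) T_joined, of "dom_lo T" "ran_lo T"] T_on by simp
  have wf: "f (ran_hi T) - f (ran_lo T) = ran_hi T - ran_lo T" using relabel_width[OF tr(1)] by simp
  have "ran_lo m1 \<le> M" using kept(1) m1_facts(1) by simp
  then have "f (ran_hi T) \<le> f M" "f (dom_lo m1) \<le> f (ran_lo T)"
    using f_mono T_on lo by blast+
  moreover have "f (ran_lo m1) \<le> f (dom_hi m1) + 1" "f (ran_lo T) \<le> f (dom_hi T) + 1"
    using f_mono[OF joined] f_mono[OF T_joined] f_step[of "dom_hi m1"] f_step[of "dom_hi T"] by linarith+
  moreover have "f (dom_lo T) \<le> f (ran_lo T)" using T_on by (intro f_mono)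
  ultimately have "mergeable (F m1) (F T)"
    unfolding mergeable_def periodic_sel Fm FT relabel_sel
    using pm pT wf T m wT m1_facts(1-3) m1_lo lo(2) Tlo by auto
  moreover have "\<not> mergeable (F m1) (F T)"
    using ready'(3) kept(2) x(1) by (auto simp: T_def)
  ultimately show False by blast
qed

lemma transmitted_far:
  assumes x: "x \<in> set rest" "ran_lo m \<le> ran_lo x" and b: "short_period (transmit m x)"
  shows "5 * width x \<le> 4 * (N - ran_lo (transmit m x) + 1)"
proof -
  define T where "T = transmit m x"
  have T: "preserving T" "4 * period T < width T" using b by (simp_all add: short_period_def T_def)
  note tr = transmitted[OF x(1), folded T_def]
  note pos = transmit_position[OF pick_facts(4,5,3) tr(2,3) x(2), folded T_def]
  have wx: "width x \<le> width m" using tr(9) x(2) pick_facts(3) by simp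
  show ?thesis
  proof (cases "preserving m")
    case True
    have "width x \<le> 2 * period m" using no_short_periods[OF x True] b by linarith
    moreover have "ran_hi T \<le> N - period m + period T" using pos(3) True T(1) by blast
    ultimately show ?thesis using T(2) tr(5) unfolding T_def[symmetric] by (simp add: algebra_simps)
  next
    case False
    have "ran_hi T \<le> N - width m + period T" using pos(4) False T(1) by blast
    then show ?thesis using T(2) tr(5,8) wx unfolding T_def[symmetric] by (simp add: algebra_simps)
  qed
qed

end

section \<open>The decrease of the potential\<close>

definition potential :: "real \<Rightarrow> int \<Rightarrow> pairing list \<Rightarrow> real" where
  "potential A N gs = (\<Sum>g\<leftarrow>gs. pot A N g)"

text \<open>
  The factor of \<open>log_loss\<close> for \<open>K = k + 2\<close>: a truncation by \<open>l \<ge> 1\<close> points and the following contraction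
  lower the top by at most \<open>l + (k + l) \<le> (k + 2) * l\<close>.
\<close>

definition price :: "nat \<Rightarrow> real" where
  "price k = 4 * (real k + 2)\<^sup>2 + 1"

text \<open>
  The factor of \<open>ln w\<close> in the potential. The maximal pairing pays twice the price for each of at most \<open>k\<close>
  others, because the distance from the top enters both \<open>- ln u\<close> and the excess; the summand \<open>1\<close>
  compensates for its own \<open>- ln u\<close>.
\<close>

definition weight :: "nat \<Rightarrow> real" where
  "weight k = 2 * real k * price k + 1"

text \<open>
  Up to a constant, twice the distance from the lower end of \<open>m\<close> to the centre of the reflection \<open>h\<close>,
  whose points are paired with sum \<open>dom_hi h + ran_lo h\<close>. The constant makes it at least \<open>1\<close> for a
  reflection that has just been trimmed and has its range inside that of \<open>m\<close>.
\<close>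

definition offset :: "pairing \<Rightarrow> pairing \<Rightarrow> int" where
  "offset m h = dom_hi h + ran_lo h - 2 * ran_lo m + 3"

definition reversed_inside :: "pairing \<Rightarrow> pairing list \<Rightarrow> pairing set" where
  "reversed_inside m rest = {h \<in> set rest. ran_lo m \<le> ran_lo h \<and> \<not> preserving h}"

definition max_offset :: "pairing \<Rightarrow> pairing list \<Rightarrow> int" where
  "max_offset m rest = Max (insert 1 (offset m ` reversed_inside m rest))"

text \<open>
  How long it can take until the potential drops: not at all if another pairing ends at \<open>N\<close> and
  produces a gain in this round; otherwise as many rounds as the offsets can be halved; and with no
  other pairing at \<open>N\<close>, one round more than in any of these cases.
\<close>

definition phase :: "real \<Rightarrow> int \<Rightarrow> pairing list \<Rightarrow> real" where
  "phase L N gs = (case pick gs of (m, rest) \<Rightarrow>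
     if \<forall>x \<in> set rest. ran_hi x \<noteq> N then L + 1
     else if \<not> short_period m \<or> (\<exists>x \<in> set rest. ran_hi x = N \<and> short_period x) then 0
     else 1 + log 2 (max_offset m rest))"

lemma max_offset_props:
  shows "1 \<le> max_offset m rest" "h \<in> reversed_inside m rest \<Longrightarrow> offset m h \<le> max_offset m rest"
    "max_offset m rest = 1 \<or> (\<exists>h \<in> reversed_inside m rest. max_offset m rest = offset m h)"
proof -
  have fin: "finite (insert 1 (offset m ` reversed_inside m rest))" by (simp add: reversed_inside_def)
  show "1 \<le> max_offset m rest" unfolding max_offset_def using fin by (intro Max_ge) auto
  show "h \<in> reversed_inside m rest \<Longrightarrow> offset m h \<le> max_offset m rest"
    unfolding max_offset_def using fin by (intro Max_ge) auto
  have "max_offset m rest \<in> insert 1 (offset m ` reversed_inside m rest)"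
    unfolding max_offset_def using fin by (intro Max_in) auto
  then show "max_offset m rest = 1 \<or> (\<exists>h \<in> reversed_inside m rest. max_offset m rest = offset m h)" by auto
qed

lemma phase_bounds:
  assumes r: "ready N gs" "gs \<noteq> []" and L: "1 + log 2 (2 * N) \<le> L"
  shows "0 \<le> phase L N gs" "phase L N gs \<le> L + 1"
    "pick gs = (m, rest) \<Longrightarrow> \<exists>x \<in> set rest. ran_hi x = N \<Longrightarrow> phase L N gs \<le> L"
proof -
  obtain m rest where p: "pick gs = (m, rest)" by fastforce
  note pp = pick_props[OF r p]
  have m: "1 \<le> N" "2 \<le> ran_lo m" using pp(4,5) by (cases m; auto)+
  have "offset m h \<le> 2 * N" if "h \<in> reversed_inside m rest" for h
  proof -
    have "pairing_on N h" "proper h" "\<not> preserving h" using that pp(6,7) by (auto simp: reversed_inside_def)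
    then show ?thesis using m by (cases h) (auto simp: offset_def)
  qed
  then have "max_offset m rest \<le> 2 * N" using max_offset_props(3)[of m rest] m by auto
  then have "real_of_int (max_offset m rest) \<le> real_of_int (2 * N)" by (simp only: of_int_le_iff)
  moreover have one: "1 \<le> real_of_int (max_offset m rest)" using max_offset_props(1)[of m rest] by simp
  ultimately have log: "log 2 (max_offset m rest) \<le> log 2 (2 * N)" using m by (subst log_le_cancel_iff) auto
  have "0 \<le> log 2 (max_offset m rest)" "0 \<le> log 2 (2 * N)" using one m by simp_all
  then show "0 \<le> phase L N gs" "phase L N gs \<le> L + 1" using log L by (auto simp: phase_def p)
  show "phase L N gs \<le> L" if "pick gs = (m', rest')" "\<exists>x \<in> set rest'. ran_hi x = N" for m' rest'
    using that log L \<open>0 \<le> log 2 (2 * N)\<close> p by (auto simp: phase_def)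
qed

lemma ln_five_fourths:
  fixes w u :: int
  assumes "1 \<le> w" "5 * w \<le> 4 * u"
  shows "ln (5/4) + ln (real_of_int w) \<le> ln (real_of_int u)"
proof -
  have "real_of_int (5 * w) \<le> real_of_int (4 * u)" using assms(2) by (simp only: of_int_le_iff)
  then have "ln (5/4 * real_of_int w) \<le> ln (real_of_int u)" using assms(1) by simp
  moreover have "ln (5/4 * real_of_int w) = ln (5/4) + ln (real_of_int w)"
    using assms(1) by (intro ln_mult_pos) auto
  ultimately show ?thesis by simp
qed

context steady_round
begin

definition R :: real where "R = ln (width m) - ln (width (F m1))"

definition gain :: "pairing \<Rightarrow> real" where
  "gain x = (ln (N - ran_lo (transmit m x) + 1) - ln (N - ran_lo x + 1))
     + (excess N x - excess N (transmit m x))"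

lemma widths: "width m = N - ran_lo m + 1" "width (F m1) = width m - (N - M)" "1 \<le> width (F m1)"
  using pick_facts(3) F_m1(3) kept(1) by auto

lemma R_nonneg: "0 \<le> R"
  using widths sizes(2) by (simp add: R_def)

lemma f_nonexpansive: "y \<le> z \<Longrightarrow> f z - f y \<le> z - y"
  using squeeze_diff[of "statics M hs" y z] by (simp add: f_def)

lemma pot_m: "pot A N' (F m1) = pot A N m - (A - 1) * R - (excess N m - excess N' (F m1))"
proof -
  have u: "N - ran_lo m + 1 = width m" "N' - ran_lo (F m1) + 1 = width (F m1)"
    using pick_facts(3) F_m1(2) by simp_all
  then show ?thesis unfolding pot_def u R_def by (simp add: algebra_simps)
qed

lemma excess_m:
  "excess N' (F m1) \<le> excess N m" "short_period m \<Longrightarrow> \<not> short_period (F m1) \<Longrightarrow> excess N m - excess N' (F m1) = ln (5/4)"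
proof -
  have u: "N - ran_lo m + 1 = width m" "N' - ran_lo (F m1) + 1 = width (F m1)"
    using pick_facts(3) F_m1(2) by simp_all
  have "short_period (F m1) \<Longrightarrow> short_period m" using short_period_F[of m1] short_period_m1 kept(2) by simp
  then show "excess N' (F m1) \<le> excess N m" unfolding excess_def u by auto
  show "short_period m \<Longrightarrow> \<not> short_period (F m1) \<Longrightarrow> excess N m - excess N' (F m1) = ln (5/4)"
    unfolding excess_def u by simp
qed

text \<open>
  The lower end stays below that of \<open>m\<close>, which survives with \<open>w - l\<close> points up to the new top; this is the
  second lower bound that \<open>log_loss\<close> asks for.
\<close>

lemma low_end_loss:
  assumes "x \<in> set rest"
  defines "T \<equiv> transmit m x"
  shows "ln (N - ran_lo T + 1) - ln (N' - f (ran_lo T) + 1) \<le> price k * R"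
    "0 \<le> ln (N - ran_lo T + 1) - ln (N' - f (ran_lo T) + 1)"
    "width T \<le> N' - f (ran_lo T) + 1"
proof -
  note tr = transmitted[OF assms(1), folded T_def]
  define u where "u = N - ran_lo T + 1"
  define u' where "u' = N' - f (ran_lo T) + 1"
  have le: "ran_lo T \<le> M" using tr(6) kept(1) by simp
  have l: "0 < N - M" "N - M < width m" using sizes(2) widths by auto
  have "f (ran_lo T) \<le> f (ran_lo m)" using tr(6) by (intro f_mono) simp
  then have wl: "width m - (N - M) \<le> u'" using F_m1 widths unfolding u'_def by simp
  have "int k * 1 \<le> int k * (N - M)" using l(1) by (intro mult_left_mono) auto
  then have "u - (int k + 2) * (N - M) \<le> u'"
    using f_lower[OF le] f_M unfolding u_def u'_def by (simp add: algebra_simps)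
  then have "real_of_int (u - (int k + 2) * (N - M)) \<le> real_of_int u'" by (simp only: of_int_le_iff)
  then have K: "real_of_int u - (real k + 2) * real_of_int (N - M) \<le> real_of_int u'" by simp
  have wl': "real_of_int (width m) - real_of_int (N - M) \<le> real_of_int u'"
    using wl by (simp only: of_int_diff[symmetric] of_int_le_iff)
  have "ln (real_of_int u) - ln (real_of_int u')
      \<le> (4 * (real k + 2)\<^sup>2 + 1) * (ln (real_of_int (width m)) - ln (real_of_int (width m) - real_of_int (N - M)))"
    by (rule log_loss) (use l K wl' tr(6) widths(1) in \<open>simp_all add: u_def\<close>)
  moreover have "real_of_int (width m) - real_of_int (N - M) = real_of_int (width (F m1))"
    unfolding widths(2) by (simp only: of_int_diff)
  ultimately show "ln (N - ran_lo T + 1) - ln (N' - f (ran_lo T) + 1) \<le> price k * R"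
    unfolding u_def u'_def price_def R_def by (simp only:)
  have "u' \<le> u" "1 \<le> u'"
    using f_nonexpansive[OF le] f_M sizes(2) wl widths unfolding u_def u'_def by simp_all
  then show "0 \<le> ln (N - ran_lo T + 1) - ln (N' - f (ran_lo T) + 1)"
    unfolding u_def u'_def by simp
  have "f (ran_hi T) - f (ran_lo T) = ran_hi T - ran_lo T" using relabel_width[OF tr(1)] by simp
  then show "width T \<le> N' - f (ran_lo T) + 1" using f_mono[OF tr(7)] f_M by simp
qed

text \<open>
  The change consists of the effects of transmission (\<open>gain\<close>), of truncation and contraction (at most
  twice the price), and of trimming, where \<open>A * ln w\<close> loses at least as much as \<open>- ln u\<close> grows.
\<close>

lemma pot_rest:
  assumes x: "x \<in> set rest" and A: "1 \<le> A"
  shows "pot A N' (F (transmit m x)) \<le> pot A N x + 2 * price k * R - gain x"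
proof -
  define T where "T = transmit m x"
  note tr = transmitted[OF x, folded T_def]
  note Ff = F_facts[OF tr(1)]
  note low = low_end_loss[OF x, folded T_def]
  define u where "u = real_of_int (N - ran_lo T + 1)"
  define u' where "u' = real_of_int (N' - f (ran_lo T) + 1)"
  define w where "w = real_of_int (width T)"
  define w' where "w' = real_of_int (width (F T))"
  have "N' - ran_lo (F T) + 1 = (N' - f (ran_lo T) + 1) - (width T - width (F T))"
    using Ff(4) by linarith
  then have eqs: "real_of_int (N' - ran_lo (F T) + 1) = u' - (w - w')"
    unfolding u'_def w_def w'_def by (simp only: of_int_diff)
  have w: "1 \<le> w'" "w' \<le> w" "w \<le> u'"
    using Ff(2,3) low(3) unfolding w_def w'_def u'_def by linarith+
  have t: "ln u' - ln (u' - (w - w')) \<le> ln w - ln w'" using w by (intro trim_log) auto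
  have lw: "ln w' \<le> ln w" using w by simp
  have "(A - 1) * ln w' \<le> (A - 1) * ln w" using lw A by (intro mult_left_mono) auto
  then have main: "A * ln w' - ln (u' - (w - w')) \<le> A * ln w - ln u'"
    using t by (simp add: algebra_simps)
  have ex: "excess N' (F T) \<le> excess N T + (ln u - ln u')"
  proof (cases "short_period (F T)")
    case True
    then have bT: "short_period T" using short_period_F[OF tr(1)] by simp
    then have "F T = relabel f T" by (intro F_preserving) (simp add: short_period_def)
    then have "w' = w" using relabel_width[OF tr(1)] by (simp add: w_def w'_def)
    then have "excess N' (F T) = max 0 (ln (5/4) + ln w - ln u')"
      using True eqs unfolding excess_def w'_def[symmetric] by simp
    moreover have "excess N T = max 0 (ln (5/4) + ln w - ln u)"
      using bT unfolding excess_def w_def u_def by simp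
    ultimately show ?thesis using low(2) unfolding u_def[symmetric] u'_def[symmetric] by linarith
  next
    case False
    then have "excess N' (F T) = 0" by (simp add: excess_def)
    then show ?thesis using low(2) excess_nonneg[of N T] unfolding u_def u'_def by linarith
  qed
  have "pot A N' (F T) = A * ln w' - ln (u' - (w - w')) + excess N' (F T)"
    unfolding pot_def eqs w'_def ..
  also have "\<dots> \<le> A * ln w - ln u + excess N T + 2 * (ln u - ln u')"
    using main ex by (simp add: algebra_simps)
  also have "\<dots> \<le> A * ln w - ln u + excess N T + 2 * (price k * R)"
    using low(1) unfolding u_def u'_def by simp
  also have "\<dots> = pot A N x + 2 * price k * R - gain x"
    unfolding pot_def gain_def T_def[symmetric] u_def w_def tr(5) by simp
  finally show ?thesis by (simp add: T_def)
qed

lemma excess_transmitted: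
  assumes "x \<in> set rest" "ran_lo m \<le> ran_lo x"
  shows "excess N (transmit m x) = 0"
proof (cases "short_period (transmit m x)")
  case True
  define T where "T = transmit m x"
  note tr = transmitted[OF assms(1), folded T_def]
  have "5 * width T \<le> 4 * (N - ran_lo T + 1)"
    using transmitted_far[OF assms True] tr(5) by (simp add: T_def)
  moreover have "1 \<le> width T" using tr(5,8) by simp
  ultimately have "ln (5/4) + ln (real_of_int (width T)) \<le> ln (real_of_int (N - ran_lo T + 1))"
    by (intro ln_five_fourths)
  then show ?thesis by (simp add: excess_def T_def)
qed (simp add: excess_def)

lemma gain_nonneg:
  assumes "x \<in> set rest"
  shows "0 \<le> gain x"
proof (cases "ran_lo m \<le> ran_lo x")
  case True
  note tr = transmitted[OF assms]
  have "ln (real_of_int (N - ran_lo x + 1)) \<le> ln (real_of_int (N - ran_lo (transmit m x) + 1))"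
    using tr True by simp
  then show ?thesis
    using excess_transmitted[OF assms True] excess_nonneg[of N x] by (simp add: gain_def)
qed (simp add: gain_def transmit_def)

text \<open>
  If \<open>x\<close> has a short period, its excess \<open>ln (5/4)\<close> vanishes; otherwise its distance from the top grows
  by the factor \<open>5/4\<close>.
\<close>

lemma gain_top:
  assumes x: "x \<in> set rest" "ran_hi x = N" and good: "short_period x \<or> \<not> short_period m"
  shows "ln (5/4) \<le> gain x"
proof -
  note tr = transmitted[OF x(1)]
  have in_range: "ran_lo m \<le> ran_lo x" using tr(4) x(2) pick_facts(3) by (simp add: below_def)
  have u: "N - ran_lo x + 1 = width x" using x(2) by simp
  show ?thesis
  proof (cases "short_period x")
    case True
    then have "excess N x = ln (5/4)" unfolding excess_def u by simp
    moreover have "ln (real_of_int (N - ran_lo x + 1)) \<le> ln (real_of_int (N - ran_lo (transmit m x) + 1))"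
      using tr in_range by simp
    ultimately show ?thesis using excess_transmitted[OF x(1) in_range] by (simp add: gain_def)
  next
    case False
    have "5 * width x \<le> 4 * (N - ran_lo (transmit m x) + 1)"
      using transmit_position(5)[OF pick_facts(4,5,3) tr(2,3) in_range] False good x(2) by blast
    with tr(8) have "ln (5/4) + ln (real_of_int (width x)) \<le> ln (real_of_int (N - ran_lo (transmit m x) + 1))"
      by (rule ln_five_fourths)
    then show ?thesis
      using excess_transmitted[OF x(1) in_range] excess_nonneg[of N x] unfolding gain_def u by simp
  qed
qed

lemma potential_step:
  shows "potential (weight k) N' (map F hs) \<le>
    potential (weight k) N gs - (excess N m - excess N' (F m1)) - (\<Sum>x\<leftarrow>rest. gain x)"
proof -
  define A where "A = weight k"
  have p: "0 \<le> price k" by (simp add: price_def)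
  have A: "A - 1 = 2 * k * price k" "1 \<le> A" using p by (simp_all add: A_def weight_def)
  have "length rest \<le> k"
    using few_pairings pick_facts(1) by (metis Suc_leD length_Cons size_mset)
  then have "real (length rest) * (2 * price k * R) \<le> real k * (2 * price k * R)"
    using p R_nonneg by (intro mult_right_mono) auto
  then have AR: "real (length rest) * (2 * price k * R) \<le> (A - 1) * R" by (simp add: A mult.assoc mult.left_commute)
  have "potential A N gs = sum_mset (image_mset (pot A N) (mset gs))"
    by (simp add: potential_def sum_mset_sum_list[symmetric])
  also have "\<dots> = pot A N m + (\<Sum>x\<leftarrow>rest. pot A N x)"
    by (simp add: pick_facts(1) sum_mset_sum_list[symmetric])
  finally have V: "potential A N gs = pot A N m + (\<Sum>x\<leftarrow>rest. pot A N x)" .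
  have "potential A N' (map F hs) = pot A N' (F m1) + (\<Sum>x\<leftarrow>rest. pot A N' (F (transmit m x)))"
    unfolding potential_def by (subst kept(2)) (simp add: comp_def)
  also have "\<dots> \<le> (pot A N m - (A - 1) * R - (excess N m - excess N' (F m1))) +
      (\<Sum>x\<leftarrow>rest. pot A N x + 2 * price k * R - gain x)"
    using pot_m[of A] pot_rest A(2) by (intro add_mono sum_list_mono) auto
  also have "(\<Sum>x\<leftarrow>rest. pot A N x + 2 * price k * R - gain x) =
      (\<Sum>x\<leftarrow>rest. pot A N x) + real (length rest) * (2 * price k * R) - (\<Sum>x\<leftarrow>rest. gain x)"
    by (induction rest) (simp_all add: algebra_simps)
  finally show ?thesis using AR V unfolding A_def by linarith
qed

text \<open>
  A transmitted reflection whose range stays above the lower end of \<open>m\<close> must have been trimmed. Being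
  overlapping, it is relabelled by a single translation, together with the lower end of \<open>m\<close>, so that the
  contraction does not affect the offset. The displacement is at least half of the offset, since a
  trimmed reflection has its centre below its range.
\<close>

lemma offset_halved:
  assumes x: "x \<in> set rest" "\<not> preserving x" and m: "preserving m"
    and inside: "f (ran_lo m) \<le> ran_lo (F (transmit m x))"
  shows "ran_lo m \<le> ran_lo x" "1 \<le> offset (F m1) (F (transmit m x))"
    "2 * offset (F m1) (F (transmit m x)) \<le> offset m x"
proof -
  define T where "T = transmit m x"
  note tr = transmitted[OF x(1), folded T_def]
  note Ff = F_facts[OF tr(1)]
  have "ran_lo m1 \<in> cover hs" using kept(2) by (intro ends_in_cover) simp
  then have strict: "z < ran_lo m \<Longrightarrow> f z < f (ran_lo m)" for z using f_strict m1_facts(1) by simp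
  have overlap: "ran_lo T \<le> dom_hi T"
  proof (rule ccontr)
    assume "\<not> ?thesis"
    then have "F T = relabel f T" by (intro F_disjoint[OF tr(1)]) simp
    then show False using inside strict[OF tr(6)] by (simp add: T_def)
  qed
  show in_range: "ran_lo m \<le> ran_lo x"
  proof (rule ccontr)
    assume "\<not> ?thesis"
    then have "T = x" by (simp add: T_def transmit_def)
    then show False using overlap tr(3) x(2) by (cases x) auto
  qed
  note pos = transmit_position[OF pick_facts(4,5,3) tr(2,3) in_range, folded T_def]
  obtain a b c d where T: "T = Pairing a b c d False" using pos(2) m x(2) by (cases T) auto
  have on: "a \<le> c" "d - c = b - a" "d \<le> M" "c \<le> b" using proper_hs(1)[OF tr(1)] overlap by (auto simp: T)
  have "f c \<le> f b" using on by (intro f_mono)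
  then have FT: "F T = Pairing (f a) ((f a + f d - 1) div 2) ((f a + f d) div 2 + 1) (f d) False"
    by (simp add: F_def T)
  define c0 where "c0 = ran_lo m"
  have in': "f c0 \<le> (f a + f d) div 2 + 1" using inside FT by (simp add: T_def[symmetric] c0_def)
  have "(f a + f d) div 2 + 1 \<le> f d" using Ff(2) by (simp add: FT)
  then have "f c0 \<le> f d" using in' by simp
  then have "c0 \<le> d" using strict[of d] by (force simp: c0_def)
  moreover have "a \<le> c0" using tr(6) on by (simp add: T c0_def)
  ultimately have rigid: "f c0 - f a = c0 - a" "f d - f a = d - a"
    using f_rigid_joined[OF tr(1), of a c0] f_rigid_joined[OF tr(1), of a d] on by (simp_all add: T)
  have off: "offset (F m1) (F T) = a + d - 2 * c0 + 3"
  proof -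
    have "(s - 1) div 2 + (s div 2 + 1) = s" for s :: int by presburger
    then show ?thesis using rigid F_m1(1) by (simp add: offset_def FT c0_def)
  qed
  show "1 \<le> offset (F m1) (F (transmit m x))"
    using in' rigid unfolding T_def[symmetric] off by presburger
  have "dom_hi T + ran_lo T \<le> dom_hi x + ran_lo x - (ran_lo x - ran_lo m + 1)"
    using pos(6) m x(2) by blast
  moreover have "dom_hi x < ran_lo x" using tr(3) x(2) by (cases x) auto
  ultimately show "2 * offset (F m1) (F (transmit m x)) \<le> offset m x"
    unfolding T_def[symmetric] off using on by (simp add: T offset_def c0_def)
qed

text \<open>
  If \<open>m\<close> is maximal again, then the range of the pairing that ends at the new top lies in the range of
  \<open>m\<close>, so it comes from a reflection to which \<open>offset_halved\<close> applies. If it is not, then what is left of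
  \<open>m\<close> is another pairing at the top with a short period, which makes the next round gain; unless the
  truncation took the short period away from it, and with it the excess.
\<close>

lemma phase_step:
  assumes L: "1 + log 2 (2 * N') \<le> L" "0 \<le> L"
  shows "potential (weight k) N' (map F hs) \<le> potential (weight k) N gs - ln (5/4) \<or>
    potential (weight k) N' (map F hs) \<le> potential (weight k) N gs \<and> phase L N' (map F hs) \<le> phase L N gs - 1"
proof -
  let ?V = "potential (weight k) N gs" and ?V' = "potential (weight k) N' (map F hs)"
  have ne: "map F hs \<noteq> []" using kept(2) by simp
  obtain m' rest' where p': "pick (map F hs) = (m', rest')" by fastforce
  note pp' = pick_props[OF ready'(1) ne p']
  have gains: "\<And>g. g \<in> set (map gain rest) \<Longrightarrow> 0 \<le> g" using gain_nonneg by auto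
  then have "0 \<le> (\<Sum>x\<leftarrow>rest. gain x)" by (rule sum_list_nonneg)
  then have mono: "?V' \<le> ?V" "?V' \<le> ?V - (excess N m - excess N' (F m1))"
    using potential_step excess_m(1) by linarith+
  obtain x0 where x0: "x0 \<in> set rest" "ran_hi (transmit m x0) = M"
    using cut_facts(5)[OF kept(1)] by auto
  have ms: "mset (m' # rest') = mset (F m1 # map (\<lambda>x. F (transmit m x)) rest)"
    unfolding pp'(1)[symmetric] by (subst kept(2)) (simp add: comp_def)
  have rest': "set rest' = (\<lambda>x. F (transmit m x)) ` set rest" "m' = F m1" if "F m1 \<notin> set rest'"
  proof -
    have "F m1 \<in> set (m' # rest')" using ms by (metis list.set_intros(1) mset_eq_setD)
    then show m': "m' = F m1" using that by simp
    then have "mset rest' = mset (map (\<lambda>x. F (transmit m x)) rest)" using ms by simp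
    then show "set rest' = (\<lambda>x. F (transmit m x)) ` set rest" by (metis mset_eq_setD set_map)
  qed
  have top': "\<exists>y \<in> set rest'. ran_hi y = N'"
  proof (cases "F m1 \<in> set rest'")
    case True
    then show ?thesis using F_m1(2) by blast
  next
    case False
    then have "F (transmit m x0) \<in> set rest'" using rest' x0(1) by simp
    then show ?thesis using x0(2) f_M by (intro bexI[of _ "F (transmit m x0)"]) simp
  qed
  consider (none) "\<forall>x \<in> set rest. ran_hi x \<noteq> N"
    | (drop) x where "x \<in> set rest" "ran_hi x = N" "short_period x \<or> \<not> short_period m"
    | (weak) "short_period m" "\<not> short_period (F m1)"
    | (stall) "\<exists>x \<in> set rest. ran_hi x = N" "short_period m" "short_period (F m1)" "\<forall>x \<in> set rest. ran_hi x = N \<longrightarrow> \<not> short_period x" by blast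
  then show ?thesis
  proof cases
    case none
    then have "phase L N gs = L + 1" by (simp add: phase_def picked)
    then show ?thesis using mono phase_bounds(3)[OF ready'(1) ne L(1) p' top'] by simp
  next
    case drop
    have "ln (5/4) \<le> gain x" by (rule gain_top[OF drop])
    also have "\<dots> \<le> (\<Sum>x\<leftarrow>rest. gain x)"
      using drop(1) gains by (intro member_le_sum_list) auto
    finally show ?thesis using potential_step excess_m(1) by linarith
  next
    case weak
    then show ?thesis using mono(2) excess_m(2) by simp
  next
    case stall
    then have ph: "phase L N gs = 1 + log 2 (max_offset m rest)" by (auto simp: phase_def picked)
    have "0 \<le> log 2 (max_offset m rest)" using max_offset_props(1)[of m rest] by simp
    have pm: "preserving m" using stall(2) by (simp add: short_period_def)
    have "phase L N' (map F hs) \<le> phase L N gs - 1"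
    proof (cases "\<not> short_period m' \<or> (\<exists>x \<in> set rest'. ran_hi x = N' \<and> short_period x)")
      case True
      then have "phase L N' (map F hs) = 0" using top' by (auto simp: phase_def p')
      then show ?thesis using ph \<open>0 \<le> log 2 (max_offset m rest)\<close> by simp
    next
      case False
      have ph': "phase L N' (map F hs) = 1 + log 2 (max_offset m' rest')"
        using False top' by (auto simp: phase_def p')
      have "F m1 \<notin> set rest'"
      proof
        assume "F m1 \<in> set rest'"
        then show False using False F_m1(2) stall(3) by blast
      qed
      note r' = rest'[OF this]
      have half: "1 \<le> offset m' y \<and> 2 * offset m' y \<le> max_offset m rest"
        if y: "y \<in> reversed_inside m' rest'" for y
      proof -
        obtain x where x: "x \<in> set rest" "y = F (transmit m x)" using y r' by (auto simp: reversed_inside_def)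
        have ins: "f (ran_lo m) \<le> ran_lo (F (transmit m x))"
          using y x(2) r'(2) F_m1(1) by (simp add: reversed_inside_def)
        have "\<not> preserving (transmit m x)" using y x(2) by (simp add: reversed_inside_def)
        then have "\<not> preserving x"
          using transmit_position(2)[OF pick_facts(4,5,3) transmitted(2,3)[OF x(1)] _ pm]
          by (cases "ran_lo m \<le> ran_lo x") (auto simp: transmit_def)
        then have "x \<in> reversed_inside m rest" "1 \<le> offset m' y" "2 * offset m' y \<le> offset m x"
          using offset_halved[OF x(1) _ pm ins] x r'(2) by (auto simp: reversed_inside_def)
        then show ?thesis using max_offset_props(2)[of x m rest] by simp
      qed
      have "F (transmit m x0) \<in> reversed_inside m' rest'"
      proof -
        have in': "F (transmit m x0) \<in> set rest'" using r' x0(1) by simp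
        moreover have lo: "ran_lo m' \<le> ran_lo (F (transmit m x0))"
          using bspec[OF pp'(2) in'] pp'(3) x0(2) f_M by (simp add: below_def)
        moreover have "\<not> preserving (transmit m x0)"
        proof
          assume "preserving (transmit m x0)"
          then have "F (transmit m x0) = relabel f (transmit m x0)" by (rule F_preserving)
          moreover have "f (ran_lo (transmit m x0)) < f (ran_lo m)"
            using f_strict[OF _ transmitted(6)[OF x0(1)]] ends_in_cover(3)[of m1] kept(2) m1_facts(1) by simp
          ultimately show False using lo r'(2) F_m1(1) by simp
        qed
        ultimately show ?thesis by (simp add: reversed_inside_def)
      qed
      then have "2 * max_offset m' rest' \<le> max_offset m rest"
        using max_offset_props(3)[of m' rest'] half by (smt (verit))
      then have "real_of_int (2 * max_offset m' rest') \<le> real_of_int (max_offset m rest)"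
        by (simp only: of_int_le_iff)
      then have "log 2 (2 * real_of_int (max_offset m' rest')) \<le> log 2 (max_offset m rest)"
        using max_offset_props(1)[of m' rest'] by (subst log_le_cancel_iff) auto
      then have "1 + log 2 (max_offset m' rest') \<le> log 2 (max_offset m rest)"
        using max_offset_props(1)[of m' rest'] by (subst (asm) log_mult) auto
      then show ?thesis using ph ph' by simp
    qed
    then show ?thesis using mono(1) by blast
  qed
qed

end

section \<open>The number of rounds\<close>

lemma all_on_pos:
  assumes "all_on N gs" "gs \<noteq> []"
  shows "1 \<le> N"
proof -
  obtain g where "g \<in> set gs" using assms(2) by (cases gs) auto
  then have "pairing_on N g" using assms(1) by blast
  then show ?thesis by (cases g) auto
qed

lemma pot_bounds:
  fixes N0 :: int
  assumes g: "pairing_on N g" and N: "N \<le> N0" and A: "0 \<le> A"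
  shows "- ln N0 \<le> pot A N g" "pot A N g \<le> A * ln N0 + ln (5/4)"
proof -
  define w where "w = real_of_int (width g)"
  define u where "u = real_of_int (N - ran_lo g + 1)"
  have "1 \<le> width g" "width g \<le> N - ran_lo g + 1" "N - ran_lo g + 1 \<le> N0"
    using g N by (cases g; auto)+
  then have b: "1 \<le> w" "w \<le> u" "u \<le> N0" unfolding w_def u_def by linarith+
  then have ln: "0 \<le> ln w" "ln w \<le> ln u" "ln u \<le> ln N0" by simp_all
  then have Aw: "0 \<le> A * ln w" "A * ln w \<le> A * ln N0" using A by (auto intro: mult_left_mono)
  have "excess N g \<le> ln (5/4)" using ln by (simp add: excess_def w_def u_def)
  then show "- ln N0 \<le> pot A N g" "pot A N g \<le> A * ln N0 + ln (5/4)"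
    using excess_nonneg[of N g] Aw ln unfolding pot_def w_def[symmetric] u_def[symmetric] by linarith+
qed

lemma potential_bounds:
  fixes N0 :: int
  assumes "all_on N gs" "N \<le> N0" "0 \<le> A" "length gs \<le> k" "1 \<le> N0"
  shows "- (k * ln N0) \<le> potential A N gs" "potential A N gs \<le> k * (A * ln N0 + ln (5/4))"
proof -
  have "- (length gs * ln N0) \<le> potential A N gs \<and> potential A N gs \<le> length gs * (A * ln N0 + ln (5/4))"
    using assms(1)
  proof (induction gs)
    case (Cons g gs)
    then have "pairing_on N g" by simp
    from pot_bounds[OF this assms(2,3)] Cons show ?case by (simp add: potential_def algebra_simps)
  qed (simp add: potential_def)
  moreover have "length gs * ln N0 \<le> k * ln N0" using assms by (intro mult_right_mono) auto
  moreover have "length gs * (A * ln N0 + ln (5/4)) \<le> k * (A * ln N0 + ln (5/4))"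
    using assms by (intro mult_right_mono) auto
  ultimately show "- (k * ln N0) \<le> potential A N gs" "potential A N gs \<le> k * (A * ln N0 + ln (5/4))"
    by linarith+
qed

text \<open>
  Bounds the phase whenever another pairing ends at the top.
\<close>

definition cap :: "int \<Rightarrow> real" where
  "cap N0 = 1 + log 2 (2 * N0)"

text \<open>
  An upper bound of \<open>level\<close>, so that losing a pairing makes up for any increase of it.
\<close>

definition spread :: "int \<Rightarrow> nat \<Rightarrow> real" where
  "spread N0 k = (k * ln N0 + k * (weight k * ln N0 + ln (5/4))) / ln (5/4) * (cap N0 + 2) + cap N0 + 1"

text \<open>
  The part of the termination measure that decreases while no pairing is lost. The factor
  \<open>cap N0 + 2\<close> lets a drop of the potential outweigh a reset of the phase; the summand \<open>k * ln N0\<close> makes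
  it nonnegative.
\<close>

definition level :: "int \<Rightarrow> nat \<Rightarrow> int \<Rightarrow> pairing list \<Rightarrow> real" where
  "level N0 k N gs = (if gs = [] then 0 else
     (potential (weight k) N gs + k * ln N0) / ln (5/4) * (cap N0 + 2) + phase (cap N0) N gs)"

definition rank :: "int \<Rightarrow> nat \<Rightarrow> int \<Rightarrow> pairing list \<Rightarrow> real" where
  "rank N0 k N gs = length (prep N gs) * (spread N0 k + 1) + level N0 k (prep_size N gs) (prep N gs)"

lemma cap_mono:
  fixes N N0 :: int
  shows "1 \<le> N \<Longrightarrow> N \<le> N0 \<Longrightarrow> 1 + log 2 (2 * N) \<le> cap N0"
  by (simp add: cap_def)

lemma level_bounds:
  assumes "ready N gs" "N \<le> N0" "length gs \<le> k" "1 \<le> N0"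
  shows "0 \<le> level N0 k N gs" "level N0 k N gs \<le> spread N0 k"
proof -
  have A: "0 \<le> weight k" by (simp add: weight_def price_def)
  have e: "0 < ln (5/4 :: real)" by simp
  have c: "0 \<le> cap N0" using assms(4) by (simp add: cap_def)
  define T where "T = k * ln N0 + k * (weight k * ln N0 + ln (5/4))"
  have "0 \<le> T" using A assms(4) by (simp add: T_def)
  then have "0 \<le> T / ln (5/4) * (cap N0 + 2)" using e c by simp
  then have sp: "0 \<le> spread N0 k" using c by (simp add: spread_def T_def)
  have "0 \<le> level N0 k N gs \<and> level N0 k N gs \<le> spread N0 k"
  proof (cases "gs = []")
    case False
    have "all_on N gs" using assms(1) by (simp add: ready_def)
    note tb = potential_bounds[OF this assms(2) A assms(3,4)]
    have "1 \<le> N" using \<open>all_on N gs\<close> False by (rule all_on_pos)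
    note pb = phase_bounds[OF assms(1) False cap_mono[OF this assms(2)]]
    define V where "V = potential (weight k) N gs + k * ln N0"
    have V: "0 \<le> V" "V \<le> T" using tb by (simp_all add: V_def T_def)
    then have "0 \<le> V / ln (5/4) * (cap N0 + 2)" using e c by simp
    moreover have "V / ln (5/4) * (cap N0 + 2) \<le> T / ln (5/4) * (cap N0 + 2)"
      using V e c by (intro mult_right_mono divide_right_mono) auto
    ultimately show ?thesis using pb False by (simp add: level_def spread_def V_def T_def)
  qed (use sp in \<open>simp add: level_def\<close>)
  then show "0 \<le> level N0 k N gs" "level N0 k N gs \<le> spread N0 k" by blast+
qed

lemma rank_nonneg:
  assumes "all_on N gs" "0 \<le> N" "N \<le> N0" "length gs \<le> k" "1 \<le> N0"
  shows "0 \<le> rank N0 k N gs" "rank N0 k N gs \<le> (real k + 1) * (spread N0 k + 1)"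
proof -
  note pp = prep_props[OF assms(1,2)]
  have lb: "0 \<le> level N0 k (prep_size N gs) (prep N gs)" "level N0 k (prep_size N gs) (prep N gs) \<le> spread N0 k"
    using pp assms by (auto intro!: level_bounds)
  moreover have "length (prep N gs) * (spread N0 k + 1) \<le> k * (spread N0 k + 1)"
    using pp(7) assms(4) lb by (intro mult_right_mono) auto
  ultimately show "0 \<le> rank N0 k N gs" "rank N0 k N gs \<le> (real k + 1) * (spread N0 k + 1)"
    by (auto simp: rank_def algebra_simps)
qed

lemma rank_decreases:
  assumes wf: "all_on N gs" and N: "0 \<le> N" "N \<le> N0" "1 \<le> N0" and k: "length gs \<le> k" and ne: "prep N gs \<noteq> []"
  defines "M \<equiv> prep_size N gs" and "hs \<equiv> prep N gs"
  shows "rank N0 k (advance_size hs) (advance M hs) \<le> rank N0 k N gs - 1"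
proof -
  note pp = prep_props[OF wf N(1), folded M_def hs_def]
  have ne': "hs \<noteq> []" using ne by (simp add: hs_def)
  have rank_eq: "rank N0 k N gs = length hs * (spread N0 k + 1) + level N0 k M hs"
    by (simp add: rank_def M_def hs_def)
  let ?N' = "advance_size hs" and ?gs' = "advance M hs"
  note ad = advance_props[OF pp(1) ne']
  note pp' = prep_props[OF ad(1,2)]
  let ?M' = "prep_size ?N' ?gs'" and ?hs' = "prep ?N' ?gs'"
  have size: "?M' \<le> N0" "length ?hs' \<le> length hs" "length hs \<le> k" "M \<le> N0"
    using pp' ad pp N k by auto
  note lb = level_bounds[OF pp(1) size(4,3) N(3)]
  note lb' = level_bounds[OF pp'(1) size(1) order_trans[OF size(2,3)] N(3)]
  have rank_eq': "rank N0 k ?N' ?gs' = length ?hs' * (spread N0 k + 1) + level N0 k ?M' ?hs'"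
    by (rule rank_def)
  show ?thesis
  proof (cases "length ?hs' < length hs")
    case True
    then have "(real (length ?hs') + 1) * (spread N0 k + 1) \<le> length hs * (spread N0 k + 1)"
      using lb by (intro mult_right_mono) auto
    then have "length ?hs' * (spread N0 k + 1) + (spread N0 k + 1) \<le> length hs * (spread N0 k + 1)"
      by (simp add: distrib_right)
    then show ?thesis using lb(1) lb'(2) unfolding rank_eq rank_eq' by linarith
  next
    case False
    then have len: "length ?hs' = length hs" using size(2) by simp
    obtain m rest where p: "pick hs = (m, rest)" by fastforce
    interpret steady_round M ?N' ?M' hs ?gs' m "hd (truncate M ?N' m [])" rest k
      "squeeze (statics ?N' ?gs')" "\<lambda>x. val (trim_t (relabel (squeeze (statics ?N' ?gs')) x))"
      by unfold_locales (use pp ne' p size k len in auto)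
    have hs': "?hs' = map (\<lambda>x. val (trim_t (relabel (squeeze (statics ?N' ?gs')) x))) ?gs'" by (rule prep_eq)
    have "?hs' \<noteq> []" using len ne' by auto
    have e: "0 < ln (5/4 :: real)" by simp
    have "all_on ?M' ?hs'" using pp'(1) by (simp add: ready_def)
    then have "1 \<le> ?M'" using \<open>?hs' \<noteq> []\<close> by (rule all_on_pos)
    note cm = cap_mono[OF this size(1)]
    have c: "0 \<le> cap N0" using N(3) by (simp add: cap_def)
    define V where "V = potential (weight k) M hs"
    define V' where "V' = potential (weight k) ?M' ?hs'"
    have Mpos: "1 \<le> M" using sizes(2) ad(2) by linarith
    note pb = phase_bounds[OF pp(1) ne' cap_mono[OF Mpos size(4)]]
    note pb' = phase_bounds[OF pp'(1) \<open>?hs' \<noteq> []\<close> cm]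
    have "level N0 k ?M' ?hs' \<le> level N0 k M hs - 1"
    proof -
      have lv: "level N0 k M hs = (V + k * ln N0) / ln (5/4) * (cap N0 + 2) + phase (cap N0) M hs"
        using ne' by (simp add: level_def V_def)
      have lv': "level N0 k ?M' ?hs' = (V' + k * ln N0) / ln (5/4) * (cap N0 + 2) + phase (cap N0) ?M' ?hs'"
        using \<open>?hs' \<noteq> []\<close> by (simp add: level_def V'_def)
      consider "V' \<le> V - ln (5/4)" | "V' \<le> V" "phase (cap N0) ?M' ?hs' \<le> phase (cap N0) M hs - 1"
        using phase_step[OF cm c] unfolding hs'[symmetric] V_def V'_def by blast
      then show ?thesis
      proof cases
        case 1
        have "(V' + k * ln N0) / ln (5/4) \<le> (V - ln (5/4) + k * ln N0) / ln (5/4)"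
          using 1 e by (intro divide_right_mono) auto
        also have "\<dots> = (V + k * ln N0) / ln (5/4) - 1" using e by (simp add: field_simps)
        finally have "(V' + k * ln N0) / ln (5/4) * (cap N0 + 2) \<le> ((V + k * ln N0) / ln (5/4) - 1) * (cap N0 + 2)"
          using c by (intro mult_right_mono) auto
        then show ?thesis using pb(1) pb'(2) unfolding lv lv' by (simp add: algebra_simps)
      next
        case 2
        have "(V' + k * ln N0) / ln (5/4) * (cap N0 + 2) \<le> (V + k * ln N0) / ln (5/4) * (cap N0 + 2)"
          using 2(1) e c by (intro mult_right_mono divide_right_mono) auto
        then show ?thesis using 2(2) unfolding lv lv' by linarith
      qed
    qed
    then show ?thesis unfolding rank_eq rank_eq' len by linarith
  qed
qed

lemma loop_total:
  fixes n :: nat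
  assumes cost: "\<And>N gs cnt. all_on N gs \<Longrightarrow> 0 \<le> N \<Longrightarrow> 0 \<le> cnt \<Longrightarrow> cnt + N \<le> N0 \<Longrightarrow> length gs \<le> k \<Longrightarrow>
      cost (round_t (N, gs, cnt)) \<le> C"
    and N0: "1 \<le> N0"
    and "rank N0 k N gs < n"
    and "all_on N gs" "0 \<le> N" "0 \<le> cnt" "cnt + N \<le> N0" "length gs \<le> k"
  shows "\<exists>time \<le> n * C. orbit_counting_loop (N, gs, cnt) = Some (cnt + int (card ({1..N} // eqv gs)), time)"
  using assms(3-)
proof (induction n arbitrary: N gs cnt)
  case 0
  then show ?case using rank_nonneg(1)[of gs N N0 k] N0 by simp
next
  case (Suc n)
  note inv = round_invariant[OF Suc.prems(2,3)]
  have c: "cost (round_t (N, gs, cnt)) \<le> C" using Suc.prems by (intro cost)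
  have NN: "N \<le> N0" using Suc.prems by simp
  show ?case
  proof (cases "val (round_t (N, gs, cnt))")
    case (Inl r)
    then have "orbit_counting_loop (N, gs, cnt) = Some (r, cost (round_t (N, gs, cnt)))"
      by (subst orbit_counting_loop.simps) simp
    then show ?thesis using inv(1)[OF Inl] c by (intro exI[of _ "cost (round_t (N, gs, cnt))"]) simp
  next
    case (Inr st)
    obtain N' gs' cnt' where st: "st = (N', gs', cnt')" by (metis prod_cases3)
    note round = Inr[unfolded st]
    let ?M = "prep_size N gs" and ?hs = "prep N gs"
    have ne: "?hs \<noteq> []" and eq: "N' = advance_size ?hs" "gs' = advance ?M ?hs" "cnt' = cnt + (N - ?M)"
      using round unfolding val_round[OF Suc.prems(2,3)] by (auto split: if_splits)
    note pp = prep_props[OF Suc.prems(2,3)]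
    note ad = advance_props[OF pp(1) ne, folded eq]
    have "rank N0 k N' gs' \<le> rank N0 k N gs - 1"
      unfolding eq using Suc.prems ne N0 NN by (intro rank_decreases)
    then have "rank N0 k N' gs' < n" using Suc.prems(1) by simp
    moreover have "cnt' + N' \<le> N0" "0 \<le> cnt'" "length gs' \<le> k"
      using ad pp Suc.prems eq(3) by auto
    ultimately obtain time where time: "time \<le> n * C"
      "orbit_counting_loop (N', gs', cnt') = Some (cnt' + int (card ({1..N'} // eqv gs')), time)"
      using Suc.IH[of N' gs' cnt'] ad by blast
    have "orbit_counting_loop (N, gs, cnt) =
        Some (cnt' + int (card ({1..N'} // eqv gs')), cost (round_t (N, gs, cnt)) + time)"
      by (subst orbit_counting_loop.simps) (simp add: round time(2))
    then show ?thesis using inv(2)[OF round] c time(1)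
      by (intro exI[of _ "cost (round_t (N, gs, cnt)) + time"]) simp
  qed
qed

section \<open>The cost of one round\<close>

lemma bits_mono: "\<bar>x\<bar> \<le> y \<Longrightarrow> bits x \<le> bits y"
  unfolding bits_def bitlen_def by (intro add_right_mono nat_mono of_nat_mono floorlog_mono) auto

lemma affine_mono:
  fixes l k x y c d :: nat
  shows "l \<le> k \<Longrightarrow> x \<le> y \<Longrightarrow> c \<le> d \<Longrightarrow> l * x + c \<le> k * y + d"
  by (intro add_mono mult_le_mono)

lemma cost_return [simp]: "cost (return_t x) = 1"
  by (simp add: return_t_def)

lemma cost_map_t:
  assumes "\<And>x. x \<in> set xs \<Longrightarrow> cost (f x) \<le> F"
  shows "cost (map_t f xs) \<le> length xs * (F + 1) + 1"
  using assms by (induction xs) (fastforce simp: algebra_simps)+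

lemma cost_filter_t:
  assumes "\<And>x. x \<in> set xs \<Longrightarrow> cost (f x) \<le> F"
  shows "cost (filter_t f xs) \<le> length xs * (F + 1) + 1"
  using assms by (induction xs) (fastforce simp: algebra_simps)+

text \<open>
  The size \<open>4 * N0 + 4\<close> leaves room for all intermediate results, such as \<open>a + d + 1\<close> and
  displacements of at most \<open>2 * N0\<close>.
\<close>

locale bounded_size =
  fixes N0 :: int and k b :: nat
  assumes N0: "1 \<le> N0" and b_def: "b = bits (4 * N0 + 4)"
begin

abbreviation small :: "int \<Rightarrow> bool" where
  "small x \<equiv> \<bar>x\<bar> \<le> 4 * N0 + 4"

lemma bits_le: "small x \<Longrightarrow> bits x \<le> b"
  unfolding b_def by (rule bits_mono)

lemma b_pos: "2 \<le> b"
proof -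
  have "bits 2 \<le> b" using N0 by (intro bits_le) auto
  moreover have "2 \<le> bits 2" by (simp add: bits_def bitlen_alt_def)
  ultimately show ?thesis by simp
qed

lemma k_le: "k \<le> b * k"
proof -
  have "1 * k \<le> b * k" using b_pos by (intro mult_le_mono1) simp
  then show ?thesis by simp
qed

lemma cost_arith:
  assumes "small x" "small y"
  shows "cost (add_t x y) \<le> 2 * b" "cost (sub_t x y) \<le> 2 * b" "cost (eq_t x y) \<le> 2 * b"
    "cost (le_t x y) \<le> 2 * b" "cost (less_t x y) \<le> 2 * b"
    "cost (max_t x y) \<le> 2 * b + 1" "cost (min_t x y) \<le> 2 * b + 1"
    "cost (mult_t x y) \<le> b * b" "cost (div_t x y) \<le> b * b" "cost (mod_t x y) \<le> b * b"
  using bits_le[OF assms(1)] bits_le[OF assms(2)]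
  by (simp_all add: add_t_def sub_t_def eq_t_def le_t_def less_t_def max_t_def min_t_def
      mult_t_def div_t_def mod_t_def mult_mono)

lemma small_pairing:
  assumes "pairing_on N (Pairing a b' c d p)" "N \<le> N0"
  shows "0 \<le> a" "a \<le> N0" "0 \<le> b'" "b' \<le> N0" "0 \<le> c" "c \<le> N0" "0 \<le> d" "d \<le> N0"
  using assms by auto

lemma cost_delete_identities:
  assumes "all_on N gs" "N \<le> N0" "length gs \<le> k"
  shows "cost (delete_identities_t gs) \<le> 7 * (k + 1) * b"
proof -
  have "cost (non_identity_t g) \<le> 4 * b + 1" if "g \<in> set gs" for g
  proof -
    obtain a b' c d p where g: "g = Pairing a b' c d p" by (cases g)
    then have "pairing_on N (Pairing a b' c d p)" using assms(1) that by blast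
    note s = small_pairing[OF this assms(2)]
    show ?thesis using cost_arith(3)[of a c] cost_arith(3)[of a b'] s
      by (simp add: g non_identity_t.simps)
  qed
  then have "cost (delete_identities_t gs) \<le> length gs * (4 * b + 1 + 1) + 1"
    unfolding delete_identities_t_def by (rule cost_filter_t)
  also have "\<dots> \<le> k * (4 * b + 2) + 1" using assms(3) by (intro affine_mono) auto
  also have "\<dots> \<le> 7 * (k + 1) * b"
    by (simp add: algebra_simps, use k_le b_pos in linarith)
  finally show ?thesis .
qed

lemma cost_contract:
  assumes "all_on N gs" "0 \<le> N" "N \<le> N0" "length gs \<le> k" "1 \<le> r" "r \<le> s + 1" "s \<le> N"
  shows "cost (contract_t r s N gs) \<le> 30 * (k + 1) * b"
proof -
  define w where "w = s - r + 1"
  have w: "0 \<le> w" "w \<le> N0" "0 \<le> s" "s \<le> N0" using assms by (auto simp: w_def)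
  have "cost (shift_pairing_t s w g) \<le> 16 * b + 5" if "g \<in> set gs" for g
  proof -
    have sl: "cost (shift_left_t s w x) \<le> 4 * b + 1" if "0 \<le> x" "x \<le> N0" for x
      using cost_arith(5)[of s x] cost_arith(2)[of x w] that w by (simp add: shift_left_t_def)
    obtain a b' c d p where g: "g = Pairing a b' c d p" by (cases g)
    then have "pairing_on N (Pairing a b' c d p)" using assms(1) that by blast
    note s = small_pairing[OF this assms(3)]
    show ?thesis using sl[of a] sl[of b'] sl[of c] sl[of d] s by (simp add: g)
  qed
  then have "cost (map_t (shift_pairing_t s w) gs) \<le> length gs * (16 * b + 5 + 1) + 1" by (rule cost_map_t)
  also have "\<dots> \<le> k * (16 * b + 6) + 1" using assms(4) by (intro affine_mono) auto
  finally have m: "cost (map_t (shift_pairing_t s w) gs) \<le> k * (16 * b + 6) + 1" .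
  have "small (s - r)" using assms by auto
  then have "cost (contract_t r s N gs) \<le> 2 * b + 2 * b + (k * (16 * b + 6) + 1) + 2 * b + 1"
    using m cost_arith(2)[of s r] cost_arith(1)[of "s - r" 1] cost_arith(2)[of N w] assms w
    by (simp add: contract_t_def w_def[symmetric])
  also have "\<dots> \<le> 30 * (k + 1) * b"
    by (simp add: algebra_simps, use k_le b_pos in linarith)
  finally show ?thesis .
qed

lemma cost_cover_end:
  assumes "all_on N gs" "N \<le> N0" "0 \<le> q" "q \<le> N0 + 1"
  shows "cost (cover_end_t q gs) \<le> length gs * (16 * b + 4) + 1"
proof -
  have pass: "cost (pass_t q l h e) \<le> 8 * b + 1 \<and> 0 \<le> val (pass_t q l h e) \<and> val (pass_t q l h e) \<le> N0 + 1"
    if "0 \<le> l" "l \<le> N0" "0 \<le> h" "h \<le> N0" "0 \<le> e" "e \<le> N0 + 1" for l h e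
    using cost_arith(4)[of l q] cost_arith(4)[of q h] cost_arith(1)[of h 1] cost_arith(6)[of e "h + 1"] that assms(3,4) b_pos
    by (simp add: pass_t_def max_def)
  have "cost (cover_end_t q gs) \<le> length gs * (16 * b + 4) + 1 \<and>
    0 \<le> val (cover_end_t q gs) \<and> val (cover_end_t q gs) \<le> N0 + 1"
    using assms(1)
  proof (induction gs)
    case (Cons g gs)
    obtain a b' c d p where g: "g = Pairing a b' c d p" by (cases g)
    have "pairing_on N (Pairing a b' c d p)" using Cons.prems g by simp
    note s = small_pairing[OF this assms(2)]
    define e where "e = val (cover_end_t q gs)"
    define e' where "e' = val (pass_t q a b' e)"
    have e: "0 \<le> e" "e \<le> N0 + 1" "cost (cover_end_t q gs) \<le> length gs * (16 * b + 4) + 1"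
      using Cons by (simp_all add: e_def)
    note p1 = pass[OF s(1-4) e(1,2), folded e'_def]
    have "0 \<le> e'" "e' \<le> N0 + 1" using p1 by simp_all
    note p2 = pass[OF s(5-8) this]
    show ?case using p1 p2 e(3) by (simp add: g e_def[symmetric] e'_def[symmetric])
  qed (use assms in simp)
  then show ?thesis by blast
qed

lemma cost_next_start:
  assumes "all_on N gs" "0 \<le> N" "N \<le> N0" "0 \<le> q" "q \<le> N0 + 1"
  shows "cost (next_start_t q N gs) \<le> length gs * (8 * b + 2) + 2 * b"
proof -
  have near: "cost (nearer_t q l n) \<le> 4 * b + 1 \<and> 0 \<le> val (nearer_t q l n) \<and> val (nearer_t q l n) \<le> N0 + 1"
    if "0 \<le> l" "l \<le> N0" "0 \<le> n" "n \<le> N0 + 1" for l n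
    using cost_arith(5)[of q l] cost_arith(7)[of l n] that assms(4,5) b_pos by (simp add: nearer_t_def min_def)
  have "cost (next_start_t q N gs) \<le> length gs * (8 * b + 2) + 2 * b \<and>
    0 \<le> val (next_start_t q N gs) \<and> val (next_start_t q N gs) \<le> N0 + 1"
    using assms(1)
  proof (induction gs)
    case Nil
    then show ?case using cost_arith(1)[of N 1] assms by simp
  next
    case (Cons g gs)
    obtain a b' c d p where g: "g = Pairing a b' c d p" by (cases g)
    have "pairing_on N (Pairing a b' c d p)" using Cons.prems g by simp
    note s = small_pairing[OF this assms(3)]
    define e where "e = val (next_start_t q N gs)"
    define e' where "e' = val (nearer_t q a e)"
    have e: "0 \<le> e" "e \<le> N0 + 1" "cost (next_start_t q N gs) \<le> length gs * (8 * b + 2) + 2 * b"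
      using Cons by (simp_all add: e_def)
    note p1 = near[OF s(1,2) e(1,2), folded e'_def]
    have "0 \<le> e'" "e' \<le> N0 + 1" using p1 by simp_all
    note p2 = near[OF s(5,6) this]
    show ?case using p1 p2 e(3) by (simp add: g e_def[symmetric] e'_def[symmetric])
  qed
  then show ?thesis by blast
qed

text \<open>
  The sweep passes each upper end of an interval at most once when it skips a covered stretch, and
  each lower end at most once when it contracts a static one.
\<close>

definition pending :: "int \<Rightarrow> int \<Rightarrow> pairing list \<Rightarrow> nat" where
  "pending q N gs =
     (\<Sum>g\<leftarrow>gs. of_bool (q \<le> dom_hi g) + of_bool (q \<le> ran_hi g) + of_bool (q < dom_lo g) + of_bool (q < ran_lo g))
     + of_bool (q \<le> N)"

lemma pending_le: "pending q N gs \<le> 4 * length gs + 1"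
proof -
  have "(\<Sum>g\<leftarrow>gs. of_bool (q \<le> dom_hi g) + of_bool (q \<le> ran_hi g) + of_bool (q < dom_lo g) + of_bool (q < ran_lo g) :: nat)
    \<le> (\<Sum>g\<leftarrow>gs. 4)" by (intro sum_list_mono) (auto simp: of_bool_def)
  also have "\<dots> = 4 * length gs" by (induction gs) auto
  finally show ?thesis by (simp add: pending_def)
qed

lemma sum_list_less:
  fixes f g :: "'a \<Rightarrow> nat"
  assumes "\<And>x. x \<in> set xs \<Longrightarrow> f x \<le> g x" "x \<in> set xs" "f x < g x"
  shows "(\<Sum>x\<leftarrow>xs. f x) < (\<Sum>x\<leftarrow>xs. g x)"
  using assms
proof (induction xs)
  case (Cons y ys)
  have le: "(\<Sum>x\<leftarrow>ys. f x) \<le> (\<Sum>x\<leftarrow>ys. g x)" using Cons.prems(1) by (intro sum_list_mono) auto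
  show ?case
  proof (cases "y = x")
    case True
    then show ?thesis using le Cons.prems(3) by simp
  next
    case False
    then have "(\<Sum>x\<leftarrow>ys. f x) < (\<Sum>x\<leftarrow>ys. g x)" using Cons by simp
    then show ?thesis using Cons.prems(1)[of y] by simp
  qed
qed simp

lemma pending_skip:
  assumes "q \<le> N" "q < e" "e = val (cover_end_t q gs)"
  shows "pending e N gs < pending q N gs"
proof -
  obtain g where g: "g \<in> set gs" "(dom_lo g \<le> q \<and> q \<le> dom_hi g \<and> e = dom_hi g + 1) \<or>
       (ran_lo g \<le> q \<and> q \<le> ran_hi g \<and> e = ran_hi g + 1)"
    using cover_end_props(4)[of q gs] assms by blast
  let ?f = "\<lambda>q g. of_bool (q \<le> dom_hi g) + of_bool (q \<le> ran_hi g) + of_bool (q < dom_lo g) + of_bool (q < ran_lo g) :: nat"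
  have "(\<Sum>g\<leftarrow>gs. ?f e g) < (\<Sum>g\<leftarrow>gs. ?f q g)"
    by (rule sum_list_less[OF _ g(1)]) (use assms(2) g(2) in \<open>auto simp: of_bool_def\<close>)
  then show ?thesis using assms(1,2) by (simp add: pending_def of_bool_def)
qed

text \<open>
  The contraction moves the interval that starts at \<open>n\<close> to \<open>q\<close>; if there is none, the sweep has reached
  the end.
\<close>

lemma pending_contract:
  assumes wf: "all_on N gs" and q: "1 \<le> q" "q \<le> N" and n: "n = val (next_start_t q N gs)"
    and static: "q \<notin> cover gs"
  shows "pending q (N - (n - q)) (map (relabel (shift (n - 1) (n - q))) gs) < pending q N gs"
proof -
  let ?f = "\<lambda>q g. of_bool (q \<le> dom_hi g) + of_bool (q \<le> ran_hi g) + of_bool (q < dom_lo g) + of_bool (q < ran_lo g) :: nat"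
  let ?g = "relabel (shift (n - 1) (n - q))"
  have qn: "q < n" unfolding n using q by (intro next_start_t_greater)
  have gap: "cover gs \<inter> {q..<n} = {}" using static_gap[OF wf static n] .
  note pair = gap_disjoint[OF wf gap qn]
  have le: "?f q (?g g) \<le> ?f q g" if "g \<in> set gs" for g
    using pair[OF that] qn by (cases g) (auto simp: shift_def of_bool_def)
  have sum_le: "(\<Sum>g\<leftarrow>gs. ?f q (?g g)) \<le> (\<Sum>g\<leftarrow>gs. ?f q g)" using le by (rule sum_list_mono)
  show ?thesis
  proof (cases "n \<le> N")
    case True
    then obtain g where g: "g \<in> set gs" "dom_lo g = n \<or> ran_lo g = n"
      using next_start_props(3)[OF wf, of q] n by blast
    have "?f q (?g g) < ?f q g"
      using pair[OF g(1)] g(2) qn by (cases g) (auto simp: shift_def of_bool_def)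
    then have "(\<Sum>g\<leftarrow>gs. ?f q (?g g)) < (\<Sum>g\<leftarrow>gs. ?f q g)" using le g(1) by (intro sum_list_less)
    then show ?thesis using q by (simp add: pending_def comp_def of_bool_def)
  next
    case False
    then have "n = N + 1" using next_start_props(1)[OF wf, of q] n by simp
    then show ?thesis using sum_le q by (simp add: pending_def comp_def of_bool_def)
  qed
qed

lemma cost_contract_from:
  assumes "all_on N gs" "1 \<le> q" "q \<le> N + 1" "N \<le> N0" "0 \<le> N" "0 \<le> cnt" "cnt + N \<le> N0" "length gs \<le> k"
  shows "cost (contract_from_t q N gs cnt) \<le> (pending q N gs + 1) * (70 * (k + 1) * b)"
  using assms
proof (induction "nat (N + 1 - q)" arbitrary: q N gs cnt rule: less_induct)
  case less
  define P where "P = 70 * (k + 1) * b"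
  define e where "e = val (cover_end_t q gs)"
  define n where "n = val (next_start_t q N gs)"
  have b: "2 \<le> b" by (rule b_pos)
  have less_cost: "cost (less_t N q) \<le> 2 * b" using less.prems by (intro cost_arith) auto
  consider "N < q" | "q \<le> N" "q < e" | "q \<le> N" "\<not> q < e" by linarith
  then have "cost (contract_from_t q N gs cnt) \<le> (pending q N gs + 1) * P"
  proof cases
    case 1
    have "2 * b + 1 \<le> P" using b by (simp add: P_def algebra_simps)
    moreover have "P \<le> (pending q N gs + 1) * P" by simp
    ultimately show ?thesis using 1 less_cost by (subst contract_from_t.simps) simp
  next
    case 2
    have eN: "e \<le> N + 1"
    proof -
      obtain g where g: "g \<in> set gs" "e = dom_hi g + 1 \<or> e = ran_hi g + 1"
        using cover_end_props(4)[of q gs] 2(2) by (auto simp: e_def)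
      from g(1) have "pairing_on N g" using less.prems(1) by blast
      then show ?thesis using g(2) by (cases g) auto
    qed
    have "cost (cover_end_t q gs) \<le> length gs * (16 * b + 4) + 1"
      using less.prems(2,3,4) by (intro cost_cover_end[OF less.prems(1,4)]) auto
    also have "\<dots> \<le> k * (16 * b + 4) + 1" using less.prems(8) by (intro affine_mono) auto
    finally have c1: "cost (cover_end_t q gs) \<le> k * (16 * b + 4) + 1" .
    have c2: "cost (less_t q e) \<le> 2 * b" using less.prems 2 eN by (intro cost_arith) auto
    have IH: "cost (contract_from_t e N gs cnt) \<le> (pending e N gs + 1) * P"
      unfolding P_def using less.prems 2 eN by (intro less.hyps) auto
    have "cost (contract_from_t q N gs cnt) =
        cost (less_t N q) + (cost (cover_end_t q gs) + (cost (less_t q e) + cost (contract_from_t e N gs cnt)))"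
      using 2 by (subst contract_from_t.simps) (simp add: e_def)
    also have "\<dots> \<le> 2 * b + (k * (16 * b + 4) + 1 + (2 * b + (pending e N gs + 1) * P))"
      using less_cost c1 c2 IH by (intro add_mono)
    also have "\<dots> = 2 * b + (k * (16 * b + 4) + 1 + 2 * b) + (pending e N gs + 1) * P" by simp
    also have "\<dots> \<le> P + (pending e N gs + 1) * P"
      unfolding P_def by (rule add_right_mono) (simp add: algebra_simps, use k_le b in linarith)
    also have "\<dots> \<le> (pending q N gs + 1) * P"
    proof -
      have "pending e N gs + 1 + 1 \<le> pending q N gs + 1"
        using pending_skip[OF 2 e_def] by simp
      then have "(pending e N gs + 1 + 1) * P \<le> (pending q N gs + 1) * P" by (rule mult_le_mono1)
      then show ?thesis by (simp add: algebra_simps)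
    qed
    finally show ?thesis .
  next
    case 3
    define gs' where "gs' = map (relabel (shift (n - 1) (n - q))) gs"
    have static: "q \<notin> cover gs" using cover_end_props(3)[of q gs] 3 by (auto simp: e_def)
    then have gap: "cover gs \<inter> {q..<n} = {}" using static_gap less.prems by (simp add: n_def)
    have qn: "q < n" unfolding n_def using 3 by (intro next_start_t_greater)
    have nN: "n \<le> N + 1" unfolding n_def by (rule next_start_props(1)[OF less.prems(1)])
    note one = contract_one(1)[OF less.prems(1,2) qn nN gap, folded gs'_def]
    have eq: "e = q" using 3 cover_end_props(1)[of q gs] by (simp add: e_def)
    have "cost (cover_end_t q gs) \<le> length gs * (16 * b + 4) + 1"
      using less.prems(2,3,4) by (intro cost_cover_end[OF less.prems(1,4)]) auto
    also have "\<dots> \<le> k * (16 * b + 4) + 1" using less.prems(8) by (intro affine_mono) auto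
    finally have c1: "cost (cover_end_t q gs) \<le> k * (16 * b + 4) + 1" .
    have "cost (next_start_t q N gs) \<le> length gs * (8 * b + 2) + 2 * b"
      using less.prems(2,3,4) by (intro cost_next_start[OF less.prems(1,5,4)]) auto
    also have "\<dots> \<le> k * (8 * b + 2) + 2 * b" using less.prems(8) by (intro affine_mono) auto
    finally have c3: "cost (next_start_t q N gs) \<le> k * (8 * b + 2) + 2 * b" .
    have c: "cost (less_t q e) \<le> 2 * b" "cost (sub_t n 1) \<le> 2 * b" "cost (add_t cnt (n - q)) \<le> 2 * b"
      using less.prems 3 eq nN qn by (intro cost_arith; auto)+
    have c4: "cost (contract_t q (n - 1) N gs) \<le> 30 * (k + 1) * b"
      using less.prems(2) qn nN by (intro cost_contract[OF less.prems(1,5,4,8)]) auto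
    have IH: "cost (contract_from_t q (N - (n - q)) gs' (cnt + (n - q)))
        \<le> (pending q (N - (n - q)) gs' + 1) * P"
      unfolding P_def using less.prems 3 qn nN one by (intro less.hyps) (auto simp: gs'_def)
    have "cost (contract_from_t q N gs cnt) =
        cost (less_t N q) + (cost (cover_end_t q gs) + (cost (less_t q e) + (cost (next_start_t q N gs) +
        (cost (sub_t n 1) + (cost (contract_t q (n - 1) N gs) + (cost (add_t cnt (n - q)) +
          cost (contract_from_t q (N - (n - q)) gs' (cnt + (n - q)))))))))"
      using 3 by (subst contract_from_t.simps) (simp add: e_def n_def val_contract gs'_def)
    also have "\<dots> \<le> 2 * b + (k * (16 * b + 4) + 1 + (2 * b + (k * (8 * b + 2) + 2 * b + (2 * b +
        (30 * (k + 1) * b + (2 * b + (pending q (N - (n - q)) gs' + 1) * P))))))"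
      using less_cost c1 c3 c4 c IH by (intro add_mono)
    also have "\<dots> = 2 * b + (k * (16 * b + 4) + 1 + (2 * b + (k * (8 * b + 2) + 2 * b + (2 * b +
        (30 * (k + 1) * b + 2 * b))))) + (pending q (N - (n - q)) gs' + 1) * P" by simp
    also have "\<dots> \<le> P + (pending q (N - (n - q)) gs' + 1) * P"
      unfolding P_def by (rule add_right_mono) (simp add: algebra_simps, use k_le b in linarith)
    also have "\<dots> \<le> (pending q N gs + 1) * P"
    proof -
      have "pending q (N - (n - q)) gs' + 1 + 1 \<le> pending q N gs + 1"
        using pending_contract[OF less.prems(1,2) 3(1) n_def static] by (simp add: gs'_def)
      then have "(pending q (N - (n - q)) gs' + 1 + 1) * P \<le> (pending q N gs + 1) * P" by (rule mult_le_mono1)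
      then show ?thesis by (simp add: algebra_simps)
    qed
    finally show ?thesis .
  qed
  then show ?case by (simp add: P_def)
qed


lemma b_square: "2 * b \<le> b * b" "4 * b \<le> b * b * b" "2 * (b * b) \<le> b * b * b"
proof -
  show sq: "2 * b \<le> b * b" using b_pos by (intro mult_le_mono1)
  show "2 * (b * b) \<le> b * b * b" using b_pos by (simp add: mult.assoc)
  then show "4 * b \<le> b * b * b" using sq by linarith
qed

text \<open>
  The product of the two arguments at least halves in each step of Euclid's algorithm, because
  \<open>2 * (x mod y) \<le> x\<close> for \<open>0 < y \<le> x\<close>.
\<close>

lemma cost_gcd_ordered:
  assumes "0 \<le> y" "y \<le> x" "small x" "x * y < 2 ^ n"
  shows "cost (gcd_t x y) \<le> (n + 1) * (b * b + 2 * b + 1)"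
  using assms
proof (induction n arbitrary: x y)
  case 0
  have "y = 0"
  proof (rule ccontr)
    assume "y \<noteq> 0"
    then have "1 * 1 \<le> x * y" using 0 by (intro mult_mono) auto
    then show False using 0 by simp
  qed
  moreover have "cost (eq_t 0 0) \<le> 2 * b" using N0 by (intro cost_arith) auto
  ultimately show ?case by (subst gcd_t.simps) simp
next
  case (Suc n)
  have e: "cost (eq_t y 0) \<le> 2 * b" using Suc.prems by (intro cost_arith) auto
  show ?case
  proof (cases "y = 0")
    case True
    then show ?thesis using e by (subst gcd_t.simps) simp
  next
    case False
    define r where "r = x mod y"
    have r: "0 \<le> r" "r < y" using Suc.prems False by (simp_all add: r_def)
    have "1 \<le> x div y" using Suc.prems False by (simp add: pos_imp_zdiv_pos_iff int_one_le_iff_zero_less)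
    then have "y * 1 \<le> y * (x div y)" using Suc.prems by (intro mult_left_mono) auto
    moreover have "x = y * (x div y) + r" by (simp add: r_def)
    ultimately have "2 * r \<le> x" using r by linarith
    then have "2 * r * y \<le> x * y" using Suc.prems by (intro mult_right_mono) auto
    then have "2 * (y * r) \<le> x * y" by (simp add: mult_ac)
    then have "y * r < 2 ^ n" using Suc.prems(4) by simp
    then have "cost (gcd_t y r) \<le> (n + 1) * (b * b + 2 * b + 1)"
      using Suc.prems r by (intro Suc.IH) auto
    moreover have "cost (mod_t x y) \<le> b * b" using Suc.prems by (intro cost_arith) auto
    ultimately show ?thesis using e False by (subst gcd_t.simps) (simp add: r_def)
  qed
qed

text \<open>
  The first step brings the arguments into order; their product is then below \<open>2 ^ (2 * b)\<close>.
\<close>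

lemma cost_gcd:
  assumes "0 \<le> x" "x \<le> N0" "0 < y" "y \<le> N0"
  shows "cost (gcd_t x y) \<le> 9 * (b * b * b)"
proof -
  have "4 * N0 + 4 < 2 ^ nat (bitlen (4 * N0 + 4))" using bitlen_bounds[of "4 * N0 + 4"] N0 by simp
  also have "\<dots> \<le> (2::int) ^ b" using N0 by (intro power_increasing) (auto simp: b_def bits_def)
  finally have pow: "N0 < 2 ^ b" using N0 by simp
  have r: "0 \<le> x mod y" "x mod y < y" using assms by simp_all
  have le: "x mod y \<le> N0" using r assms by linarith
  have "y * (x mod y) \<le> N0 * N0" by (rule mult_mono[OF assms(4) le]) (use r N0 in auto)
  also have "\<dots> < 2 ^ b * 2 ^ b" using pow N0 by (intro mult_strict_mono) auto
  finally have "y * (x mod y) < 2 ^ (2 * b)" by (simp add: power_add[symmetric] mult_2)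
  then have "cost (gcd_t y (x mod y)) \<le> (2 * b + 1) * (b * b + 2 * b + 1)"
    using assms by (intro cost_gcd_ordered[OF r(1) less_imp_le[OF r(2)]]) auto
  moreover have "cost (eq_t y 0) \<le> 2 * b" "cost (mod_t x y) \<le> b * b" using assms by (intro cost_arith; auto)+
  ultimately have "cost (gcd_t x y) \<le> (2 * b + 2) * (b * b + 2 * b + 1)"
    using assms by (subst gcd_t.simps) (simp add: algebra_simps)
  also have "\<dots> \<le> (3 * b) * (3 * (b * b))"
  proof (rule mult_le_mono)
    show "2 * b + 2 \<le> 3 * b" "b * b + 2 * b + 1 \<le> 3 * (b * b)" using b_pos b_square(1) by linarith+
  qed
  finally show ?thesis by (simp add: mult.assoc)
qed

lemma cost_merge:
  assumes "pairing_on N g" "pairing_on N h" "N \<le> N0"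
  shows "cost (merge_t g h) \<le> 20 * (b * b * b)"
proof -
  obtain a b1 c d p a' b1' c' d' p'
    where gh: "g = Pairing a b1 c d p" "h = Pairing a' b1' c' d' p'" by (metis pairing.exhaust)
  have on: "pairing_on N (Pairing a b1 c d p)" "pairing_on N (Pairing a' b1' c' d' p')"
    using assms gh by simp_all
  note s = small_pairing[OF on(1) assms(3)] small_pairing[OF on(2) assms(3)]
  have per: "cost (periodic_t (Pairing a b1 c d p)) \<le> 6 * b + 1"
    if "0 \<le> a" "a \<le> N0" "0 \<le> b1" "b1 \<le> N0" "0 \<le> c" "c \<le> N0" for a b1 c d p
    using that cost_arith(5)[of a c] cost_arith(1)[of b1 1] cost_arith(4)[of c "b1 + 1"]
    by (simp add: periodic_t.simps)
  have sub: "cost (sub_t c a) \<le> 2 * b" "cost (sub_t c' a') \<le> 2 * b"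
    using s by (intro cost_arith; auto)+
  have mm: "cost (max_t a a') \<le> 2 * b + 1" "cost (min_t d d') \<le> 2 * b + 1"
    "cost (min_t a a') \<le> 2 * b + 1" "cost (max_t d d') \<le> 2 * b + 1"
    using s by (intro cost_arith; auto)+
  have w: "cost (sub_t (min d d') (max a a')) \<le> 2 * b" "cost (add_t (min d d' - max a a') 1) \<le> 2 * b"
    "cost (add_t (c - a) (c' - a')) \<le> 2 * b"
    "cost (le_t (c - a + (c' - a')) (min d d' - max a a' + 1)) \<le> 2 * b"
    using s by (intro cost_arith; auto)+
  define t where "t = val (gcd_t (c - a) (c' - a'))"
  have merged: "cost (gcd_t (c - a) (c' - a')) \<le> 9 * (b * b * b) \<and>
      cost (add_t (min a a') t) \<le> 2 * b \<and> cost (sub_t (max d d') t) \<le> 2 * b"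
    if "a < c" "a' < c'"
  proof -
    have "t = gcd (c - a) (c' - a')" using that by (simp add: t_def val_gcd_t)
    then have "0 \<le> t" "t \<le> c - a" using that by (auto intro: gcd_le1_int)
    then have "cost (add_t (min a a') t) \<le> 2 * b" "cost (sub_t (max d d') t) \<le> 2 * b"
      using s by (intro cost_arith; auto)+
    moreover have "cost (gcd_t (c - a) (c' - a')) \<le> 9 * (b * b * b)"
      using that s by (intro cost_gcd) auto
    ultimately show ?thesis by blast
  qed
  have "cost (merge_t g h) \<le> 38 * b + 10 + 9 * (b * b * b)"
    using per[of a b1 c d p] per[of a' b1' c' d' p'] s sub mm w merged
    by (auto simp: gh merge_t.simps t_def[symmetric])
  then show ?thesis using b_square b_pos by linarith
qed

lemma cost_merge_with:
  assumes "pairing_on N g" "all_on N hs" "N \<le> N0"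
  shows "cost (merge_with_t g hs) \<le> length hs * (20 * (b * b * b) + 1) + 1"
  using assms(2)
proof (induction hs)
  case (Cons h hs)
  have "cost (merge_t g h) \<le> 20 * (b * b * b)" using Cons.prems assms by (intro cost_merge) auto
  then show ?case using Cons by (auto split: option.splits)
qed simp

lemma cost_merge_first:
  assumes "all_on N gs" "N \<le> N0" "length gs \<le> k"
  shows "cost (merge_first_t gs) \<le> length gs * (k * (20 * (b * b * b) + 1) + 2) + 1"
  using assms(1,3)
proof (induction gs)
  case (Cons g gs)
  have "cost (merge_with_t g gs) \<le> length gs * (20 * (b * b * b) + 1) + 1"
    using Cons.prems assms by (intro cost_merge_with) auto
  also have "\<dots> \<le> k * (20 * (b * b * b) + 1) + 1" using Cons.prems by (intro affine_mono) auto
  finally show ?case using Cons by (auto split: option.splits)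
qed simp

text \<open>
  Each merger shortens the list, so there are at most \<open>length gs + 1\<close> searches.
\<close>

lemma cost_merge_all:
  assumes "ready N gs" "N \<le> N0" "length gs \<le> k"
  shows "cost (merge_all_t gs) \<le> (length gs + 1) * (k * (k * (20 * (b * b * b) + 1) + 2) + 2)"
  using assms(1,3)
proof (induction gs rule: merge_all_t.induct)
  case (1 gs)
  define P where "P = k * (k * (20 * (b * b * b) + 1) + 2) + 2"
  have wf: "all_on N gs" using "1.prems" by (simp add: ready_def)
  have "cost (merge_first_t gs) \<le> length gs * (k * (20 * (b * b * b) + 1) + 2) + 1"
    by (rule cost_merge_first[OF wf assms(2) "1.prems"(2)])
  also have "\<dots> \<le> k * (k * (20 * (b * b * b) + 1) + 2) + 1"
    using "1.prems"(2) by (intro affine_mono) auto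
  finally have first: "cost (merge_first_t gs) + 1 \<le> P" by (simp add: P_def)
  show ?case
  proof (cases "val (merge_first_t gs)")
    case None
    have "P \<le> (length gs + 1) * P" by simp
    then have "cost (merge_first_t gs) + 1 \<le> (length gs + 1) * P" using first by linarith
    then show ?thesis using None unfolding P_def by (subst merge_all_t.simps) simp
  next
    case (Some gs')
    have len: "length gs' < length gs" using merge_first_t_length[OF Some] .
    have "cost (merge_all_t gs') \<le> (length gs' + 1) * P"
      unfolding P_def using "1.IH"[OF refl Some] merge_first_step(1)[OF Some "1.prems"(1)] len "1.prems"(2) by simp
    also have "\<dots> \<le> length gs * P" using len by (intro mult_le_mono1) simp
    finally have "cost (merge_first_t gs) + cost (merge_all_t gs') \<le> (length gs + 1) * P"
      using first by simp
    then show ?thesis using Some unfolding P_def by (subst merge_all_t.simps) simp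
  qed
qed

lemma cost_trim:
  assumes "pairing_on N g" "N \<le> N0"
  shows "cost (trim_t g) \<le> 8 * b + 2 * (b * b) + 1"
proof -
  obtain a b1 c d p where g: "g = Pairing a b1 c d p" by (cases g)
  note s = small_pairing[OF assms(1)[unfolded g] assms(2)]
  have h: "0 \<le> (a + d) div 2" "(a + d) div 2 \<le> a + d" using s by auto
  have "cost (le_t c b1) \<le> 2 * b" "cost (add_t a d) \<le> 2 * b" "cost (sub_t (a + d) 1) \<le> 2 * b"
    "cost (div_t (a + d - 1) 2) \<le> b * b" "cost (div_t (a + d) 2) \<le> b * b"
    "cost (add_t ((a + d) div 2) 1) \<le> 2 * b"
    using s h by (intro cost_arith; auto)+
  then show ?thesis by (auto simp: g trim_t.simps)
qed

lemma cost_orient: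
  assumes "small (dom_lo g)" "small (ran_lo g)"
  shows "cost (orient_t g) \<le> 2 * b + 1"
  using assms cost_arith(4)[of "dom_lo g" "ran_lo g"] by (cases g) (simp add: orient_t.simps)

lemma cost_displacement:
  assumes "0 < t" "t \<le> N0" "0 \<le> c" "c \<le> x" "x \<le> N0"
  shows "cost (displacement_t t c x) \<le> 4 * b + 2 * (b * b)" "0 \<le> disp t c x" "disp t c x \<le> 2 * N0"
proof -
  have q: "0 \<le> (x - c) div t" "(x - c) div t \<le> x - c"
  proof -
    show nonneg: "0 \<le> (x - c) div t" using assms by (simp add: pos_imp_zdiv_nonneg_iff)
    then have "(x - c) div t * 1 \<le> (x - c) div t * t" using assms by (intro mult_left_mono) auto
    moreover have "(x - c) div t * t + (x - c) mod t = x - c" "0 \<le> (x - c) mod t" using assms by simp_all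
    ultimately show "(x - c) div t \<le> x - c" by linarith
  qed
  have "cost (sub_t x c) \<le> 2 * b" "cost (div_t (x - c) t) \<le> b * b" "cost (add_t ((x - c) div t) 1) \<le> 2 * b"
    "cost (mult_t ((x - c) div t + 1) t) \<le> b * b"
    using assms q by (intro cost_arith; auto)+
  then show "cost (displacement_t t c x) \<le> 4 * b + 2 * (b * b)" by (simp add: displacement_t_def)
  show "0 \<le> disp t c x" "disp t c x \<le> 2 * N0"
    using disp_bounds(1,2)[OF assms(1,4)] assms by auto
qed

lemma cost_transmit:
  assumes m: "proper m" "pairing_on N m" "ran_hi m = N" and x: "pairing_on N x" "ran_lo m \<le> ran_lo x"
    and N: "N \<le> N0"
  shows "cost (transmit_t m x) \<le> 40 * b + 6 * (b * b) + 10"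
proof -
  obtain a1 b1 c1 p1 a2 b2 c2 d2 p2
    where mx: "m = Pairing a1 b1 c1 N p1" "x = Pairing a2 b2 c2 d2 p2"
    using m(3) by (metis pairing.exhaust pairing.sel(4))
  note s = small_pairing[OF m(2)[unfolded mx] N] small_pairing[OF x(1)[unfolded mx] N]
  have c: "a1 < c1" "c1 \<le> c2" "p1 \<or> b1 < c1" using m x by (auto simp: mx)
  have trim: "cost (trim_t m) \<le> 8 * b + 2 * (b * b) + 1" using m(2) N by (rule cost_trim)
  have same: "val (trim_t m) = m" using c by (auto simp: mx)
  have le: "cost (le_t c1 a2) \<le> 2 * b" "cost (le_t b2 N) \<le> 2 * b" using s by (intro cost_arith; auto)+
  define u where "u = disp (c1 - a1) c1 c2"
  define v where "v = disp (c1 - a1) c1 a2"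
  have t: "0 < c1 - a1" "c1 - a1 \<le> N0" using c s by auto
  note du = cost_displacement[OF t s(5) c(2) s(14), folded u_def]
  have cu: "cost (sub_t c1 a1) \<le> 2 * b" "cost (sub_t c2 u) \<le> 2 * b" "cost (sub_t d2 u) \<le> 2 * b"
    "cost (add_t a1 N) \<le> 2 * b" "cost (sub_t (a1 + N) d2) \<le> 2 * b" "cost (sub_t (a1 + N) c2) \<le> 2 * b"
    "cost (sub_t (a1 + N) b2) \<le> 2 * b" "cost (sub_t (a1 + N) a2) \<le> 2 * b"
    using s du(2,3) by (intro cost_arith; auto)+
  have cv: "cost (displacement_t (c1 - a1) c1 a2) \<le> 4 * b + 2 * (b * b) \<and>
      cost (sub_t a2 v) \<le> 2 * b \<and> cost (sub_t b2 v) \<le> 2 * b \<and>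
      cost (orient_t (Pairing (a2 - v) (b2 - v) (c2 - u) (d2 - u) p2)) \<le> 2 * b + 1"
    if "c1 \<le> a2"
  proof -
    note dv = cost_displacement[OF t s(5) that s(10), folded v_def]
    have "cost (sub_t a2 v) \<le> 2 * b" "cost (sub_t b2 v) \<le> 2 * b"
      using s dv(2,3) by (intro cost_arith; auto)+
    moreover have "cost (orient_t (Pairing (a2 - v) (b2 - v) (c2 - u) (d2 - u) p2)) \<le> 2 * b + 1"
      using s du dv by (intro cost_orient) auto
    ultimately show ?thesis using dv by blast
  qed
  have o: "cost (orient_t (Pairing a2 b2 (c2 - u) (d2 - u) p2)) \<le> 2 * b + 1"
    "cost (orient_t (Pairing (a1 + N - b2) (a1 + N - a2) (a1 + N - d2) (a1 + N - c2) p2)) \<le> 2 * b + 1"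
    "cost (orient_t (Pairing a2 b2 (a1 + N - d2) (a1 + N - c2) (\<not> p2))) \<le> 2 * b + 1"
    using s du by (intro cost_orient; auto)+
  show ?thesis
    using trim le cu cv o du(1) same
    by (auto simp: transmit_t_def mx transmit_trimmed_t.simps u_def[symmetric] v_def[symmetric])
qed

lemma cost_select_maximal:
  assumes "pairing_on N g" "all_on N hs" "N \<le> N0"
  shows "cost (select_maximal_t g hs) \<le> length hs * (12 * b + 2) + 1"
  using assms(1,2)
proof (induction hs arbitrary: g)
  case (Cons h hs)
  have "cost (lex_less_t g h) \<le> 12 * b + 1"
  proof -
    obtain a b1 c d p a' b1' c' d' p'
      where gh: "g = Pairing a b1 c d p" "h = Pairing a' b1' c' d' p'" by (metis pairing.exhaust)
    have on: "pairing_on N (Pairing a b1 c d p)" "pairing_on N (Pairing a' b1' c' d' p')"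
      using Cons.prems gh by simp_all
    note s = small_pairing[OF on(1) assms(3)] small_pairing[OF on(2) assms(3)]
    have "cost (less_t d d') \<le> 2 * b" "cost (eq_t d d') \<le> 2 * b" "cost (less_t c' c) \<le> 2 * b"
      "cost (eq_t c' c) \<le> 2 * b" "cost (less_t a' a) \<le> 2 * b" "cost (eq_t a' a) \<le> 2 * b"
      using s by (intro cost_arith; auto)+
    then show ?thesis by (simp add: gh)
  qed
  moreover have "cost (select_maximal_t (if val (lex_less_t g h) then h else g) hs) \<le> length hs * (12 * b + 2) + 1"
    using Cons.prems by (intro Cons.IH) auto
  ultimately show ?case by (simp add: case_prod_unfold del: lex_less_t.simps)
qed simp

lemma cost_transmit_all:
  assumes r: "ready N gs" "gs \<noteq> []" and N: "N \<le> N0" "length gs \<le> k"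
  shows "cost (transmit_all_t N gs) \<le> 90 * (k + 1) * (b * b)"
proof -
  obtain g hs where gs: "gs = g # hs" using r(2) by (cases gs) auto
  obtain m rest where p: "val (select_maximal_t g hs) = (m, rest)" by fastforce
  have pick: "pick gs = (m, rest)" using p by (simp add: pick_def gs)
  note pp = pick_props[OF r pick]
  have "length gs = Suc (length rest)" using pp(1) by (metis length_Cons size_mset)
  then have len: "length rest \<le> k" "length hs \<le> k" using N(2) gs by simp_all
  have "all_on N gs" using r by (simp add: ready_def)
  then have "cost (select_maximal_t g hs) \<le> length hs * (12 * b + 2) + 1"
    using N(1) by (intro cost_select_maximal) (auto simp: gs)
  also have "\<dots> \<le> k * (12 * b + 2) + 1" using len by (intro affine_mono) auto
  finally have sel: "cost (select_maximal_t g hs) \<le> k * (12 * b + 2) + 1" .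
  have "cost (transmit_if_t N m x) \<le> 44 * b + 6 * (b * b) + 10" if "x \<in> set rest" for x
  proof -
    have x: "pairing_on N x" using pp(6) that by blast
    have "0 \<le> ran_lo m" "ran_lo m \<le> N0" "0 \<le> ran_lo x" "ran_lo x \<le> N0" "0 \<le> ran_hi x" "ran_hi x \<le> N0" "0 \<le> N"
      using x pp(5) N(1) by (cases m; cases x; auto)+
    then have "cost (le_t (ran_lo m) (ran_lo x)) \<le> 2 * b" "cost (le_t (ran_hi x) N) \<le> 2 * b"
      using N(1) by (intro cost_arith; auto)+
    then show ?thesis
      using cost_transmit[OF pp(4,5,3) x _ N(1)] by (auto simp: transmit_if_t_def)
  qed
  then have "cost (map_t (transmit_if_t N m) rest) \<le> length rest * (44 * b + 6 * (b * b) + 10 + 1) + 1"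
    by (rule cost_map_t)
  also have "\<dots> \<le> k * (44 * b + 6 * (b * b) + 11) + 1" using len by (intro affine_mono) auto
  finally have "cost (transmit_all_t N gs) \<le> k * (12 * b + 2) + 1 + (k * (44 * b + 6 * (b * b) + 11) + 1) + 1"
    using sel by (simp add: gs p)
  also have "\<dots> = k * (56 * b + 6 * (b * b) + 13) + 3" by (simp add: algebra_simps)
  also have "\<dots> \<le> k * (90 * (b * b)) + 90 * (b * b)"
  proof (intro affine_mono le_refl)
    show "56 * b + 6 * (b * b) + 13 \<le> 90 * (b * b)" "3 \<le> 90 * (b * b)"
      using b_square(1) b_pos by linarith+
  qed
  finally show ?thesis by (simp add: algebra_simps)
qed

lemma cost_truncate_top:
  assumes "all_on N gs" "0 \<le> N" "N \<le> N0" "length gs \<le> k"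
  shows "cost (truncate_top_t N gs) \<le> 30 * (k + 1) * b"
proof -
  have hi: "0 \<le> ran_hi g \<and> ran_hi g \<le> N0 \<and> 0 \<le> ran_lo g \<and> ran_lo g \<le> N0" if "g \<in> set gs" for g
  proof -
    have "pairing_on N g" using assms(1) that by blast
    then show ?thesis using assms(3) by (cases g) auto
  qed
  have ext: "cost (extract_top_t N gs) \<le> length gs * (2 * b + 2) + 1"
    using hi
  proof (induction gs)
    case (Cons g gs)
    have "cost (eq_t (ran_hi g) N) \<le> 2 * b" using Cons.prems[of g] assms(2,3) by (intro cost_arith) auto
    then show ?case using Cons by auto
  qed simp
  have ex: "h \<in> set gs \<and> set hs \<subseteq> set gs \<and> length hs \<le> length gs"
    if "val (extract_top_t N gs) = Some (h, hs)" for h hs gs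
    using that
  proof (induction gs arbitrary: hs)
    case (Cons g gs)
    show ?case
    proof (cases "ran_hi g = N")
      case True
      then show ?thesis using Cons.prems by auto
    next
      case False
      then obtain hs' where "val (extract_top_t N gs) = Some (h, hs')" "hs = g # hs'"
        using Cons.prems by auto
      with Cons.IH[of hs'] show ?thesis by auto
    qed
  qed simp
  have maxe: "cost (max_end_t hs) \<le> length hs * (2 * b + 1) + 1 \<and> 0 \<le> val (max_end_t hs) \<and> val (max_end_t hs) \<le> N0"
    if "set hs \<subseteq> set gs" for hs
    using that
  proof (induction hs)
    case (Cons h hs)
    have h: "0 \<le> ran_hi h" "ran_hi h \<le> N0" using hi[of h] Cons.prems by auto
    have IH: "cost (max_end_t hs) \<le> length hs * (2 * b + 1) + 1" "0 \<le> val (max_end_t hs)" "val (max_end_t hs) \<le> N0"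
      using Cons by auto
    have "cost (max_t (val (max_end_t hs)) (ran_hi h)) \<le> 2 * b + 1" using IH h by (intro cost_arith) auto
    then show ?case using IH h by (simp del: val_max_end add: max_def)
  qed (use N0 in \<open>auto simp: max_end_def\<close>)
  have eb: "length gs * (2 * b + 2) + 1 \<le> k * (2 * b + 2) + 1" using assms(4) by (intro affine_mono) auto
  have "cost (truncate_top_t N gs) \<le> (k * (2 * b + 2) + 1) + (k * (2 * b + 1) + 1) + 20 * b"
  proof (cases "val (extract_top_t N gs)")
    case None
    then have "cost (truncate_top_t N gs) = cost (extract_top_t N gs) + 1"
      by (simp add: truncate_top_t_def)
    then show ?thesis using ext eb b_pos by linarith
  next
    case (Some q)
    obtain g hs where q: "q = (g, hs)" by fastforce
    note e = ex[OF Some[unfolded q]]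
    note g = hi[of g]
    have mh: "cost (max_end_t hs) \<le> length hs * (2 * b + 1) + 1" "0 \<le> max_end hs" "max_end hs \<le> N0"
      using maxe[of hs] e by auto
    have "length hs * (2 * b + 1) + 1 \<le> k * (2 * b + 1) + 1" using e assms(4) by (intro affine_mono) auto
    then have mh': "cost (max_end_t hs) \<le> k * (2 * b + 1) + 1" using mh(1) by linarith
    define M where "M = max (ran_lo g) (max_end hs + 1) - 1"
    have M: "-1 \<le> M" "M \<le> N0" using g e mh by (auto simp: M_def)
    have c: "cost (add_t (max_end hs) 1) \<le> 2 * b" "cost (max_t (ran_lo g) (max_end hs + 1)) \<le> 2 * b + 1"
      "cost (sub_t (max (ran_lo g) (max_end hs + 1)) 1) \<le> 2 * b"
      using mh g e by (intro cost_arith; auto)+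
    have "cost (truncate_t N M g hs) \<le> 8 * b + 1"
    proof -
      obtain a b1 c d p where gg: "g = Pairing a b1 c d p" by (cases g)
      have "pairing_on N (Pairing a b1 c d p)" using assms(1) e gg by blast
      note s = small_pairing[OF this assms(3)]
      have "cost (add_t M 1) \<le> 2 * b" "cost (eq_t c (M + 1)) \<le> 2 * b" "cost (sub_t N M) \<le> 2 * b"
        "cost (sub_t b1 (N - M)) \<le> 2 * b" "cost (add_t a (N - M)) \<le> 2 * b"
        using M s assms(2,3) by (intro cost_arith; auto)+
      then show ?thesis by (auto simp: gg truncate_t.simps)
    qed
    moreover have "cost (truncate_top_t N gs) = cost (extract_top_t N gs) + (cost (max_end_t hs) +
        (cost (add_t (max_end hs) 1) + (cost (max_t (ran_lo g) (max_end hs + 1)) +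
        (cost (sub_t (max (ran_lo g) (max_end hs + 1)) 1) + cost (truncate_t N M g hs)))))"
      using Some by (simp add: truncate_top_t_def q M_def)
    ultimately show ?thesis using c ext eb mh' b_pos by linarith
  qed
  also have "\<dots> \<le> 30 * (k + 1) * b" by (simp add: algebra_simps, use k_le b_pos in linarith)
  finally show ?thesis .
qed


lemma cost_round:
  assumes wf: "all_on N gs" and N: "0 \<le> N" and cnt: "0 \<le> cnt" "cnt + N \<le> N0" and k: "length gs \<le> k"
  shows "cost (round_t (N, gs, cnt)) \<le> 500 * ((k + 1) ^ 3 * (b * b * b))"
proof -
  define K where "K = k + 1"
  define Q where "Q = b * b * b"
  define M where "M = prep_size N gs"
  define cs where "cs = contracted N (live gs)"
  define hs where "hs = prep N gs"
  have NN: "N \<le> N0" using cnt by simp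
  have lwf: "all_on N (live gs)" by (rule live_on[OF wf])
  have ll: "length (live gs) \<le> k" unfolding live_def using length_filter_le k by (rule order_trans)
  have lc: "length cs \<le> k" using ll by (simp add: cs_def contracted_def)
  note pp = prep_props[OF wf N, folded M_def hs_def]
  have MN: "M \<le> N0" using pp(3) NN by simp
  note tc = trimmed_live(1)[OF wf N, folded M_def cs_def]
  have cwf: "all_on M cs" using contracted_on[OF lwf] by (simp add: M_def prep_size_def cs_def)
  have d: "val (delete_identities_t gs) = live gs" by (simp add: delete_identities_t_def live_def)
  have c: "val (contract_from_t 1 N (live gs) cnt) = (M, cs, cnt + (N - M))"
    using val_contract_from[of 1 "live gs" N cnt] lwf
    by (simp add: statics_def[symmetric] contracted_def M_def prep_size_def cs_def)
  have h: "val (merge_all_t (map (\<lambda>g. val (trim_t g)) cs)) = hs"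
    by (simp add: hs_def prep_def trimmed_def cs_def)
  have e: "cs = [] \<longleftrightarrow> hs = []"
    using prep_Nil[OF wf N] by (simp add: hs_def cs_def contracted_def)
  have c1: "cost (delete_identities_t gs) \<le> 7 * K * b"
    unfolding K_def by (rule cost_delete_identities[OF wf NN k])
  have c2: "cost (contract_from_t 1 N (live gs) cnt) \<le> 280 * (K * K) * b"
  proof -
    have "cost (contract_from_t 1 N (live gs) cnt) \<le> (pending 1 N (live gs) + 1) * (70 * (k + 1) * b)"
      using N cnt by (intro cost_contract_from[OF lwf _ _ NN N cnt ll]) auto
    also have "\<dots> \<le> (4 * K) * (70 * (k + 1) * b)"
      using pending_le[of 1 N "live gs"] ll by (intro mult_le_mono1) (simp add: K_def)
    also have "\<dots> = 280 * (K * K) * b" by (simp add: K_def algebra_simps)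
    finally show ?thesis .
  qed
  have c3: "cost (map_t trim_t cs) \<le> 13 * K * (b * b)"
  proof -
    have "cost (map_t trim_t cs) \<le> length cs * (8 * b + 2 * (b * b) + 1 + 1) + 1"
      using cwf by (intro cost_map_t cost_trim[OF _ MN]) blast
    also have "\<dots> \<le> k * (13 * (b * b)) + 13 * (b * b)"
    proof (rule affine_mono[OF lc])
      show "8 * b + 2 * (b * b) + 1 + 1 \<le> 13 * (b * b)" "1 \<le> 13 * (b * b)"
        using b_square(1) b_pos by linarith+
    qed
    finally show ?thesis by (simp add: K_def algebra_simps)
  qed
  have c4: "cost (merge_all_t (map (\<lambda>g. val (trim_t g)) cs)) \<le> 25 * (K * (K * K)) * Q"
  proof -
    have Q: "1 \<le> Q" using b_pos by (simp add: Q_def)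
    have "cost (merge_all_t (map (\<lambda>g. val (trim_t g)) cs))
        \<le> (length (trimmed cs) + 1) * (k * (k * (20 * (b * b * b) + 1) + 2) + 2)"
      using cost_merge_all[OF tc MN] lc by (simp add: trimmed_def)
    also have "\<dots> \<le> K * (K * K * (25 * Q))"
    proof (rule mult_le_mono)
      show "length (trimmed cs) + 1 \<le> K" using lc by (simp add: trimmed_def K_def)
      have "k * (k * (20 * Q + 1) + 2) + 2 \<le> k * (k * (21 * Q) + 2 * Q) + 2 * Q"
        using Q by (intro affine_mono le_refl) auto
      also have "\<dots> \<le> K * K * (25 * Q)" by (simp add: K_def algebra_simps)
      finally show "k * (k * (20 * (b * b * b) + 1) + 2) + 2 \<le> K * K * (25 * Q)" by (simp add: Q_def)
    qed
    finally show ?thesis by (simp add: mult_ac)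
  qed
  have tail: "cost (transmit_all_t M hs) + cost (truncate_top_t M (val (transmit_all_t M hs)))
      \<le> 90 * K * (b * b) + 30 * K * b" if "hs \<noteq> []"
  proof (rule add_mono)
    have lh: "length hs \<le> k" using pp(7) k by simp
    show "cost (transmit_all_t M hs) \<le> 90 * K * (b * b)"
      unfolding K_def by (rule cost_transmit_all[OF pp(1) that MN lh])
    obtain m rest where p: "pick hs = (m, rest)" by fastforce
    note pk = pick_props[OF pp(1) that p]
    have v: "val (transmit_all_t M hs) = m # map (transmit m) rest"
      using val_transmit_all[of "hd hs" "tl hs" m rest M] p pk(6) that by (simp add: pick_def)
    have "pairing_on M x" if "x \<in> set (map (transmit m) rest)" for x
    proof -
      have "pairing_on (M - 1) x" using that transmit_all_on[OF pp(1) \<open>hs \<noteq> []\<close> p] by blast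
      then show ?thesis by (cases x) auto
    qed
    moreover have "length hs = Suc (length rest)" using pk(1) by (metis length_Cons size_mset)
    ultimately show "cost (truncate_top_t M (val (transmit_all_t M hs))) \<le> 30 * K * b"
      unfolding v K_def using pk(5) pp(2) MN lh by (intro cost_truncate_top) auto
  qed
  have K: "1 \<le> K" by (simp add: K_def)
  have b: "1 \<le> b" using b_pos by simp
  define U where "U = K * (K * K) * Q"
  have KK: "K * 1 \<le> K * (K * K)" "K * K * 1 \<le> K * K * K" using K by (intro mult_le_mono2; simp)+
  have bQ: "b \<le> Q" "b * b \<le> Q" using b_square b unfolding Q_def by linarith+
  have U: "K * b \<le> U" "K * K * b \<le> U" "K * (b * b) \<le> U" "1 \<le> U"
  proof -
    show "K * b \<le> U" "K * (b * b) \<le> U" unfolding U_def using KK bQ by (intro mult_le_mono; simp)+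
    show "K * K * b \<le> U" unfolding U_def using KK(2) bQ by (intro mult_le_mono) (simp_all add: mult.assoc)
    show "1 \<le> U" using K b by (simp add: U_def Q_def)
  qed
  have eq: "7 * K * b = 7 * (K * b)" "280 * (K * K) * b = 280 * (K * K * b)" "13 * K * (b * b) = 13 * (K * (b * b))"
    "90 * K * (b * b) = 90 * (K * (b * b))" "30 * K * b = 30 * (K * b)" "25 * (K * (K * K)) * Q = 25 * U"
    by (simp_all add: U_def mult.assoc)
  have "cost (round_t (N, gs, cnt)) \<le> 500 * U"
  proof (cases "hs = []")
    case True
    then have "cost (round_t (N, gs, cnt)) = cost (delete_identities_t gs) + (cost (contract_from_t 1 N (live gs) cnt) + 1)"
      using e by (simp add: round_t.simps d c)
    then show ?thesis using c1 c2 U unfolding eq by linarith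
  next
    case False
    then have "cost (round_t (N, gs, cnt)) = cost (delete_identities_t gs) + (cost (contract_from_t 1 N (live gs) cnt) +
        (cost (map_t trim_t cs) + (cost (merge_all_t (map (\<lambda>g. val (trim_t g)) cs)) +
        (cost (transmit_all_t M hs) + (cost (truncate_top_t M (val (transmit_all_t M hs))) + 1)))))"
      using e by (simp add: round_t.simps d c h case_prod_unfold)
    then show ?thesis using c1 c2 c3 c4 tail[OF False] U unfolding eq by linarith
  qed
  moreover have "U = (k + 1) ^ 3 * (b * b * b)" by (simp add: U_def K_def Q_def power3_eq_cube mult.assoc)
  ultimately show ?thesis by simp
qed

end

section \<open>The polynomial bound\<close>

lemma bits_bound:
  assumes "1 \<le> N"
  shows "real (bits (4 * N + 4)) \<le> 6 * max 1 (log 2 (real_of_int N))"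
proof -
  have "bitlen (4 * N + 4) = \<lfloor>log 2 (4 * N + 4)\<rfloor> + 1" using assms by (simp add: bitlen_alt_def)
  then have "real_of_int (bitlen (4 * N + 4)) \<le> log 2 (4 * N + 4) + 1" by simp
  also have "log 2 (4 * N + 4) \<le> log 2 (2 ^ 3 * N)" using assms by (subst log_le_cancel_iff) auto
  also have "\<dots> = log 2 (2 ^ 3 * real_of_int N)" by simp
  also have "\<dots> = log 2 (2 ^ 3) + log 2 N" using assms by (intro log_mult_pos) auto
  also have "log 2 (2 ^ 3 :: real) = 3" by (subst log_nat_power) auto
  finally have "real_of_int (bitlen (4 * N + 4)) \<le> 4 + log 2 N" by simp
  moreover have "0 \<le> bitlen (4 * N + 4)" by (rule bitlen_nonneg)
  moreover have "\<bar>4 * N + 4\<bar> = 4 * N + 4" using assms by simp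
  ultimately have "real (bits (4 * N + 4)) \<le> 5 + log 2 N" by (simp add: bits_def)
  then show ?thesis by simp
qed

text \<open>
  Crude estimates: \<open>price\<close>, \<open>weight\<close> and the range of the potential are polynomials in \<open>X\<close> of degrees
  \<open>2\<close>, \<open>3\<close> and \<open>5\<close>, and the factor \<open>cap + 2\<close> has degree \<open>1\<close>.
\<close>

lemma spread_bound:
  fixes X :: real
  assumes N: "1 \<le> N" "log 2 (real_of_int N) \<le> X" and k: "real k \<le> X" and X: "1 \<le> X"
  shows "spread N k + 1 \<le> 1930 * X ^ 6"
proof -
  have pw: "X ^ i \<le> X ^ j" if "i \<le> j" for i j :: nat using X that by (rule power_increasing[rotated])
  have pos: "0 \<le> X" "0 \<le> X ^ n" for n using X by simp_all
  have ln54: "1 / 5 \<le> ln (5/4 :: real)" "ln (5/4 :: real) \<le> 1 / 4"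
  proof -
    have "ln (4/5 :: real) \<le> 4/5 - 1" by (rule ln_le_minus_one) simp
    moreover have "ln (4/5 :: real) = - ln (5/4)" by (simp add: ln_div)
    ultimately show "1 / 5 \<le> ln (5/4 :: real)" by simp
    show "ln (5/4 :: real) \<le> 1 / 4" using ln_le_minus_one[of "5/4 :: real"] by simp
  qed
  have lnN: "0 \<le> ln (real_of_int N)" "ln (real_of_int N) \<le> X"
  proof -
    show nn: "0 \<le> ln (real_of_int N)" using N(1) by simp
    have "ln (real_of_int N) = log 2 N * ln 2" by (simp add: log_def)
    also have "\<dots> \<le> log 2 N * 1"
      using N(1) ln_le_minus_one[of "2 :: real"] by (intro mult_left_mono) auto
    finally show "ln (real_of_int N) \<le> X" using N(2) by simp
  qed
  have cap: "0 \<le> cap N + 2" "cap N + 2 \<le> 5 * X" "cap N + 1 \<le> 4 * X"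
  proof -
    have "cap N = 2 + log 2 N" using N(1) by (simp add: cap_def log_mult)
    moreover have "0 \<le> log 2 N" using N(1) by simp
    ultimately show "0 \<le> cap N + 2" "cap N + 2 \<le> 5 * X" "cap N + 1 \<le> 4 * X" using N(2) X by linarith+
  qed
  have price: "price k \<le> 37 * X ^ 2"
  proof -
    have "(real k + 2)\<^sup>2 \<le> (3 * X)\<^sup>2" using k X by (intro power_mono) auto
    then show ?thesis using pw[of 0 2] by (simp add: price_def power_mult_distrib)
  qed
  have p0: "0 \<le> price k" by (simp add: price_def)
  have weight: "0 \<le> weight k" "weight k \<le> 75 * X ^ 3"
  proof -
    show "0 \<le> weight k" using p0 by (simp add: weight_def)
    have "real k * price k \<le> X * (37 * X ^ 2)" using k price p0 pos by (intro mult_mono) auto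
    also have "\<dots> = 37 * X ^ 3" by (simp add: power2_eq_square power3_eq_cube)
    finally show "weight k \<le> 75 * X ^ 3" using pw[of 0 3] by (simp add: weight_def)
  qed
  define T where "T = real k * ln N + real k * (weight k * ln N + ln (5/4))"
  have T: "0 \<le> T" "T \<le> 77 * X ^ 5"
  proof -
    show "0 \<le> T" using weight lnN by (simp add: T_def)
    have "real k * ln N \<le> X * X" using k lnN pos by (intro mult_mono) auto
    moreover have "weight k * ln N \<le> 75 * X ^ 3 * X" using weight lnN pos by (intro mult_mono) auto
    moreover have "X * X = X ^ 2" "75 * X ^ 3 * X = 75 * X ^ 4" by (simp_all add: power2_eq_square eval_nat_numeral)
    ultimately have "real k * ln N \<le> X ^ 2" "weight k * ln N + ln (5/4) \<le> 76 * X ^ 4"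
      using ln54 pw[of 0 4] by simp_all
    moreover from this have "real k * (weight k * ln N + ln (5/4)) \<le> X * (76 * X ^ 4)"
      using k weight lnN pos by (intro mult_mono) auto
    moreover have "X * (76 * X ^ 4) = 76 * X ^ 5" by (simp add: eval_nat_numeral)
    ultimately show "T \<le> 77 * X ^ 5" using pw[of 2 5] by (simp add: T_def)
  qed
  have "T / ln (5/4) \<le> T / (1/5)" using ln54 T by (intro divide_left_mono) auto
  also have "\<dots> \<le> 385 * X ^ 5" using T by simp
  finally have "T / ln (5/4) * (cap N + 2) \<le> 385 * X ^ 5 * (5 * X)"
    using cap pos by (intro mult_mono) auto
  also have "\<dots> = 1925 * X ^ 6" by (simp add: eval_nat_numeral)
  finally have "T / ln (5/4) * (cap N + 2) \<le> 1925 * X ^ 6" .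
  then show ?thesis using cap(3) pw[of 1 6] pw[of 0 6] X by (simp add: spread_def T_def)
qed

text \<open>
  There are \<open>O(X ^ 7)\<close> rounds, each of cost \<open>O(X ^ 6)\<close>.
\<close>

lemma time_bound:
  fixes N :: int and gs :: "pairing list"
  assumes N: "1 \<le> N" and wf: "all_on N gs"
  defines "X \<equiv> real (max 1 (length gs)) * max 1 (log 2 (real_of_int N))"
  shows "\<exists>time. orbit_counting N gs = Some (int (card (orbits N gs)), time) \<and>
    real time \<le> 3862 * 864000 * X ^ 13"
proof -
  define k where "k = length gs"
  define b where "b = bits (4 * N + 4)"
  interpret bounded_size N k b by unfold_locales (simp_all add: N b_def)
  define C where "C = 500 * ((k + 1) ^ 3 * (b * b * b))"
  define n where "n = nat \<lfloor>rank N k N gs\<rfloor> + 1"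
  have r: "0 \<le> rank N k N gs" "rank N k N gs \<le> (real k + 1) * (spread N k + 1)"
    using rank_nonneg[OF wf _ order_refl _ N, of k] N by (simp_all add: k_def)
  then have "rank N k N gs < n" "real n \<le> rank N k N gs + 1" by (simp_all add: n_def) linarith+
  then obtain time where time: "time \<le> n * C"
    "orbit_counting_loop (N, gs, 0) = Some (0 + int (card ({1..N} // eqv gs)), time)"
    using loop_total[OF cost_round[folded C_def] N, where N = N and gs = gs and cnt = 0 and n = n] wf N
    by (auto simp: k_def)
  have big: "1 \<le> real (max 1 (length gs))" "1 \<le> max 1 (log 2 (real_of_int N))" by simp_all
  have X: "1 \<le> X" "real k \<le> X" "log 2 (real_of_int N) \<le> X" "max 1 (log 2 (real_of_int N)) \<le> X"
  proof -
    have "real (max 1 (length gs)) * 1 \<le> X" "1 * max 1 (log 2 (real_of_int N)) \<le> X"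
      unfolding X_def using big by (intro mult_mono; simp)+
    then show "1 \<le> X" "real k \<le> X" "log 2 (real_of_int N) \<le> X" "max 1 (log 2 (real_of_int N)) \<le> X"
      by (auto simp: k_def)
  qed
  have sp: "spread N k + 1 \<le> 1930 * X ^ 6" using X N by (intro spread_bound) auto
  have pw: "X ^ i \<le> X ^ j" if "i \<le> j" for i j :: nat using X(1) that by (rule power_increasing[rotated])
  have pos: "0 \<le> X" "0 \<le> X ^ n" for n using X(1) by simp_all
  have "(real k + 1) * (spread N k + 1) \<le> (real k + 1) * (1930 * X ^ 6)" using sp by (intro mult_left_mono) auto
  also have "\<dots> \<le> 2 * X * (1930 * X ^ 6)" using X pos by (intro mult_right_mono) auto
  also have "\<dots> = 3860 * X ^ 7" by (simp add: eval_nat_numeral)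
  finally have n: "real n \<le> 3862 * X ^ 7" using r(2) \<open>real n \<le> rank N k N gs + 1\<close> pw[of 0 7] by simp
  have b: "real b \<le> 6 * X" using bits_bound[OF N] X(4) unfolding b_def by linarith
  have "real C = 500 * ((real k + 1) ^ 3 * real b ^ 3)"
    by (simp only: C_def of_nat_mult of_nat_add of_nat_1 of_nat_numeral power3_eq_cube mult.assoc)
  also have "\<dots> \<le> 500 * ((2 * X) ^ 3 * (6 * X) ^ 3)"
    using b X pos by (intro mult_left_mono mult_mono power_mono) auto
  also have "\<dots> = 864000 * X ^ 6" by (simp add: power_mult_distrib eval_nat_numeral)
  finally have C: "real C \<le> 864000 * X ^ 6" .
  have "real time \<le> real n * real C" using time(1) by (metis of_nat_le_iff of_nat_mult)
  also have "\<dots> \<le> 3862 * X ^ 7 * (864000 * X ^ 6)" using n C pos by (intro mult_mono) auto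
  also have "\<dots> = 3862 * 864000 * X ^ 13" by (simp add: eval_nat_numeral)
  finally show ?thesis using time(2) orbits_eq[OF wf] by (auto simp: orbit_counting_def)
qed

theorem theorem12:
  shows "\<exists>P :: real poly. \<forall>(N :: int) (gs :: pairing list).
    1 \<le> N \<longrightarrow> (\<forall>g \<in> set gs. pairing_on N g) \<longrightarrow>
    (\<exists>time :: nat.
       orbit_counting N gs = Some (int (card (orbits N gs)), time) \<and>
       real time \<le> poly P (real (max 1 (length gs)) * max 1 (log 2 (real_of_int N))))"
  using time_bound by (intro exI[of _ "monom (3862 * 864000) 13"]) (simp add: poly_monom)

end
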